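(* Let $\{g_j\}_{j\in I_x}\subset\mathbb{R}[X]$ and $\{h_k\}_{k\in I_{yz}}\subset\mathbb{R}[Y,Z]$ be finite families of polynomials, where $X=(X_1,\ldots,X_n)$, $Y=(Y_1,\ldots,Y_m)$, $Z=(Z_1,\ldots,Z_p)$, and let $$K_x=\{x\in\mathbb{R}^n : g_j(x)\ge 0,\ j\in I_x\},\qquad K_{yz}=\{(y,z)\in\mathbb{R}^{m+p} : h_k(y,z)\ge 0,\ k\in I_{yz}\}.$$ Assume that $K_x$ and $K_{yz}$ are compact and that $K:=K_x\times K_{yz}\subset\mathbb{R}^{n+m+p}$ has nonempty interior. Let $f\in\mathbb{R}[X,Y]+\mathbb{R}[Y,Z]$. Then: (a) If $f>0$ on $K$, then $f\in\Sigma^2_{xy}+P(g)+P(h)$. (b) Suppose $f>0$ on $K$. If $N-\|X\|^2\in Q(g)$ for some scalar $N$, then in (a) one may replace $P(g)$ with $Q(g)$, i.e. $f\in\Sigma^2_{xy}+Q(g)+P(h)$. If $N-\|(Y,Z)\|^2\in Q(h)$ for some scalar $N$, then in (a) one may replace $P(h)$ with $Q(h)$, i.e. $f\in\Sigma^2_{xy}+P(g)+Q(h)$. If both conditions hold, then both replacements may be made simultaneously, i.e. $f\in\Sigma^2_{xy}+Q(g)+Q(h)$.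
   Context: $\mathbb{R}[X]$, $\mathbb{R}[X,Y]$, $\mathbb{R}[Y,Z]$ are real polynomial rings, regarded as subrings of $\mathbb{R}[X,Y,Z]$; $\mathbb{R}[X,Y]+\mathbb{R}[Y,Z]$ is the set of sums of an element of $\mathbb{R}[X,Y]$ and an element of $\mathbb{R}[Y,Z]$. Sums of sets such as $\Sigma^2_{xy}+P(g)+P(h)$ are Minkowski sums in $\mathbb{R}[X,Y,Z]$. The norm $\|\cdot\|$ is Euclidean, so $\|X\|^2=\sum_i X_i^2$ and $\|(Y,Z)\|^2=\sum_i Y_i^2+\sum_i Z_i^2$. Let $\Sigma^2_x\subset\mathbb{R}[X]$, $\Sigma^2_{xy}\subset\mathbb{R}[X,Y]$ and $\Sigma^2_{yz}\subset\mathbb{R}[Y,Z]$ be the sets of (finite) sums of squares of elements of $\mathbb{R}[X]$, of $\mathbb{R}[X,Y]$ and of $\mathbb{R}[Y,Z]$, respectively. Preordering: $P(g)\subset\mathbb{R}[X]$ is the set of all $\sum_{J\subseteq I_x}\sigma_J\prod_{j\in J}g_j$ with $\sigma_J\in\Sigma^2_x$ for every $J\subseteq I_x$ (the empty product being $1$). $P(h)\subset\mathbb{R}[Y,Z]$ is the set of all $\sum_{L\subseteq I_{yz}}\psi_L\prod_{k\in L}h_k$ with $\psi_L\in\Sigma^2_{yz}$. Quadratic module: $Q(g)\subset\mathbb{R}[X]$ is the set of all $\sigma_0+\sum_{j\in I_x}\sigma_j g_j$, where $\sigma_0$ and all the $\sigma_j$ are in $\Sigma^2_x$ ($\sigma_0$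 being a separate term, not attached to any index of $I_x$). $Q(h)\subset\mathbb{R}[Y,Z]$ is the set of all $\psi_0+\sum_{k\in I_{yz}}\psi_k h_k$, where $\psi_0$ and all the $\psi_k$ are in $\Sigma^2_{yz}$ ($\psi_0$ again being a separate term). *)

theory Defs
  imports "HOL-Analysis.Analysis" "HOL-Library.Poly_Mapping" "HOL-Library.Set_Algebras"
begin

datatype ('n, 'm, 'p) xyz_var = VX 'n | VY 'm | VZ 'p

text \<open>
  The ring of real polynomials in the variables \<open>X\<^sub>i\<close>, \<open>Y\<^sub>i\<close>, \<open>Z\<^sub>i\<close>, whose indices range over the
  finite types \<open>'n\<close>, \<open>'m\<close>, \<open>'p\<close>. A polynomial is a finitely supported map from monomials to
  coefficients, and a monomial is a finitely supported map from variables to exponents; the ring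
  operations are those of the library type of finitely supported maps.
\<close>
type_synonym ('n, 'm, 'p) xyz_poly = "(('n, 'm, 'p) xyz_var \<Rightarrow>\<^sub>0 nat) \<Rightarrow>\<^sub>0 real"

definition Const :: "real \<Rightarrow> ('n, 'm, 'p) xyz_poly" where
  "Const c = Poly_Mapping.single 0 c"

definition Var :: "('n, 'm, 'p) xyz_var \<Rightarrow> ('n, 'm, 'p) xyz_poly" where
  "Var v = Poly_Mapping.single (Poly_Mapping.single v 1) 1"

definition poly_eval :: "('n, 'm, 'p) xyz_poly \<Rightarrow> (('n, 'm, 'p) xyz_var \<Rightarrow> real) \<Rightarrow> real" where
  "poly_eval q a =
     (\<Sum>t\<in>Poly_Mapping.keys q.
        Poly_Mapping.lookup q t * (\<Prod>v\<in>Poly_Mapping.keys t. a v ^ Poly_Mapping.lookup t v))"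

fun point :: "real ^ 'n \<Rightarrow> real ^ 'm \<Rightarrow> real ^ 'p \<Rightarrow> ('n, 'm, 'p) xyz_var \<Rightarrow> real" where
  "point x y z (VX i) = x $ i"
| "point x y z (VY i) = y $ i"
| "point x y z (VZ i) = z $ i"

definition polys_in :: "('n, 'm, 'p) xyz_var set \<Rightarrow> ('n, 'm, 'p) xyz_poly set" where
  "polys_in V = {q. \<forall>t\<in>Poly_Mapping.keys q. Poly_Mapping.keys t \<subseteq> V}"

definition RX :: "('n, 'm, 'p) xyz_poly set" where
  "RX = polys_in (range VX)"

definition RXY :: "('n, 'm, 'p) xyz_poly set" where
  "RXY = polys_in (range VX \<union> range VY)"

definition RYZ :: "('n, 'm, 'p) xyz_poly set" where
  "RYZ = polys_in (range VY \<union> range VZ)"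

definition sos :: "('n, 'm, 'p) xyz_poly set \<Rightarrow> ('n, 'm, 'p) xyz_poly set" where
  "sos R = {\<Sum>i<k. q i ^ 2 | (k :: nat) q. \<forall>i<k. q i \<in> R}"

definition poly_preordering ::
  "('n, 'm, 'p) xyz_poly set \<Rightarrow> 'j set \<Rightarrow> ('j \<Rightarrow> ('n, 'm, 'p) xyz_poly) \<Rightarrow> ('n, 'm, 'p) xyz_poly set"
where
  "poly_preordering R I g =
     {\<Sum>J\<in>Pow I. \<sigma> J * (\<Prod>j\<in>J. g j) | \<sigma>. \<forall>J\<in>Pow I. \<sigma> J \<in> sos R}"

definition quadratic_module ::
  "('n, 'm, 'p) xyz_poly set \<Rightarrow> 'j set \<Rightarrow> ('j \<Rightarrow> ('n, 'm, 'p) xyz_poly) \<Rightarrow> ('n, 'm, 'p) xyz_poly set"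
where
  "quadratic_module R I g =
     {\<sigma>0 + (\<Sum>j\<in>I. \<sigma> j * g j) | \<sigma>0 \<sigma>. \<sigma>0 \<in> sos R \<and> (\<forall>j\<in>I. \<sigma> j \<in> sos R)}"

text \<open>
  Members of \<open>RX\<close> and \<open>RYZ\<close> are elements of the big ring, so evaluating them needs a value for every
  variable; the coordinates set to \<open>0\<close> below are those on which such polynomials do not depend.
\<close>
definition K_x :: "'j set \<Rightarrow> ('j \<Rightarrow> ('n::finite, 'm::finite, 'p::finite) xyz_poly) \<Rightarrow> (real ^ 'n) set" where
  "K_x I g = {x. \<forall>j\<in>I. poly_eval (g j) (point x 0 0) \<ge> 0}"

definition K_yz ::
  "'k set \<Rightarrow> ('k \<Rightarrow> ('n::finite, 'm::finite, 'p::finite) xyz_poly) \<Rightarrow> ((real ^ 'm) \<times> (real ^ 'p)) set" where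
  "K_yz I h = {(y, z). \<forall>k\<in>I. poly_eval (h k) (point 0 y z) \<ge> 0}"

definition norm_sq_X :: "('n::finite, 'm, 'p) xyz_poly" where
  "norm_sq_X = (\<Sum>i\<in>UNIV. Var (VX i) ^ 2)"

definition norm_sq_YZ :: "('n, 'm::finite, 'p::finite) xyz_poly" where
  "norm_sq_YZ = (\<Sum>i\<in>UNIV. Var (VY i) ^ 2) + (\<Sum>i\<in>UNIV. Var (VZ i) ^ 2)"

end

theory Submission
  imports Defs "HOL-Algebra.Algebraic_Closure_Type" "HOL-Computational_Algebra.Fraction_Field"
begin

text \<open>
  Write \<open>f = f\<^sub>1 + f\<^sub>2\<close> with \<open>f\<^sub>1\<close> in the variables \<open>X, Y\<close> and \<open>f\<^sub>2\<close> in \<open>Y, Z\<close>. The function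
  \<open>l(y) = min {f\<^sub>1(x, y) | x \<in> K\<^sub>x}\<close> is continuous, and \<open>f\<^sub>2(y, z) + l(y) > 0\<close> on \<open>K\<^sub>y\<^sub>z\<close>. A polynomial \<open>p(Y)\<close>
  uniformly close to \<open>\<epsilon> - l\<close> on a ball \<open>B\<close> containing the projection of \<open>K\<^sub>y\<^sub>z\<close> makes both \<open>f\<^sub>1 + p > 0\<close> on
  \<open>K\<^sub>x \<times> B\<close> and \<open>f\<^sub>2 - p > 0\<close> on \<open>K\<^sub>y\<^sub>z\<close>. The latter is handled by the theorems of Schmuedgen and Putinar.

  For \<open>f\<^sub>1 + p\<close>, the archimedean Positivstellensatz gives a representation \<open>\<delta> + \<Sum>u\<^sub>i q\<^sub>i\<^sup>2\<close> where \<open>q\<^sub>i\<close> involves \<open>X\<close> and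
  \<open>Y\<close>, and the weight \<open>u\<^sub>i\<close> depends on \<open>X\<close> only or on \<open>Y\<close> only and is positive on \<open>K\<^sub>x\<close> or \<open>B\<close>. Replacing \<open>u\<^sub>i\<close> by
  the square of a polynomial approximation of its square root, in the same variables, costs an error
  which \<open>\<delta>\<close> absorbs modulo sums of squares and positive polynomials in the separate variables.

  The archimedean Positivstellensatz holds because the standard part modulo a maximal proper quadratic
  module is a ring homomorphism to the reals. That the preordering of a compact set is archimedean
  follows, by Woermann's argument, from an identity \<open>p b = 1 + q\<close> for \<open>b = N - \<parallel>x\<parallel>\<^sup>2\<close>; without such an identity
  some ordering of the coordinate ring would make all \<open>g\<^sub>j\<close> nonnegative and \<open>b\<close> nonpositive, and by
  Hormander's elimination of variables, applied in the real closure of its residue field, the same signs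
  would occur at a real point.
\<close>

text \<open>The theory of algebraic closures brings homonyms of these polynomial constants into scope.\<close>

hide_const (open) up_ring.coeff up_ring.monom module.smult Coset.order Divisibility.prime
  Polynomials.lead_coeff Polynomials.degree

section \<open>Polynomials with coefficients in a subring\<close>

text \<open>What forbids a direct appeal to a Positivstellensatz on the product of K_x and B is the
  shape of the answer: such a certificate multiplies weights by squares in X and Y together, whereas
  only plain sums of squares may mix the variables. A weight can be traded for a square because it
  involves one group of variables only: its square root is a continuous function of that group, and
  the error is split between the groups by 2ab = (a + b)^2 - a^2 - b^2. Two further obstacles are
  formal. All rings of the theorem sit inside one type, so subrings are sets, and a certificate
  found in the full ring is pulled back by setting the foreign variables to zero. Elimination runs
  over rings of polynomials, which are mapped into two fields at once; hence divisions are
  pseudo-divisions, and leading coefficients may vanish in the images.\<close>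

definition subring_set :: "'a::comm_ring_1 set \<Rightarrow> bool" where
  "subring_set S \<longleftrightarrow> 0 \<in> S \<and> 1 \<in> S \<and> (\<forall>a\<in>S. \<forall>b\<in>S. a + b \<in> S \<and> a - b \<in> S \<and> a * b \<in> S)"

definition polys_over :: "'a::comm_ring_1 set \<Rightarrow> 'a poly set" where
  "polys_over S = {f. \<forall>i. coeff f i \<in> S}"

lemma subring_setD:
  assumes "subring_set S"
  shows "0 \<in> S" "1 \<in> S" "a \<in> S \<Longrightarrow> b \<in> S \<Longrightarrow> a + b \<in> S" "a \<in> S \<Longrightarrow> b \<in> S \<Longrightarrow> a - b \<in> S"
    "a \<in> S \<Longrightarrow> b \<in> S \<Longrightarrow> a * b \<in> S" "a \<in> S \<Longrightarrow> - a \<in> S"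
proof -
  show "0 \<in> S" "1 \<in> S" "a \<in> S \<Longrightarrow> b \<in> S \<Longrightarrow> a + b \<in> S" "a \<in> S \<Longrightarrow> b \<in> S \<Longrightarrow> a - b \<in> S"
    "a \<in> S \<Longrightarrow> b \<in> S \<Longrightarrow> a * b \<in> S"
    using assms unfolding subring_set_def by auto
  show "a \<in> S \<Longrightarrow> - a \<in> S"
    using assms unfolding subring_set_def by (metis diff_0)
qed

lemma subring_set_power: "subring_set S \<Longrightarrow> a \<in> S \<Longrightarrow> a ^ n \<in> S"
  by (induction n) (auto simp: subring_setD)

lemma subring_set_sum: "subring_set S \<Longrightarrow> (\<And>i. i \<in> I \<Longrightarrow> f i \<in> S) \<Longrightarrow> sum f I \<in> S"
  by (induction I rule: infinite_finite_induct) (auto simp: subring_setD)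

lemma subring_set_of_nat: "subring_set S \<Longrightarrow> of_nat n \<in> S"
  by (induction n) (auto simp: subring_setD)

lemma subring_set_UNIV: "subring_set UNIV"
  by (simp add: subring_set_def)

lemma subring_polys_over: assumes "subring_set S" shows "subring_set (polys_over S)"
  unfolding subring_set_def[of "polys_over S"]
proof (intro conjI ballI)
  show "0 \<in> polys_over S" "1 \<in> polys_over S"
    by (simp_all add: polys_over_def coeff_1 subring_setD[OF assms])
  fix f g assume "f \<in> polys_over S" "g \<in> polys_over S"
  then show "f + g \<in> polys_over S" "f - g \<in> polys_over S" "f * g \<in> polys_over S"
    unfolding polys_over_def mem_Collect_eq coeff_mult coeff_add coeff_diff
    by (blast intro: subring_setD[OF assms] subring_set_sum[OF assms])+
qed

lemma polys_over_smult: "subring_set S \<Longrightarrow> c \<in> S \<Longrightarrow> f \<in> polys_over S \<Longrightarrow> smult c f \<in> polys_over S"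
  by (auto simp: polys_over_def subring_setD)

lemma polys_over_monom: "subring_set S \<Longrightarrow> c \<in> S \<Longrightarrow> monom c n \<in> polys_over S"
  by (auto simp: polys_over_def subring_setD)

lemma polys_over_pCons [simp]:
  "pCons c f \<in> polys_over S \<longleftrightarrow> c \<in> S \<and> f \<in> polys_over S"
  unfolding polys_over_def mem_Collect_eq coeff_pCons by (force split: nat.splits)

lemma lead_coeff_polys_over: "f \<in> polys_over S \<Longrightarrow> lead_coeff f \<in> S"
  by (auto simp: polys_over_def)

lemma poly_in_subring: "subring_set S \<Longrightarrow> f \<in> polys_over S \<Longrightarrow> a \<in> S \<Longrightarrow> poly f a \<in> S"
  by (induction f) (auto simp: subring_setD)

text \<open>Every elimination of a leading term multiplies \<open>f\<close> by
  \<open>lead_coeff g\<close> in place of a division. The identity thus holds over any commutative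
  ring, stays within \<open>S\<close>, and survives ring homomorphisms.\<close>

lemma pseudo_division_over:
  assumes S: "subring_set S" and "f \<in> polys_over S" and g: "g \<in> polys_over S" "degree g > 0"
  shows "\<exists>e q r. q \<in> polys_over S \<and> r \<in> polys_over S \<and>
           smult (lead_coeff g ^ e) f = g * q + r \<and> degree r < degree g"
  using assms(2)
proof (induction "degree f" arbitrary: f rule: less_induct)
  case less
  note PS = subring_setD[OF subring_polys_over[OF S]]
  show ?case
  proof (cases "degree f < degree g")
    case True
    have "smult (lead_coeff g ^ 0) f = g * 0 + f" by simp
    with True less.prems PS(1) show ?thesis by blast
  next
    case False
    define m where "m = monom (lead_coeff f) (degree f - degree g)"
    define f1 where "f1 = smult (lead_coeff g) f - m * g"
    have m: "m \<in> polys_over S"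
      unfolding m_def by (intro polys_over_monom S lead_coeff_polys_over less.prems)
    have f1: "f1 \<in> polys_over S"
      unfolding f1_def
      by (intro PS polys_over_smult S lead_coeff_polys_over g less.prems m)
    \<comment> \<open>Degrees are compared through coefficients, since the degree of a product may
      drop in a ring with zero divisors.\<close>
    have "coeff f1 i = 0" if "i \<ge> degree f" for i
    proof (cases "i = degree f")
      case True
      then show ?thesis using False
        unfolding f1_def m_def coeff_diff coeff_smult coeff_monom_mult by (simp add: mult.commute)
    next
      case F: False
      then have "i > degree f" using that by simp
      moreover from this have "i - (degree f - degree g) > degree g" using False by linarith
      ultimately show ?thesis using False
        unfolding f1_def m_def coeff_diff coeff_smult coeff_monom_mult by (simp add: coeff_eq_0)
    qed
    then have "degree f1 < degree f"
      using False g(2) by (metis (no_types, lifting) degree_0 leading_coeff_0_iff linorder_not_le order.strict_trans2)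
    from less.hyps[OF this f1] obtain e q r where qr: "q \<in> polys_over S" "r \<in> polys_over S"
      "smult (lead_coeff g ^ e) f1 = g * q + r" "degree r < degree g" by blast
    have "smult (lead_coeff g ^ Suc e) f = smult (lead_coeff g ^ e) f1 + smult (lead_coeff g ^ e) (m * g)"
      unfolding f1_def by (simp add: smult_diff_right mult.commute)
    also have "\<dots> = g * (q + smult (lead_coeff g ^ e) m) + r"
      unfolding qr(3) by (simp add: algebra_simps)
    finally have "smult (lead_coeff g ^ Suc e) f = g * (q + smult (lead_coeff g ^ e) m) + r" .
    moreover have "q + smult (lead_coeff g ^ e) m \<in> polys_over S"
      by (intro PS qr polys_over_smult S subring_set_power lead_coeff_polys_over g m)
    ultimately show ?thesis using qr by blast
  qed
qed

section \<open>The real closure of an ordered field\<close>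

text \<open>The intended nonnegative part of a subring of the algebraic closure, the subring being
  \<open>differences P\<close>; the clause on \<open>(a - b)\<^sup>2\<close> puts all squares of
  that subring into the cone. One set thus encodes both a ring and an order, and Zorn's lemma
  applies to plain inclusion.\<close>

definition ordcone :: "'a::linordered_field alg_closure set \<Rightarrow> bool" where
  "ordcone P \<longleftrightarrow> (\<forall>c\<ge>0. to_ac c \<in> P)
     \<and> (\<forall>a\<in>P. \<forall>b\<in>P. a + b \<in> P \<and> a * b \<in> P \<and> (a - b)\<^sup>2 \<in> P)
     \<and> (\<forall>a\<in>P. - a \<in> P \<longrightarrow> a = 0)"

definition max_ordcone :: "'a::linordered_field alg_closure set \<Rightarrow> bool" where
  "max_ordcone P \<longleftrightarrow> ordcone P \<and> (\<forall>P'. ordcone P' \<longrightarrow> P \<subseteq> P' \<longrightarrow> P' = P)"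

definition differences :: "'a::ab_group_add set \<Rightarrow> 'a set" where
  "differences P = {a - b | a b. a \<in> P \<and> b \<in> P}"

lemma ordconeD:
  assumes "ordcone P"
  shows "c \<ge> 0 \<Longrightarrow> to_ac c \<in> P" "a \<in> P \<Longrightarrow> b \<in> P \<Longrightarrow> a + b \<in> P"
    "a \<in> P \<Longrightarrow> b \<in> P \<Longrightarrow> a * b \<in> P" "s \<in> differences P \<Longrightarrow> s\<^sup>2 \<in> P"
    "a \<in> P \<Longrightarrow> - a \<in> P \<Longrightarrow> a = 0" "0 \<in> P" "1 \<in> P" "a \<in> P \<Longrightarrow> a \<in> differences P"
proof -
  show 0: "0 \<in> P" "1 \<in> P"
    using assms unfolding ordcone_def by (metis order_refl to_ac_0, metis zero_le_one to_ac_1)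
  show "a \<in> P \<Longrightarrow> a \<in> differences P"
    unfolding differences_def using 0(1) by force
qed (use assms in \<open>auto simp: ordcone_def differences_def\<close>)

lemma ordcone_base: "ordcone (to_ac ` {c::'a::linordered_field. c \<ge> 0})"
  unfolding ordcone_def
proof (intro conjI ballI allI impI)
  fix a b :: "'a alg_closure"
  assume a: "a \<in> to_ac ` {c. c \<ge> 0}" and "b \<in> to_ac ` {c. c \<ge> 0}"
  then obtain c d where cd: "a = to_ac c" "b = to_ac d" "c \<ge> 0" "d \<ge> 0" by auto
  have "a + b = to_ac (c + d)" "a * b = to_ac (c * d)" "(a - b)\<^sup>2 = to_ac ((c - d)\<^sup>2)"
    using cd by simp_all
  moreover have "0 \<le> c + d" "0 \<le> c * d" "0 \<le> (c - d)\<^sup>2" using cd by simp_all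
  ultimately show "a + b \<in> to_ac ` {c. c \<ge> 0}" "a * b \<in> to_ac ` {c. c \<ge> 0}"
    "(a - b)\<^sup>2 \<in> to_ac ` {c. c \<ge> 0}" by blast+
next
  fix a :: "'a alg_closure"
  assume "a \<in> to_ac ` {c. c \<ge> 0}" and "- a \<in> to_ac ` {c. c \<ge> 0}"
  then obtain c d where "a = to_ac c" "- a = to_ac d" "c \<ge> 0" "d \<ge> 0" by auto
  moreover from this have "to_ac (c + d) = to_ac 0"
    by (metis add.right_inverse to_ac_0 to_ac_add)
  then have "c + d = 0" by (simp only: to_ac_eq_iff)
  ultimately show "a = 0" by (simp add: add_nonneg_eq_0_iff)
qed auto

lemma max_ordcone_exists: "\<exists>P :: 'a::linordered_field alg_closure set. max_ordcone P"
proof -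
  define A where "A = {P :: 'a alg_closure set. ordcone P}"
  have "\<exists>M\<in>A. \<forall>B\<in>A. M \<subseteq> B \<longrightarrow> B = M"
  proof (rule subset_Zorn_nonempty)
    show "A \<noteq> {}" unfolding A_def using ordcone_base by blast
  next
    fix C assume ne: "C \<noteq> {}" and "subset.chain A C"
    then have C: "C \<subseteq> Collect ordcone" "\<And>B D. B \<in> C \<Longrightarrow> D \<in> C \<Longrightarrow> B \<subseteq> D \<or> D \<subseteq> B"
      by (auto simp: subset.chain_def A_def)
    have two: "\<exists>B\<in>C. a \<in> B \<and> b \<in> B" if "a \<in> Union C" "b \<in> Union C" for a b
      using that C(2) by blast
    have "ordcone (Union C)"
      unfolding ordcone_def
    proof (intro conjI ballI allI impI)
      fix c :: 'a assume "c \<ge> 0"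
      then show "to_ac c \<in> Union C" using ne C(1) ordconeD(1) by blast
    next
      fix a b assume "a \<in> Union C" "b \<in> Union C"
      from two[OF this] obtain B where "B \<in> C" "a \<in> B" "b \<in> B" by blast
      with C(1) show "a + b \<in> Union C" "a * b \<in> Union C" "(a - b)\<^sup>2 \<in> Union C"
        unfolding ordcone_def by blast+
    next
      fix a assume "a \<in> Union C" "- a \<in> Union C"
      from two[OF this] obtain B where "B \<in> C" "a \<in> B" "- a \<in> B" by blast
      with C(1) show "a = 0" unfolding ordcone_def by blast
    qed
    then show "Union C \<in> A" by (simp add: A_def)
  qed
  then show ?thesis unfolding max_ordcone_def A_def by auto
qed

section \<open>The ordered field cut out by a maximal cone\<close>

locale maximal_ordcone =
  fixes P :: "'a::linordered_field alg_closure set"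
  assumes max: "max_ordcone P"
begin

definition S where "S = differences P"

lemma cone: "ordcone P" using max by (simp add: max_ordcone_def)

lemmas coneD = ordconeD[OF cone, folded S_def]

lemma maximalD: "ordcone P' \<Longrightarrow> P \<subseteq> P' \<Longrightarrow> x \<in> P' \<Longrightarrow> x \<in> P"
  using max by (auto simp: max_ordcone_def)

lemma subring: "subring_set S"
  unfolding subring_set_def
proof (intro conjI ballI)
  show "0 \<in> S" "1 \<in> S" by (auto intro: coneD)
  fix a b assume "a \<in> S" "b \<in> S"
  then obtain p q p' q' where *: "a = p - q" "b = p' - q'" "p \<in> P" "q \<in> P" "p' \<in> P" "q' \<in> P"
    unfolding S_def differences_def by blast
  have "a + b = (p + p') - (q + q')" "a - b = (p + q') - (q + p')" "a * b = (p * p' + q * q') - (p * q' + q * p')"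
    unfolding *(1,2) by (simp_all add: algebra_simps)
  with * show "a + b \<in> S" "a - b \<in> S" "a * b \<in> S"
    unfolding S_def differences_def using coneD(2,3) by blast+
qed

lemmas subringD = subring_setD[OF subring]

text \<open>Fractions with square denominators again form a proper cone: clearing denominators
  multiplies a member of the cone by a square of \<open>S\<close>, which stays in the cone.
  Maximality then closes \<open>P\<close> under such fractions, and this makes \<open>S\<close> a
  field.\<close>

lemma divide_square:
  assumes p: "p \<in> P" and q: "q \<in> S" "q \<noteq> 0"
  shows "p / q\<^sup>2 \<in> P"
proof -
  define P' where "P' = {p / q\<^sup>2 | p q. p \<in> P \<and> q \<in> S \<and> q \<noteq> 0}"
  have P'I: "x \<in> P'" if "x = p / q\<^sup>2" "p \<in> P" "q \<in> S" "q \<noteq> 0" for x p q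
    using that P'_def by blast
  have sub: "P \<subseteq> P'" using P'I[of _ _ 1] subringD(2) by auto
  have "ordcone P'"
    unfolding ordcone_def
  proof (intro conjI ballI allI impI)
    fix a b assume "a \<in> P'" "b \<in> P'"
    then obtain p q p' q' where *: "a = p / q\<^sup>2" "b = p' / q'\<^sup>2" "p \<in> P" "p' \<in> P"
      "q \<in> S" "q' \<in> S" "q \<noteq> 0" "q' \<noteq> 0" unfolding P'_def by blast
    have qq: "q * q' \<in> S" "q * q' \<noteq> 0" using * by (simp_all add: subringD)
    then have qq2: "(q * q')\<^sup>2 \<in> S" "(q * q')\<^sup>2 \<noteq> 0" by (simp_all add: coneD)
    have pq: "p * q'\<^sup>2 \<in> P" "p' * q\<^sup>2 \<in> P" using * by (simp_all add: coneD)
    then have "p * q'\<^sup>2 + p' * q\<^sup>2 \<in> P" "p * p' \<in> P" "(p * q'\<^sup>2 - p' * q\<^sup>2)\<^sup>2 \<in> P"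
      using * by (simp_all add: coneD subringD)
    moreover have "a + b = (p * q'\<^sup>2 + p' * q\<^sup>2) / (q * q')\<^sup>2" "a * b = (p * p') / (q * q')\<^sup>2"
      "(a - b)\<^sup>2 = (p * q'\<^sup>2 - p' * q\<^sup>2)\<^sup>2 / ((q * q')\<^sup>2)\<^sup>2"
      unfolding *(1,2) using *(7,8)
      by (simp_all add: add_frac_eq diff_frac_eq power_divide flip: power_mult_distrib)
    ultimately show "a + b \<in> P'" "a * b \<in> P'" "(a - b)\<^sup>2 \<in> P'"
      using P'I qq qq2 by blast+
  next
    fix a assume "a \<in> P'" "- a \<in> P'"
    then obtain p q p' q' where *: "a = p / q\<^sup>2" "- a = p' / q'\<^sup>2" "p \<in> P" "p' \<in> P"
      "q \<in> S" "q' \<in> S" "q \<noteq> 0" "q' \<noteq> 0" unfolding P'_def by blast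
    then have "(- p) / q\<^sup>2 = p' / q'\<^sup>2" by simp
    moreover have "q\<^sup>2 \<noteq> 0" "q'\<^sup>2 \<noteq> 0" using * by simp_all
    ultimately have "- (p * q'\<^sup>2) = p' * q\<^sup>2"
      using frac_eq_eq[of "q\<^sup>2" "q'\<^sup>2" "- p" p'] by simp
    moreover have "p * q'\<^sup>2 \<in> P" "p' * q\<^sup>2 \<in> P" using * by (simp_all add: coneD)
    ultimately have "p * q'\<^sup>2 = 0" using coneD(5)[of "p * q'\<^sup>2"] by simp
    then show "a = 0" using *(1,8) by simp
  qed (use sub coneD(1) in blast)
  from maximalD[OF this sub] P'I assms show ?thesis by blast
qed

text \<open>Otherwise \<open>P + a P\<close> would be a larger cone. If it contained some
  \<open>x\<close> and \<open>- x\<close>, the sum of the two representations would read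
  \<open>u + a * w = 0\<close>; for \<open>w \<noteq> 0\<close> this gives
  \<open>- a = (u * w) / w\<^sup>2\<close>, a member of \<open>P\<close> after all.\<close>

lemma total:
  assumes "a \<in> S" shows "a \<in> P \<or> - a \<in> P"
proof (rule ccontr)
  assume neg: "\<not> (a \<in> P \<or> - a \<in> P)"
  define P' where "P' = {p + a * q | p q. p \<in> P \<and> q \<in> P}"
  have P'I: "x \<in> P'" if "x = p + a * q" "p \<in> P" "q \<in> P" for x p q
    using that P'_def by blast
  have sub: "P \<subseteq> P'" using P'I[of _ _ 0] coneD(6) by auto
  have "ordcone P'"
    unfolding ordcone_def
  proof (intro conjI ballI allI impI)
    fix x y assume "x \<in> P'" "y \<in> P'"
    then obtain p q p' q' where *: "x = p + a * q" "y = p' + a * q'" "p \<in> P" "p' \<in> P"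
      "q \<in> P" "q' \<in> P" unfolding P'_def by blast
    have "x + y = (p + p') + a * (q + q')" "x * y = (p * p' + a\<^sup>2 * (q * q')) + a * (p * q' + q * p')"
      using * by (simp_all add: algebra_simps power2_eq_square)
    moreover have "p + p' \<in> P" "q + q' \<in> P" "p * p' + a\<^sup>2 * (q * q') \<in> P" "p * q' + q * p' \<in> P"
      using * assms by (simp_all add: coneD)
    ultimately show "x + y \<in> P'" "x * y \<in> P'" using P'I by blast+
    have "x - y \<in> S" using * assms by (simp add: coneD subringD)
    then show "(x - y)\<^sup>2 \<in> P'" using sub coneD(4) by blast
  next
    fix x assume "x \<in> P'" "- x \<in> P'"
    then obtain p q p' q' where *: "x = p + a * q" "- x = p' + a * q'" "p \<in> P" "p' \<in> P"
      "q \<in> P" "q' \<in> P" unfolding P'_def by blast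
    define u w where "u = p + p'" and "w = q + q'"
    have uw: "u \<in> P" "w \<in> P" unfolding u_def w_def using * by (simp_all add: coneD)
    have "u + a * w = x + (- x)" unfolding * (2) u_def w_def using *(1) by (simp add: algebra_simps)
    then have eq: "u = - a * w" by (simp add: eq_neg_iff_add_eq_0)
    show "x = 0"
    proof (cases "w = 0")
      case True
      then have "p' = - p" "q' = - q" using eq unfolding u_def w_def by (simp_all add: add_eq_0_iff)
      then have "p = 0" "q = 0" using *(3-6) coneD(5)[of p] coneD(5)[of q] by simp_all
      then show ?thesis using *(1) by simp
    next
      case False
      then have "- a = (u * w) / w\<^sup>2" unfolding eq by (simp add: power2_eq_square)
      then have "- a \<in> P" using divide_square[of "u * w" w] uw False by (simp add: coneD)
      then show ?thesis using neg by blast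
    qed
  qed (use sub coneD(1) in blast)
  from maximalD[OF this sub] P'I[of a 0 1] neg show False by (simp add: coneD)
qed

lemma inverse_in: "a \<in> S \<Longrightarrow> inverse a \<in> S"
proof (cases "a = 0")
  case False
  assume a: "a \<in> S"
  have "1 / a\<^sup>2 \<in> P" using divide_square[OF coneD(7) a] False by blast
  moreover have "inverse a = a * (1 / a\<^sup>2)" using False by (simp add: power2_eq_square field_simps)
  ultimately show ?thesis using a coneD(8) subringD(5) by metis
qed simp

definition strict_pos where "strict_pos x \<longleftrightarrow> x \<in> P \<and> x \<noteq> 0"

lemma strict_pos_mult: "strict_pos x \<Longrightarrow> strict_pos y \<Longrightarrow> strict_pos (x * y)"
  by (auto simp: strict_pos_def coneD(3))

lemma square_in: "x \<in> S \<Longrightarrow> x * x \<in> P"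
  using coneD(4)[of x] by (simp add: power2_eq_square)

lemma not_strict_pos_minus: "x \<in> P \<Longrightarrow> \<not> strict_pos (- x)"
  using coneD(5) by (auto simp: strict_pos_def)

lemma strict_pos_minus_mult:
  assumes "x \<in> S" "y \<in> S" "strict_pos (- (x * y))"
  shows "strict_pos (- x) \<or> strict_pos (- y)"
proof (rule ccontr)
  assume "\<not> ?thesis"
  then have "x \<in> P" "y \<in> P" using total[OF assms(1)] total[OF assms(2)] assms(3) by (auto simp: strict_pos_def)
  then show False using not_strict_pos_minus[of "x * y"] assms(3) coneD(3) by blast
qed

lemma sum_zero: "x \<in> P \<Longrightarrow> y \<in> P \<Longrightarrow> x + y = 0 \<Longrightarrow> x = 0 \<and> y = 0"
  using coneD(5)[of x] by (simp add: add_eq_0_iff)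

lemma of_nat_inj: "(of_nat m :: 'a alg_closure) = of_nat n \<Longrightarrow> m = n"
  by (metis of_nat_eq_iff to_ac_eq_iff to_ac_of_nat)

lemma infinite_S: "infinite S"
proof -
  have "inj (of_nat :: nat \<Rightarrow> 'a alg_closure)" using of_nat_inj by (auto intro: injI)
  then have "infinite (range (of_nat :: nat \<Rightarrow> 'a alg_closure))" by (simp add: finite_image_iff)
  moreover have "range of_nat \<subseteq> S" using subring_set_of_nat[OF subring] by auto
  ultimately show ?thesis using finite_subset by blast
qed

lemma root_factor:
  assumes "g \<in> polys_over S" "c \<in> S" "poly g c = 0"
  shows "\<exists>g'\<in>polys_over S. g = [:- c, 1:] * g'"
proof -
  have "[:- c, 1:] \<in> polys_over S"
    using assms subringD by (auto simp: polys_over_def coeff_pCons split: nat.splits)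
  from pseudo_division_over[OF subring assms(1) this] obtain q r where
    "q \<in> polys_over S" "g = [:- c, 1:] * q + r" "degree r = 0" by auto
  moreover from this obtain r0 where "r = [:r0:]" by (meson degree_eq_zeroE)
  ultimately show ?thesis using assms(3) by auto
qed

end

text \<open>Kept as polynomials rather than as values at a root: the arguments below use their
  degrees and their values at other points.\<close>

inductive_set square_cone :: "'a::comm_ring_1 set \<Rightarrow> 'a poly set \<Rightarrow> 'a poly set" for P GG where
  zero: "0 \<in> square_cone P GG"
| add: "p \<in> P \<Longrightarrow> g \<in> GG \<Longrightarrow> G \<in> square_cone P GG \<Longrightarrow> smult p (g\<^sup>2) + G \<in> square_cone P GG"

lemma square_cone_add: "G \<in> square_cone P GG \<Longrightarrow> H \<in> square_cone P GG \<Longrightarrow> G + H \<in> square_cone P GG"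
  by (induction rule: square_cone.induct) (auto simp: add.assoc intro: square_cone.intros)

context maximal_ordcone
begin

definition low_polys where "low_polys d = {g \<in> polys_over S. degree g < d}"

lemma square_cone_props:
  assumes "G \<in> square_cone P (low_polys d)"
  shows "G \<in> polys_over S" "d > 0 \<Longrightarrow> degree G \<le> 2 * (d - 1)" "c \<in> S \<Longrightarrow> poly G c \<in> P"
  using assms
proof (induction rule: square_cone.induct)
  case zero
  { case 1 show ?case using subring_polys_over[OF subring] subring_setD by blast
  next case 2 show ?case by simp
  next case 3 show ?case using coneD by simp }
next
  case (add p g G)
  note PS = subring_setD[OF subring_polys_over[OF subring]]
  have g: "g \<in> polys_over S" "degree g < d" using add by (auto simp: low_polys_def)
  { case 1 show ?case
      using add g by (intro PS polys_over_smult subring subring_set_power subring_polys_over coneD)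
  next case 2
    have "degree (smult p (g\<^sup>2)) \<le> 2 * degree g"
      by (metis degree_power_le degree_smult_le mult.commute order_trans)
    also have "\<dots> \<le> 2 * (d - 1)" using g by simp
    finally show ?case using add 2 by (intro degree_add_le) auto
  next case 3
    have "(poly g c)\<^sup>2 \<in> P" using g 3 poly_in_subring[OF subring] coneD(4) by blast
    then show ?case using add 3 coneD(2,3) by simp }
qed

text \<open>At \<open>c\<close> every term takes a value in \<open>P\<close>, and in a proper cone a
  vanishing sum has vanishing terms. So each term has weight 0 or a base vanishing at
  \<open>c\<close>, and the square of the linear factor splits off term by term.\<close>

lemma square_cone_divide:
  assumes "G \<in> square_cone P (low_polys d)" "c \<in> S" "poly G c = 0"
  shows "\<exists>H\<in>square_cone P (low_polys d). G = [:- c, 1:]\<^sup>2 * H"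
  using assms(1,3)
proof (induction rule: square_cone.induct)
  case zero
  show ?case by (rule bexI[of _ 0]) (auto intro: square_cone.intros)
next
  case (add p g G)
  have g: "g \<in> polys_over S" "degree g < d" using add by (auto simp: low_polys_def)
  have "(poly g c)\<^sup>2 \<in> P" using g assms(2) poly_in_subring[OF subring] coneD(4) by blast
  then have "p * (poly g c)\<^sup>2 \<in> P" using add coneD(3) by blast
  moreover have "poly G c \<in> P" using square_cone_props(3) add assms(2) by blast
  ultimately have z: "p * (poly g c)\<^sup>2 = 0" "poly G c = 0"
    using sum_zero[of "p * (poly g c)\<^sup>2" "poly G c"] add.prems by simp_all
  from add.IH[OF z(2)] obtain H where H: "H \<in> square_cone P (low_polys d)" "G = [:- c, 1:]\<^sup>2 * H" by blast
  show ?case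
  proof (cases "p = 0")
    case True
    with H show ?thesis by auto
  next
    case False
    then have "poly g c = 0" using z by simp
    from root_factor[OF g(1) assms(2) this] obtain g' where g': "g' \<in> polys_over S" "g = [:- c, 1:] * g'" by blast
    have "degree g' \<le> degree g"
    proof (cases "g' = 0")
      case False
      then show ?thesis unfolding g'(2) by (subst degree_mult_eq) auto
    qed simp
    then have "g' \<in> low_polys d" using g' g by (simp add: low_polys_def)
    then have "smult p (g'\<^sup>2) + H \<in> square_cone P (low_polys d)" using add H by (intro square_cone.add)
    moreover have "smult p (g\<^sup>2) + G = [:- c, 1:]\<^sup>2 * (smult p (g'\<^sup>2) + H)"
      unfolding H(2) g'(2) power_mult_distrib by (simp add: distrib_left)
    ultimately show ?thesis by blast
  qed
qed

text \<open>The values of \<open>G\<close> and \<open>H\<close> at a point of \<open>S\<close> lie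
  in the cone and cancel, hence are 0; and \<open>S\<close> is infinite.\<close>

lemma square_cone_sum_zero:
  assumes "G \<in> square_cone P (low_polys d)" "H \<in> square_cone P (low_polys d)" "G + H = 0"
  shows "G = 0"
proof (rule ccontr)
  assume "G \<noteq> 0"
  then have "finite {x. poly G x = 0}" by (rule poly_roots_finite)
  moreover have "poly G c = 0" if "c \<in> S" for c
    using sum_zero[of "poly G c" "poly H c"] square_cone_props(3) assms that by (metis poly_0 poly_add)
  then have "S \<subseteq> {x. poly G x = 0}" by blast
  ultimately show False using infinite_S finite_subset by blast
qed

text \<open>
  Strong induction on the degree. A polynomial \<open>f\<close> of minimal degree that changes sign without having
  a root must be irreducible over \<open>S\<close>; if \<open>\<alpha>\<close> is a root of \<open>f\<close> in the algebraic closure, then the sums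
  of squares of \<open>S(\<alpha>)\<close> with coefficients in \<open>P\<close> form a larger cone. Its properness is the heart of the
  matter: a relation \<open>G(\<alpha>) = 0\<close> with \<open>G = \<Sum>p\<^sub>i g\<^sub>i\<^sup>2\<close> gives \<open>G = f h\<close>, and \<open>h\<close> changes sign like \<open>f\<close> does.
\<close>
lemma sign_change_root:
  assumes "f \<in> polys_over S" "a \<in> S" "b \<in> S" "b - a \<in> P" "strict_pos (- (poly f a * poly f b))"
  shows "\<exists>c\<in>S. c - a \<in> P \<and> b - c \<in> P \<and> poly f c = 0"
  using assms
proof (induction "degree f" arbitrary: f a b rule: less_induct)
  case less
  note PS = subring_setD[OF subring_polys_over[OF subring]]
  define d where "d = degree f"
  note val = poly_in_subring[OF subring]
  show ?case
  proof (rule ccontr)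
    assume no_root: "\<not> ?case"
    have f0: "f \<noteq> 0" using less.prems(5) by (auto simp: strict_pos_def)
    have d: "d > 0"
    proof (rule ccontr)
      assume "\<not> d > 0"
      then obtain c where c: "f = [:c:]" using d_def by (metis degree_eq_zeroE neq0_conv)
      then have "c \<in> S" using less.prems(1) by (metis coeff_pCons_0 mem_Collect_eq polys_over_def)
      then show False using less.prems(5) c not_strict_pos_minus square_in by simp
    qed
    then obtain \<alpha> where \<alpha>: "poly f \<alpha> = 0" using alg_closed_imp_poly_has_root d_def by blast
    have lower: "\<exists>c\<in>S. c - a \<in> P \<and> b - c \<in> P \<and> poly h c = 0"
      if "h \<in> polys_over S" "degree h < d" "strict_pos (- (poly h a * poly h b))" for h
      using less.hyps[of h a b] that less.prems d_def by blast
    \<comment> \<open>The sign products of \<open>m\<close> and \<open>k\<close> at the end points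
      multiply to \<open>l\<^sup>2\<close> times that of \<open>f\<close>. So one factor of smaller
      degree changes sign, and its root, given by induction, is a root of \<open>f\<close>.\<close>
    have no_factor: False if mk: "m \<in> polys_over S" "k \<in> polys_over S" "degree m < d" "degree k < d"
      "l \<in> S" "l \<noteq> 0" "smult l f = m * k" for m k l
    proof -
      have "strict_pos (l * l)" using square_in that by (auto simp: strict_pos_def)
      then have "strict_pos ((l * l) * - (poly f a * poly f b))" using less.prems(5) strict_pos_mult by blast
      moreover have "(l * l) * - (poly f a * poly f b) = - (poly (smult l f) a * poly (smult l f) b)" by simp
      moreover have "\<dots> = - ((poly m a * poly m b) * (poly k a * poly k b))" unfolding that(7) by simp
      ultimately have "strict_pos (- ((poly m a * poly m b) * (poly k a * poly k b)))" by metis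
      then have "strict_pos (- (poly m a * poly m b)) \<or> strict_pos (- (poly k a * poly k b))"
        using strict_pos_minus_mult val less.prems that subringD(5) by metis
      then obtain c where c: "c \<in> S" "c - a \<in> P" "b - c \<in> P" "poly m c = 0 \<or> poly k c = 0"
        using lower[OF mk(1,3)] lower[OF mk(2,4)] by blast
      then have "poly (smult l f) c = 0" unfolding mk(7) by auto
      then have "poly f c = 0" using mk(6) by simp
      then show False using no_root c(1-3) by blast
    qed
    \<comment> \<open>Up to scalars \<open>f\<close> is the minimal polynomial of
      \<open>\<alpha>\<close>: an annihilator of least degree below \<open>d\<close> would leave
      pseudo-remainder 0 and so factor a multiple of \<open>f\<close>.\<close>
    have min_degree: "d \<le> degree G" if "G \<in> polys_over S" "G \<noteq> 0" "poly G \<alpha> = 0" for G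
    proof -
      define Q where "Q G \<longleftrightarrow> G \<in> polys_over S \<and> G \<noteq> 0 \<and> poly G \<alpha> = 0" for G
      have "\<exists>m. Q m \<and> (\<forall>y. Q y \<longrightarrow> degree m \<le> degree y)"
        by (rule ex_has_least_nat[of _ G]) (simp add: Q_def that)
      then obtain m where m: "Q m" "\<And>y. Q y \<Longrightarrow> degree m \<le> degree y" by blast
      have "\<not> degree m < d"
      proof
        assume md: "degree m < d"
        have "degree m > 0" using m(1) unfolding Q_def
          by (metis degree_eq_zeroE gr0I mult_zero_right add_0_right poly_0 poly_pCons pCons_0_0)
        from pseudo_division_over[OF subring less.prems(1) _ this] obtain e q r where qr:
          "q \<in> polys_over S" "r \<in> polys_over S" "smult (lead_coeff m ^ e) f = m * q + r" "degree r < degree m"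
          using m(1) Q_def by blast
        have "poly r \<alpha> = 0" using arg_cong[OF qr(3), of "\<lambda>p. poly p \<alpha>"] \<alpha> m(1) by (simp add: Q_def)
        then have "r = 0" using m(2)[of r] qr(2,4) by (auto simp: Q_def)
        then have eq: "smult (lead_coeff m ^ e) f = m * q" using qr by simp
        have l: "lead_coeff m ^ e \<noteq> 0" "lead_coeff m ^ e \<in> S"
          using m(1) by (auto simp: Q_def intro!: subring_set_power[OF subring] lead_coeff_polys_over)
        have "q \<noteq> 0" using eq l f0 by auto
        then have "d = degree m + degree q"
          using arg_cong[OF eq, of degree] l m(1) unfolding d_def Q_def
          by (simp add: degree_mult_eq)
        then have "degree q < d" using \<open>degree m > 0\<close> by simp
        then show False using no_factor[OF _ qr(1) md _ l(2,1) eq] m(1) by (simp add: Q_def)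
      qed
      then show ?thesis using m(2)[of G] that by (simp add: Q_def)
    qed
    have lf: "lead_coeff f ^ e \<noteq> 0" "lead_coeff f ^ e \<in> S" for e
      using f0 less.prems by (auto intro!: subring_set_power[OF subring] lead_coeff_polys_over)
    have reduce: "\<exists>e q r. q \<in> polys_over S \<and> r \<in> low_polys d \<and> smult (lead_coeff f ^ e) g = f * q + r"
      if "g \<in> polys_over S" for g
      using pseudo_division_over[OF subring that less.prems(1)] d unfolding d_def low_polys_def by fastforce
    have multiple: "\<exists>e q. q \<in> polys_over S \<and> smult (lead_coeff f ^ e) G = f * q"
      if "G \<in> polys_over S" "poly G \<alpha> = 0" for G
    proof -
      from reduce[OF that(1)] obtain e q r where qr: "q \<in> polys_over S" "r \<in> low_polys d"
        "smult (lead_coeff f ^ e) G = f * q + r" by blast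
      have "poly r \<alpha> = 0" using arg_cong[OF qr(3), of "\<lambda>p. poly p \<alpha>"] \<alpha> that by simp
      then have "r = 0" using min_degree[of r] qr(2) by (auto simp: low_polys_def)
      then show ?thesis using qr by auto
    qed
    define E where "E = {poly g \<alpha> | g. g \<in> polys_over S}"
    \<comment> \<open>Leading coefficients are invertible in \<open>S\<close>, so a pseudo-remainder
      can be rescaled to an exact representative of degree below \<open>d\<close>. This keeps the
      degrees in the cone bounded by 2 (d - 1).\<close>
    have low: "\<exists>g\<in>low_polys d. x = poly g \<alpha>" if "x \<in> E" for x
    proof -
      from \<open>x \<in> E\<close> obtain g where g: "g \<in> polys_over S" "x = poly g \<alpha>" unfolding E_def by blast
      from reduce[OF g(1)] obtain e q r where qr: "r \<in> low_polys d"
        "smult (lead_coeff f ^ e) g = f * q + r" by blast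
      define l where "l = lead_coeff f ^ e"
      have "l * x = poly r \<alpha>" using arg_cong[OF qr(2), of "\<lambda>p. poly p \<alpha>"] \<alpha> g l_def by simp
      then have "x = poly (smult (inverse l) r) \<alpha>" using lf(1)[of e] by (simp add: l_def field_simps)
      moreover have "smult (inverse l) r \<in> low_polys d"
        using qr(1) lf(2)[of e] inverse_in polys_over_smult[OF subring]
        by (auto simp: low_polys_def l_def)
      ultimately show ?thesis by blast
    qed
    have E_ring: "subring_set E"
      unfolding subring_set_def
    proof (intro conjI ballI)
      show "0 \<in> E" unfolding E_def using PS(1) by force
      show "1 \<in> E" unfolding E_def using PS(2) by force
      fix x y assume "x \<in> E" "y \<in> E"
      then obtain g h where "x = poly g \<alpha>" "y = poly h \<alpha>" "g \<in> polys_over S" "h \<in> polys_over S"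
        unfolding E_def by blast
      then have "x + y = poly (g + h) \<alpha>" "x - y = poly (g - h) \<alpha>" "x * y = poly (g * h) \<alpha>"
        "g + h \<in> polys_over S" "g - h \<in> polys_over S" "g * h \<in> polys_over S" using PS by auto
      then show "x + y \<in> E" "x - y \<in> E" "x * y \<in> E" unfolding E_def by blast+
    qed
    define C where "C = square_cone P (low_polys d)"
    define P' where "P' = {poly G \<alpha> | G. G \<in> C}"
    have term_in: "p * x\<^sup>2 \<in> P'" if "p \<in> P" "x \<in> E" for p x
    proof -
      from low[OF \<open>x \<in> E\<close>] obtain g where "g \<in> low_polys d" "x = poly g \<alpha>" by blast
      then have "p * x\<^sup>2 = poly (smult p (g\<^sup>2) + 0) \<alpha>" "smult p (g\<^sup>2) + 0 \<in> C"
        unfolding C_def using that by (simp, intro square_cone.intros)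
      then show ?thesis unfolding P'_def by blast
    qed
    have sub: "P \<subseteq> P'" using term_in[of _ 1] subring_setD[OF E_ring] by fastforce
    have add_in: "x + y \<in> P'" if xy: "x \<in> P'" "y \<in> P'" for x y
    proof -
      obtain G H where GH: "x = poly G \<alpha>" "y = poly H \<alpha>" "G \<in> C" "H \<in> C" using xy P'_def by blast
      then have "x + y = poly (G + H) \<alpha>" "G + H \<in> C" unfolding C_def by (auto intro: square_cone_add)
      then show ?thesis unfolding P'_def by blast
    qed
    have mult_term: "p * x\<^sup>2 * y \<in> P'" if p: "p \<in> P" and x: "x \<in> E" and y: "y \<in> P'" for p x y
    proof -
      obtain G where "y = poly G \<alpha>" "G \<in> square_cone P (low_polys d)" using y P'_def C_def by blast
      from this(2) have "p * x\<^sup>2 * poly G \<alpha> \<in> P'"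
      proof (induction rule: square_cone.induct)
        case zero
        then show ?case using term_in[of 0 1] coneD(6) subring_setD[OF E_ring] by simp
      next
        case (add p' g G)
        have "poly g \<alpha> \<in> E" using add by (auto simp: E_def low_polys_def)
        then have "(p * p') * (x * poly g \<alpha>)\<^sup>2 \<in> P'"
          using p x add by (intro term_in subring_setD[OF E_ring] coneD)
        moreover have "p * x\<^sup>2 * poly (smult p' (g\<^sup>2) + G) \<alpha> = (p * p') * (x * poly g \<alpha>)\<^sup>2 + p * x\<^sup>2 * poly G \<alpha>"
          by (simp add: algebra_simps power_mult_distrib)
        ultimately show ?case using add.IH add_in by simp
      qed
      then show ?thesis using \<open>y = _\<close> by simp
    qed
    have mult_in: "x * y \<in> P'" if xy: "x \<in> P'" "y \<in> P'" for x y
    proof -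
      obtain G where "x = poly G \<alpha>" "G \<in> square_cone P (low_polys d)" using xy P'_def C_def by blast
      from this(2) have "poly G \<alpha> * y \<in> P'"
      proof (induction rule: square_cone.induct)
        case zero
        then show ?case using term_in[of 0 1] coneD(6) subring_setD[OF E_ring] by simp
      next
        case (add p' g G)
        have "poly g \<alpha> \<in> E" using add by (auto simp: E_def low_polys_def)
        then have "p' * (poly g \<alpha>)\<^sup>2 * y \<in> P'" using mult_term add xy by blast
        then show ?case using add.IH add_in by (simp add: distrib_right)
      qed
      then show ?thesis using \<open>x = _\<close> by simp
    qed
    have P'E: "x \<in> E" if "x \<in> P'" for x
      using that square_cone_props(1) unfolding P'_def C_def E_def by blast
    have proper: "x = 0" if x: "x \<in> P'" "- x \<in> P'" for x
    proof (rule ccontr)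
      assume "x \<noteq> 0"
      obtain G1 G2 where G12: "x = poly G1 \<alpha>" "- x = poly G2 \<alpha>" "G1 \<in> C" "G2 \<in> C"
        using x P'_def by blast
      define Q where "Q G \<longleftrightarrow> G \<in> C \<and> G \<noteq> 0 \<and> poly G \<alpha> = 0" for G
      have "Q (G1 + G2)"
        using G12 square_cone_add square_cone_sum_zero[of G1 d G2] \<open>x \<noteq> 0\<close>
        unfolding Q_def C_def by (metis add.right_inverse poly_0 poly_add)
      then have "\<exists>m. Q m \<and> (\<forall>y. Q y \<longrightarrow> degree m \<le> degree y)" by (rule ex_has_least_nat)
      then obtain G where G: "Q G" "\<And>y. Q y \<Longrightarrow> degree G \<le> degree y" by blast
      have GS: "G \<in> polys_over S" "degree G \<le> 2 * (d - 1)" "\<And>c. c \<in> S \<Longrightarrow> poly G c \<in> P"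
        using square_cone_props[of G d] G(1) d unfolding Q_def C_def by auto
      \<comment> \<open>By the least degree of \<open>G\<close>: a root in \<open>S\<close> other
        than \<open>\<alpha>\<close> could be divided out twice, leaving a smaller nonzero member
        that still vanishes at \<open>\<alpha>\<close>.\<close>
      have nz: "poly G c \<noteq> 0" if c: "c \<in> S" "c \<noteq> \<alpha>" for c
      proof
        assume "poly G c = 0"
        with square_cone_divide[of G d c] G(1) c obtain H where H: "H \<in> C" "G = [:- c, 1:]\<^sup>2 * H"
          unfolding Q_def C_def by blast
        then have "H \<noteq> 0" using G(1) Q_def by auto
        moreover have "poly H \<alpha> = 0" using G(1) c unfolding Q_def H(2) by simp
        ultimately have "degree G \<le> degree H" using G(2) H Q_def by blast
        moreover have "degree G = 2 + degree H"
          unfolding H(2) using \<open>H \<noteq> 0\<close> by (simp add: degree_mult_eq degree_power_eq)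
        ultimately show False by simp
      qed
      have fab: "poly f a \<noteq> 0" "poly f b \<noteq> 0" using less.prems(5) by (auto simp: strict_pos_def)
      then have ab: "strict_pos (poly G a)" "strict_pos (poly G b)"
        using nz GS(3) less.prems \<alpha> by (auto simp: strict_pos_def)
      from multiple[OF GS(1)] G(1) obtain e h where h: "h \<in> polys_over S" "smult (lead_coeff f ^ e) G = f * h"
        unfolding Q_def by blast
      define l where "l = lead_coeff f ^ e"
      have h0: "h \<noteq> 0" using h(2) lf(1)[of e] G(1) by (auto simp: Q_def)
      have "degree G = d + degree h"
        using arg_cong[OF h(2), of degree] lf(1)[of e] f0 h0 by (simp add: degree_mult_eq d_def)
      \<comment> \<open>From \<open>degree G \<le> 2 * (d - 1)\<close> the cofactor has degree at
        most d - 2, so induction applies to it.\<close>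
      then have hd: "degree h < d" using GS(2) d by simp
      have "strict_pos (- (poly h a * poly h b))"
      proof -
        \<comment> \<open>The right side is strictly positive, as \<open>G\<close> is so at both end
          points; hence \<open>h\<close> must change sign where \<open>f\<close> does.\<close>
        have eq: "(poly f a * poly f b) * (poly h a * poly h b) = (l * l) * (poly G a * poly G b)"
          using arg_cong[OF h(2), of "\<lambda>p. poly p a * poly p b"] by (simp add: l_def mult_ac)
        have "strict_pos (l * l)" using square_in lf[of e] by (auto simp: strict_pos_def l_def)
        then have r: "strict_pos ((l * l) * (poly G a * poly G b))" using ab strict_pos_mult by blast
        have hab: "poly h a * poly h b \<in> S" using h less.prems val subringD(5) by blast
        have "poly h a * poly h b \<noteq> 0" using r unfolding eq[symmetric] by (auto simp: strict_pos_def)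
        moreover have "\<not> strict_pos (poly h a * poly h b)"
        proof
          assume "strict_pos (poly h a * poly h b)"
          from strict_pos_mult[OF less.prems(5) this] have
            "strict_pos (- ((l * l) * (poly G a * poly G b)))" unfolding eq[symmetric] by simp
          then show False using r not_strict_pos_minus strict_pos_def by blast
        qed
        ultimately show ?thesis using total[OF hab] by (auto simp: strict_pos_def)
      qed
      from lower[OF h(1) hd this] obtain c where c: "c \<in> S" "c - a \<in> P" "b - c \<in> P" "poly h c = 0" by blast
      have "l * poly G c = 0" using arg_cong[OF h(2), of "\<lambda>p. poly p c"] c by (simp add: l_def)
      then have "poly G c = 0" using lf(1)[of e] l_def f0 by simp
      moreover have "c \<noteq> \<alpha>" using no_root c \<alpha> by blast
      ultimately show False using nz c by blast
    qed
    have "ordcone P'"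
      unfolding ordcone_def
    proof (intro conjI ballI allI impI)
      fix x y assume xy: "x \<in> P'" "y \<in> P'"
      show "x + y \<in> P'" "x * y \<in> P'" using add_in mult_in xy by blast+
      have "x - y \<in> E" using subring_setD(4)[OF E_ring] P'E xy by simp
      then show "(x - y)\<^sup>2 \<in> P'" using term_in[of 1] coneD(7) by fastforce
    qed (use sub coneD(1) proper in blast)+
    from maximalD[OF this sub] have P'P: "\<And>x. x \<in> P' \<Longrightarrow> x \<in> P" .
    have "\<alpha> = poly [:0, 1:] \<alpha>" "[:0, 1:] \<in> polys_over S"
      using subringD PS(1) by (simp_all del: pCons_eq_0_iff)
    then have "\<alpha> \<in> E" unfolding E_def by blast
    \<comment> \<open>Maximality puts all squares of \<open>E\<close> into \<open>P\<close>, hence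
      into \<open>S\<close>, and polarization recovers \<open>\<alpha>\<close> itself: 4 \<alpha> =
      (\<alpha> + 1)^2 - (\<alpha> - 1)^2.\<close>
    then have E1: "\<alpha> + 1 \<in> E" "\<alpha> - 1 \<in> E" using subring_setD[OF E_ring] by blast+
    have "x\<^sup>2 \<in> S" if "x \<in> E" for x
      using term_in[of 1 x] that P'P coneD(7,8) by simp
    then have "(\<alpha> + 1)\<^sup>2 \<in> S" "(\<alpha> - 1)\<^sup>2 \<in> S" using E1 by blast+
    moreover have four: "(4 :: 'a alg_closure) \<in> S" "(4 :: 'a alg_closure) \<noteq> 0"
      using subring_set_of_nat[OF subring, of 4] of_nat_inj[of 4 0] by auto
    ultimately have "((\<alpha> + 1)\<^sup>2 - (\<alpha> - 1)\<^sup>2) * inverse 4 \<in> S"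
      by (intro subringD(4,5) inverse_in)
    moreover have "(\<alpha> + 1)\<^sup>2 - (\<alpha> - 1)\<^sup>2 = \<alpha> * 4" by (simp add: power2_eq_square algebra_simps)
    ultimately have \<alpha>S: "\<alpha> \<in> S" using four by (simp add: mult.assoc)
    from root_factor[OF less.prems(1) this \<alpha>] obtain k where k: "k \<in> polys_over S" "f = [:- \<alpha>, 1:] * k" by blast
    have "k \<noteq> 0" using k f0 by auto
    then have dk: "d = Suc (degree k)" unfolding d_def k(2) by (subst degree_mult_eq) auto
    have "[:- \<alpha>, 1:] \<in> polys_over S" using subringD \<alpha>S PS by simp
    moreover have "degree [:- \<alpha>, 1:] = 1" by simp
    \<comment> \<open>For larger degree the linear factor and \<open>k\<close> would contradict
      \<open>no_factor\<close>. What remains is a linear \<open>f\<close>, whose root lies between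
      the end points because the sign changes there.\<close>
    ultimately have "\<not> 1 < d" using no_factor[of "[:- \<alpha>, 1:]" k 1] k subringD(2) dk
      by (simp only: smult_1_left) auto
    then have "d = 1" using d by simp
    then obtain c where c: "k = [:c:]" using dk by (metis degree_eq_zeroE One_nat_def nat.inject)
    then have cS: "c \<in> S" using k by simp
    have "strict_pos (- ((c * c) * ((a - \<alpha>) * (b - \<alpha>))))"
      using less.prems(5) unfolding k(2) c by (simp add: algebra_simps)
    then have neg: "(a - \<alpha>) * (b - \<alpha>) \<notin> P"
      using not_strict_pos_minus square_in[OF cS] coneD(3) by blast
    have aS: "a - \<alpha> \<in> S" "b - \<alpha> \<in> S" using less.prems \<alpha>S subringD by auto
    have "\<alpha> - a \<in> P"
    proof (rule ccontr)
      assume "\<alpha> - a \<notin> P"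
      then have "a - \<alpha> \<in> P" using total[OF aS(1)] by simp
      moreover from this have "(b - a) + (a - \<alpha>) \<in> P" using less.prems coneD(2) by blast
      ultimately show False using neg coneD(3) by simp
    qed
    moreover have "b - \<alpha> \<in> P"
    proof (rule ccontr)
      assume "b - \<alpha> \<notin> P"
      then have "\<alpha> - b \<in> P" using total[OF aS(2)] by simp
      moreover from this have "(\<alpha> - b) + (b - a) \<in> P" using less.prems coneD(2) by blast
      then have "\<alpha> - a \<in> P" by simp
      ultimately have "(\<alpha> - a) * (\<alpha> - b) \<in> P" using coneD(3) by blast
      then show False using neg by (simp add: algebra_simps)
    qed
    ultimately show False using no_root \<alpha> \<alpha>S by blast
  qed
qed

end

text \<open>One cone is fixed for each base field, so that its difference ring can become a
  type.\<close>

definition closure_cone :: "'a::linordered_field alg_closure set" where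
  "closure_cone = (SOME P. max_ordcone P)"

interpretation closure: maximal_ordcone closure_cone
  unfolding maximal_ordcone_def closure_cone_def using max_ordcone_exists by (rule someI_ex)

section \<open>The real closure as a type, and the class of real closed fields\<close>

typedef (overloaded) 'a real_closure = "differences (closure_cone :: 'a::linordered_field alg_closure set)"
  using closure.coneD(8)[OF closure.coneD(6)] unfolding closure.S_def by blast

setup_lifting type_definition_real_closure

instantiation real_closure :: (linordered_field) "{zero, one, plus, minus, times, uminus, inverse, ord, abs, sgn}"
begin

lift_definition zero_real_closure :: "'a real_closure" is 0
  using closure.subringD(1) by (simp add: closure.S_def)
lift_definition one_real_closure :: "'a real_closure" is 1
  using closure.subringD(2) by (simp add: closure.S_def)
lift_definition plus_real_closure :: "'a real_closure \<Rightarrow> 'a real_closure \<Rightarrow> 'a real_closure" is "(+)"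
  using closure.subringD(3) by (simp add: closure.S_def)
lift_definition minus_real_closure :: "'a real_closure \<Rightarrow> 'a real_closure \<Rightarrow> 'a real_closure" is "(-)"
  using closure.subringD(4) by (simp add: closure.S_def)
lift_definition times_real_closure :: "'a real_closure \<Rightarrow> 'a real_closure \<Rightarrow> 'a real_closure" is "(*)"
  using closure.subringD(5) by (simp add: closure.S_def)
lift_definition uminus_real_closure :: "'a real_closure \<Rightarrow> 'a real_closure" is uminus
  using closure.subringD(6) by (simp add: closure.S_def)
lift_definition inverse_real_closure :: "'a real_closure \<Rightarrow> 'a real_closure" is inverse
  using closure.inverse_in by (simp add: closure.S_def)
lift_definition divide_real_closure :: "'a real_closure \<Rightarrow> 'a real_closure \<Rightarrow> 'a real_closure" is "(/)"
  unfolding divide_inverse closure.S_def[symmetric] by (intro closure.subringD(5) closure.inverse_in)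
lift_definition less_eq_real_closure :: "'a real_closure \<Rightarrow> 'a real_closure \<Rightarrow> bool"
  is "\<lambda>a b. b - a \<in> closure_cone" .
definition less_real_closure :: "'a real_closure \<Rightarrow> 'a real_closure \<Rightarrow> bool"
  where "less_real_closure a b \<longleftrightarrow> a \<le> b \<and> \<not> b \<le> a"
definition abs_real_closure :: "'a real_closure \<Rightarrow> 'a real_closure"
  where "abs_real_closure a = (if a < 0 then - a else a)"
definition sgn_real_closure :: "'a real_closure \<Rightarrow> 'a real_closure"
  where "sgn_real_closure a = (if a = 0 then 0 else if 0 < a then 1 else - 1)"

instance ..

end

instance real_closure :: (linordered_field) linordered_field
proof
  fix a b c :: "'a real_closure"
  show "a * b * c = a * (b * c)" "a * b = b * a" "1 * a = a" "a + b + c = a + (b + c)"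
    "a + b = b + a" "0 + a = a" "- a + a = 0" "a - b = a + - b" "(a + b) * c = a * c + b * c"
    "(0 :: 'a real_closure) \<noteq> 1" "inverse (0 :: 'a real_closure) = 0" "a / b = a * inverse b"
    "a + b - a = b" "a - b - c = a - (b + c)" "0 * a = 0" "a * 0 = 0"
    by (transfer; simp add: algebra_simps divide_inverse)+
  show "a \<noteq> 0 \<Longrightarrow> inverse a * a = 1" by transfer simp
  show refl: "a \<le> a" by transfer (simp add: closure.coneD(6))
  show "a \<le> b \<Longrightarrow> b \<le> c \<Longrightarrow> a \<le> c"
  proof transfer
    fix a b c :: "'a alg_closure" assume "b - a \<in> closure_cone" "c - b \<in> closure_cone"
    from closure.coneD(2)[OF this] show "c - a \<in> closure_cone" by simp
  qed
  show antisym: "a \<le> b \<Longrightarrow> b \<le> a \<Longrightarrow> a = b"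
  proof transfer
    fix a b :: "'a alg_closure" assume "b - a \<in> closure_cone" "a - b \<in> closure_cone"
    with closure.coneD(5)[of "b - a"] show "a = b" by simp
  qed
  show "a < b \<longleftrightarrow> a \<le> b \<and> \<not> b \<le> a" by (rule less_real_closure_def)
  show total: "a \<le> b \<or> b \<le> a"
  proof transfer
    fix a b :: "'a alg_closure" assume "a \<in> differences closure_cone" "b \<in> differences closure_cone"
    then have "b - a \<in> closure.S" using closure.subringD(4) by (simp add: closure.S_def)
    from closure.total[OF this] show "b - a \<in> closure_cone \<or> a - b \<in> closure_cone" by simp
  qed
  show "a \<le> b \<Longrightarrow> c + a \<le> c + b" by transfer simp
  have mono: "0 \<le> a \<Longrightarrow> 0 \<le> b \<Longrightarrow> 0 \<le> a * b" for a b :: "'a real_closure"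
    by transfer (simp add: closure.coneD(3))
  show "a < b \<Longrightarrow> 0 < c \<Longrightarrow> c * a < c * b"
  proof -
    assume ab: "a < b" and c: "0 < c"
    have "0 \<le> b - a" using ab unfolding less_real_closure_def by transfer simp
    then have le: "0 \<le> c * (b - a)" using mono c unfolding less_real_closure_def by blast
    have "b \<noteq> a" "c \<noteq> 0" using ab c refl unfolding less_real_closure_def by auto
    then have ne: "c * (b - a) \<noteq> 0" by transfer simp
    have "c * a \<le> c * b" using le by transfer (simp add: algebra_simps)
    moreover have "\<not> c * b \<le> c * a"
    proof
      assume "c * b \<le> c * a"
      then have "c * (b - a) \<le> 0" by transfer (simp add: algebra_simps)
      moreover have "x \<le> 0 \<Longrightarrow> 0 \<le> x \<Longrightarrow> x = 0" for x :: "'a real_closure"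
        by transfer (use closure.coneD(5) in force)
      ultimately show False using le ne by blast
    qed
    ultimately show "c * a < c * b" by (simp add: less_real_closure_def)
  qed
qed (simp_all only: abs_real_closure_def sgn_real_closure_def)

text \<open>The intermediate value property is spelled out through coefficients, so that the axiom
  refers to the field operations alone; \<open>real_closed_fieldI\<close> returns to
  \<open>poly\<close>.\<close>

class real_closed_field = linordered_field +
  assumes rcf_IVT: "a < b \<Longrightarrow> (\<Sum>k\<le>n. f k * a ^ k) < 0 \<Longrightarrow> 0 < (\<Sum>k\<le>n. f k * b ^ k) \<Longrightarrow>
    \<exists>x. a < x \<and> x < b \<and> (\<Sum>k\<le>n. f k * x ^ k) = 0"

lemma real_closed_fieldI:
  assumes "\<And>(p :: 'a::linordered_field poly) a b. a < b \<Longrightarrow> poly p a < 0 \<Longrightarrow> 0 < poly p b \<Longrightarrow>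
    \<exists>x. a < x \<and> x < b \<and> poly p x = 0"
  shows "OFCLASS('a, real_closed_field_class)"
proof
  fix a b :: 'a and f :: "nat \<Rightarrow> 'a" and n
  assume "a < b" and "(\<Sum>k\<le>n. f k * a ^ k) < 0" and "0 < (\<Sum>k\<le>n. f k * b ^ k)"
  moreover have "(\<Sum>k\<le>n. f k * x ^ k) = poly (\<Sum>k\<le>n. monom (f k) k) x" for x
    by (simp add: poly_sum poly_monom)
  ultimately show "\<exists>x. a < x \<and> x < b \<and> (\<Sum>k\<le>n. f k * x ^ k) = 0"
    using assms[of a b "\<Sum>k\<le>n. monom (f k) k"] by simp
qed

instance real :: real_closed_field
  by (rule real_closed_fieldI) (use poly_IVT_pos in blast)

lemma poly_Rep_real_closure:
  "Rep_real_closure (poly p a) = poly (map_poly Rep_real_closure p) (Rep_real_closure a)"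
  by (induction p)
    (simp_all add: map_poly_pCons zero_real_closure.rep_eq plus_real_closure.rep_eq times_real_closure.rep_eq)

instance real_closure :: (linordered_field) real_closed_field
proof (rule real_closed_fieldI)
  fix a b :: "'a real_closure" and p :: "'a real_closure poly"
  assume ab: "a < b" and pa: "poly p a < 0" and pb: "0 < poly p b"
  let ?R = "Rep_real_closure :: 'a real_closure \<Rightarrow> 'a alg_closure"
  define f where "f = map_poly ?R p"
  have S: "?R x \<in> closure.S" for x using Rep_real_closure[of x] by (simp add: closure.S_def)
  have f: "f \<in> polys_over closure.S"
    unfolding polys_over_def f_def using S by (simp add: coeff_map_poly zero_real_closure.rep_eq)
  have ba: "?R b - ?R a \<in> closure_cone" using ab by (simp add: less_imp_le less_eq_real_closure.rep_eq[symmetric])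
  have "poly p a * poly p b < 0" using pa pb by (simp add: mult_less_0_iff)
  then have "0 \<le> - (poly p a * poly p b)" "- (poly p a * poly p b) \<noteq> 0" using pa pb by auto
  then have "closure.strict_pos (- (poly f (?R a) * poly f (?R b)))"
    unfolding closure.strict_pos_def f_def less_eq_real_closure.rep_eq Rep_real_closure_inject[symmetric]
    by (simp add: poly_Rep_real_closure zero_real_closure.rep_eq times_real_closure.rep_eq uminus_real_closure.rep_eq)
  from closure.sign_change_root[OF f S S ba this] obtain c where
    c: "c \<in> closure.S" "c - ?R a \<in> closure_cone" "?R b - c \<in> closure_cone" "poly f c = 0" by blast
  then obtain x where x: "c = ?R x"
    by (metis Abs_real_closure_inverse closure.S_def)
  have "poly p x = 0"
    using c(4) unfolding x f_def poly_Rep_real_closure[symmetric]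
    by (simp add: Rep_real_closure_inject[symmetric] zero_real_closure.rep_eq)
  moreover have "a \<le> x" "x \<le> b" using c unfolding x by (simp_all add: less_eq_real_closure.rep_eq)
  ultimately have "a < x" "x < b" using pa pb by (auto simp: order.strict_iff_order)
  with \<open>poly p x = 0\<close> show "\<exists>x. a < x \<and> x < b \<and> poly p x = 0" by blast
qed

lift_definition of_base :: "'a::linordered_field \<Rightarrow> 'a real_closure" is to_ac
proof -
  fix a :: 'a
  have "to_ac a \<in> closure.S"
  proof (cases "a \<ge> 0")
    case False
    then have "to_ac (- a) \<in> closure.S" by (intro closure.coneD(8) closure.coneD(1)) simp
    then have "- to_ac (- a) \<in> closure.S" using closure.subringD(6) by blast
    then show ?thesis by simp
  qed (use closure.coneD(1,8) in blast)
  then show "to_ac a \<in> differences closure_cone" by (simp add: closure.S_def)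
qed

lemma of_base_hom:
  "of_base 0 = 0" "of_base 1 = 1" "of_base (a + b) = of_base a + of_base b"
  "of_base (a * b) = of_base a * of_base b" "0 \<le> a \<Longrightarrow> 0 \<le> of_base a" "of_base a = 0 \<longleftrightarrow> a = 0"
proof -
  show "of_base 0 = 0" "of_base 1 = 1" "of_base (a + b) = of_base a + of_base b"
    "of_base (a * b) = of_base a * of_base b" by (transfer; simp)+
  show "0 \<le> a \<Longrightarrow> 0 \<le> of_base a" by transfer (simp add: closure.coneD(1))
  show "of_base a = 0 \<longleftrightarrow> a = 0" by transfer (metis to_ac_0 to_ac_eq_iff)
qed

section \<open>Sign diagrams of polynomials over real closed fields\<close>

text \<open>Integer values allow signs in two different ordered fields to be compared.\<close>

definition sg :: "'a::linordered_idom \<Rightarrow> int" where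
  "sg x = (if x < 0 then - 1 else if x = 0 then 0 else 1)"

lemma sg_simps [simp]:
  "sg x = 0 \<longleftrightarrow> x = 0" "0 = sg x \<longleftrightarrow> x = 0" "sg x = 1 \<longleftrightarrow> 0 < x" "sg x = - 1 \<longleftrightarrow> x < 0" "sg 0 = 0"
  by (auto simp: sg_def)

lemma sg_mult: "sg (x * y) = sg x * sg y"
  by (auto simp: sg_def zero_less_mult_iff mult_less_0_iff not_less)

lemma sg_minus [simp]: "sg (- x) = - sg x"
  by (auto simp: sg_def)

lemma sg_power: "sg (x ^ n) = sg x ^ n"
proof (induction n)
  case 0
  show ?case by (simp add: sg_def)
qed (simp add: sg_mult)

lemma sg_pos_iff: "sg x = sg y \<Longrightarrow> 0 < x \<longleftrightarrow> 0 < y" and sg_neg_iff: "sg x = sg y \<Longrightarrow> x < 0 \<longleftrightarrow> y < 0"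
  and sg_zero_iff: "sg x = sg y \<Longrightarrow> x = 0 \<longleftrightarrow> y = 0"
  by (auto simp: sg_def split: if_splits)

lemma sg_eqI:
  fixes x :: "'a::linordered_idom" and y :: "'b::linordered_idom"
  shows "(0 < x \<Longrightarrow> 0 < y) \<Longrightarrow> (x < 0 \<Longrightarrow> y < 0) \<Longrightarrow> (0 < y \<Longrightarrow> 0 < x) \<Longrightarrow> (y < 0 \<Longrightarrow> x < 0) \<Longrightarrow> sg x = sg y"
  by (cases x "0::'a" rule: linorder_cases; cases y "0::'b" rule: linorder_cases) (auto simp: sg_def)

section \<open>Rolle's theorem, the mean value theorem and signs at infinity over real closed
  fields\<close>

lemma rcf_poly_IVT:
  fixes p :: "'a::real_closed_field poly"
  assumes "a < b" "poly p a * poly p b < 0"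
  shows "\<exists>x. a < x \<and> x < b \<and> poly p x = 0"
proof -
  have *: "\<exists>x. a < x \<and> x < b \<and> poly q x = 0" if "poly q a < 0" "0 < poly q b" for q :: "'a poly"
    using rcf_IVT[of a b "coeff q" "degree q"] that assms(1) by (simp add: poly_altdef)
  show ?thesis
  proof (cases "poly p a < 0")
    case True
    with assms(2) have "0 < poly p b" by (simp add: mult_less_0_iff)
    with * True show ?thesis by blast
  next
    case False
    with assms(2) have "poly (- p) a < 0" "0 < poly (- p) b" by (auto simp: mult_less_0_iff)
    from *[OF this] show ?thesis by simp
  qed
qed

lemma rcf_sign_change:
  fixes p :: "'a::real_closed_field poly"
  assumes "a < b" "sg (poly p a) \<noteq> sg (poly p b)"
  shows "\<exists>x. a \<le> x \<and> x \<le> b \<and> poly p x = 0"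
proof (cases "poly p a = 0 \<or> poly p b = 0")
  case False
  then have "poly p a * poly p b < 0" using assms(2)
    by (auto simp: sg_def mult_less_0_iff split: if_splits)
  from rcf_poly_IVT[OF assms(1) this] show ?thesis by (meson less_imp_le)
next
  case True
  then show ?thesis using assms(1) by (metis less_imp_le order_refl)
qed

text \<open>No completeness is available, so the proof is algebraic. Let \<open>c\<close> be the
  first root after \<open>a\<close> and split off all factors at \<open>a\<close> and
  \<open>c\<close>. The cofactor \<open>g\<close> has no root between them and keeps its sign, which
  forces a sign change of the essential factor \<open>h\<close> of the derivative.\<close>

lemma rcf_poly_Rolle:
  fixes p :: "'a::real_closed_field poly"
  assumes "a < b" "poly p a = 0" "poly p b = 0"
  shows "\<exists>x. a < x \<and> x < b \<and> poly (pderiv p) x = 0"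
proof (cases "p = 0")
  case True
  then show ?thesis using dense[OF assms(1)] by auto
next
  case False
  define Z where "Z = {x. a < x \<and> x \<le> b \<and> poly p x = 0}"
  have "finite Z" unfolding Z_def by (rule finite_subset[OF _ poly_roots_finite[OF False]]) auto
  moreover have "b \<in> Z" using assms by (simp add: Z_def)
  ultimately have Min: "Min Z \<in> Z" "\<And>x. x \<in> Z \<Longrightarrow> Min Z \<le> x"
    by (metis Min_in empty_iff, metis Min_le)
  define c where "c = Min Z"
  have c: "a < c" "c \<le> b" "poly p c = 0" using Min(1) unfolding c_def[symmetric] by (simp_all add: Z_def)
  have gap: "poly p x \<noteq> 0" if "a < x" "x < c" for x
    using Min(2)[of x] that c unfolding c_def[symmetric] by (auto simp: Z_def)
  obtain q where q: "p = [:- a, 1:] ^ order a p * q" "\<not> [:- a, 1:] dvd q" using order_decomp[OF False] by blast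
  have "order a p \<noteq> 0" using assms(2) False by (simp add: order_root)
  then obtain m where m: "order a p = Suc m" using not0_implies_Suc by blast
  have q0: "q \<noteq> 0" "poly q a \<noteq> 0" using q False by (auto simp: poly_eq_0_iff_dvd)
  obtain g where g: "q = [:- c, 1:] ^ order c q * g" "\<not> [:- c, 1:] dvd g" using order_decomp[OF q0(1)] by blast
  have "poly p c = (c - a) ^ order a p * poly q c" by (subst q(1)) simp
  then have "poly q c = 0" using c by simp
  then have "order c q \<noteq> 0" using q0 by (simp add: order_root)
  then obtain n where n: "order c q = Suc n" using not0_implies_Suc by blast
  have p_eq: "p = [:- a, 1:] ^ Suc m * ([:- c, 1:] ^ Suc n * g)" using q(1) g(1) m n by simp
  have "poly g c \<noteq> 0" using g(2) by (simp add: poly_eq_0_iff_dvd)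
  moreover have "poly g a \<noteq> 0"
  proof
    assume "poly g a = 0"
    then have "poly q a = 0" by (subst g(1)) simp
    then show False using q0 by simp
  qed
  ultimately have g0: "poly g c \<noteq> 0" "poly g a \<noteq> 0" by auto
  have gsg: "sg (poly g a) = sg (poly g c)"
  proof (rule ccontr)
    assume "\<not> ?thesis"
    from rcf_sign_change[OF c(1) this] obtain x where x: "a \<le> x" "x \<le> c" "poly g x = 0" by blast
    then have "a < x" "x < c" using g0 by (auto simp: order.strict_iff_order)
    moreover have "poly p x = 0" using p_eq x by simp
    ultimately show False using gap by blast
  qed
  \<comment> \<open>The derivative without its factors at \<open>a\<close> and \<open>c\<close>. At
    \<open>a\<close> and at \<open>c\<close> only one summand survives, with factor
    \<open>a - c\<close> and \<open>c - a\<close> respectively, hence with opposite signs.\<close>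
  define h where "h = smult (of_nat (Suc m)) ([:- c, 1:] * g) + smult (of_nat (Suc n)) ([:- a, 1:] * g)
     + [:- a, 1:] * ([:- c, 1:] * pderiv g)"
  have dp: "pderiv p = [:- a, 1:] ^ m * [:- c, 1:] ^ n * h"
  proof -
    have "pderiv (A ^ Suc m * (C ^ Suc n * g)) = A ^ m * C ^ n * (smult (of_nat (Suc m)) (C * g)
        + smult (of_nat (Suc n)) (A * g) + A * (C * pderiv g))"
      if "pderiv A = 1" "pderiv C = 1" for A C :: "'a poly"
      unfolding pderiv_mult pderiv_power_Suc that by (simp add: algebra_simps del: of_nat_Suc)
    then show ?thesis unfolding p_eq h_def by (simp add: pderiv_pCons del: of_nat_Suc power_Suc)
  qed
  have "poly h a = of_nat (Suc m) * ((a - c) * poly g a)" "poly h c = of_nat (Suc n) * ((c - a) * poly g c)"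
    unfolding h_def by (simp_all add: algebra_simps)
  then have "sg (poly h a) = sg (a - c) * sg (poly g a)" "sg (poly h c) = sg (c - a) * sg (poly g c)"
    using of_nat_0_less_iff[of "Suc m", where 'a='a] of_nat_0_less_iff[of "Suc n", where 'a='a]
    by (simp_all only: sg_mult sg_simps(3)[symmetric] zero_less_Suc simp_thms mult_1)
  moreover have "sg (a - c) = - 1" "sg (c - a) = 1" using c by simp_all
  ultimately have "sg (poly h a) = - sg (poly g a)" "sg (poly h c) = sg (poly g a)" using gsg by simp_all
  then have "sg (poly h a) * sg (poly h c) = - (sg (poly g a) * sg (poly g a))" by simp
  also have "\<dots> = - 1" using g0(2) by (simp add: sg_def)
  finally have "poly h a * poly h c < 0" by (simp add: sg_mult[symmetric])
  from rcf_poly_IVT[OF c(1) this] obtain x where "a < x" "x < c" "poly h x = 0" by blast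
  then show ?thesis using dp c by (intro exI[of _ x]) auto
qed

lemma rcf_poly_MVT:
  fixes p :: "'a::real_closed_field poly"
  assumes "a < b"
  shows "\<exists>x. a < x \<and> x < b \<and> poly p b - poly p a = (b - a) * poly (pderiv p) x"
proof -
  define d where "d = poly p b - poly p a"
  \<comment> \<open>The difference of \<open>p\<close> and its chord, multiplied by
    \<open>b - a\<close> to avoid a quotient.\<close>
  define q where "q = smult (b - a) p - [:(b - a) * poly p a - d * a, d:]"
  have "poly q a = 0" "poly q b = 0" by (simp_all add: q_def d_def algebra_simps)
  from rcf_poly_Rolle[OF assms this] obtain x where x: "a < x" "x < b" "poly (pderiv q) x = 0" by blast
  have "poly (pderiv q) x = (b - a) * poly (pderiv p) x - d"
    by (simp add: q_def pderiv_diff pderiv_smult pderiv_pCons)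
  then show ?thesis using x by (intro exI[of _ x]) (simp add: d_def)
qed

lemma poly_ge_lead_coeff:
  fixes p :: "'a::linordered_field poly"
  assumes "0 < lead_coeff p"
  shows "\<exists>M. \<forall>x\<ge>M. lead_coeff p \<le> poly p x"
  using assms
proof (induction p)
  case 0
  then show ?case by simp
next
  case (pCons a p)
  show ?case
  proof (cases "p = 0")
    case False
    then have l: "lead_coeff (pCons a p) = lead_coeff p" "0 < lead_coeff p"
      using pCons.prems False by simp_all
    from pCons.IH[OF l(2)] obtain M where M: "\<And>x. M \<le> x \<Longrightarrow> lead_coeff p \<le> poly p x" by blast
    have "lead_coeff p \<le> poly (pCons a p) x" if x: "x \<ge> max M (1 + \<bar>a\<bar> / lead_coeff p)" for x
    proof -
      have "0 \<le> \<bar>a\<bar> / lead_coeff p" using less_imp_le[OF l(2)] by (intro divide_nonneg_nonneg) simp_all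
      then have "0 \<le> x" using x by simp
      have "lead_coeff p + \<bar>a\<bar> = (1 + \<bar>a\<bar> / lead_coeff p) * lead_coeff p" using False by (simp add: distrib_right)
      also have "\<dots> \<le> x * lead_coeff p" using x l by (intro mult_right_mono) auto
      also have "\<dots> \<le> x * poly p x" using M x \<open>0 \<le> x\<close> by (intro mult_left_mono) auto
      finally have "lead_coeff p \<le> a + x * poly p x" using abs_ge_minus_self[of a] by linarith
      then show ?thesis by (simp only: l(1) poly_pCons)
    qed
    then show ?thesis unfolding l(1) by blast
  qed auto
qed

lemma sg_at_infinity:
  fixes p :: "'a::linordered_field poly"
  shows "\<exists>M>0. \<forall>x\<ge>M. sg (poly p x) = sg (lead_coeff p) \<and> sg (poly p (- x)) = (- 1) ^ degree p * sg (lead_coeff p)"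
proof -
  have pos: "\<exists>M. \<forall>x\<ge>M. sg (poly q x) = sg (lead_coeff q)" for q :: "'a poly"
  proof -
    consider "lead_coeff q = 0" | "0 < lead_coeff q" | "lead_coeff q < 0" by (meson linorder_neqE)
    then show ?thesis
    proof cases
      case 2
      from poly_ge_lead_coeff[OF this] obtain M where "\<And>x. M \<le> x \<Longrightarrow> lead_coeff q \<le> poly q x" by blast
      with 2 have "\<forall>x\<ge>M. sg (poly q x) = sg (lead_coeff q)"
        by (metis order.strict_trans2 sg_simps(3))
      then show ?thesis by blast
    next
      case 3
      then have "0 < lead_coeff (- q)" by simp
      from poly_ge_lead_coeff[OF this] obtain M where M: "\<And>x. M \<le> x \<Longrightarrow> lead_coeff (- q) \<le> poly (- q) x" by blast
      have "\<forall>x\<ge>M. sg (poly q x) = sg (lead_coeff q)"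
      proof (intro allI impI)
        fix x assume "x \<ge> M"
        from M[OF this] have "poly q x \<le> lead_coeff q" by simp
        then have "poly q x < 0" using 3 by linarith
        then show "sg (poly q x) = sg (lead_coeff q)" using 3 by (metis sg_simps(4))
      qed
      then show ?thesis by blast
    qed auto
  qed
  obtain M1 where M1: "\<And>x. x \<ge> M1 \<Longrightarrow> sg (poly p x) = sg (lead_coeff p)" using pos[of p] by blast
  obtain M2 where M2: "\<And>x. x \<ge> M2 \<Longrightarrow> sg (poly (p \<circ>\<^sub>p [:0, - 1:]) x) = sg (lead_coeff (p \<circ>\<^sub>p [:0, - 1:]))"
    using pos by blast
  have "lead_coeff (p \<circ>\<^sub>p [:0, - 1:]) = lead_coeff p * (- 1) ^ degree p"
    by (subst lead_coeff_comp) auto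
  then have *: "sg (lead_coeff (p \<circ>\<^sub>p [:0, - 1:])) = (- 1) ^ degree p * sg (lead_coeff p)"
    by (simp add: sg_mult sg_power) (simp add: sg_def)
  show ?thesis
    using M1 M2 * by (intro exI[of _ "max 1 (max M1 M2)"]) (auto simp: poly_pcompose)
qed

text \<open>A sign diagram common to two fields is encoded by a finite set \<open>\<Theta>\<close>
  of matched marks, strictly monotone when \<open>increasing\<close>. Its cells are the marks and
  the open intervals that they leave; \<open>same_pos\<close> relates points of corresponding cells,
  and \<open>same_signs\<close> says that \<open>p\<close> and \<open>q\<close> have equal constant
  signs on corresponding cells.\<close>

definition same_pos :: "('a::linordered_idom \<times> 'b::linordered_idom) set \<Rightarrow> 'a \<Rightarrow> 'b \<Rightarrow> bool" where
  "same_pos \<Theta> b b' \<longleftrightarrow> (\<forall>(x, y)\<in>\<Theta>. sg (b - x) = sg (b' - y))"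

definition increasing :: "('a::linordered_idom \<times> 'b::linordered_idom) set \<Rightarrow> bool" where
  "increasing \<Theta> \<longleftrightarrow> finite \<Theta> \<and> (\<forall>(x, y)\<in>\<Theta>. same_pos \<Theta> x y)"

definition same_signs :: "('a::linordered_idom \<times> 'b::linordered_idom) set \<Rightarrow> 'a poly \<Rightarrow> 'b poly \<Rightarrow> bool" where
  "same_signs \<Theta> p q \<longleftrightarrow> (\<forall>b b'. same_pos \<Theta> b b' \<longrightarrow> sg (poly p b) = sg (poly q b'))"

lemma same_pos_iff: "same_pos \<Theta> b b' \<longleftrightarrow> (\<forall>x y. (x, y) \<in> \<Theta> \<longrightarrow> sg (b - x) = sg (b' - y))"
  by (auto simp: same_pos_def)

lemma same_posD: "same_pos \<Theta> b b' \<Longrightarrow> (x, y) \<in> \<Theta> \<Longrightarrow> sg (b - x) = sg (b' - y)"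
  by (auto simp: same_pos_def)

lemma same_pos_order:
  assumes "same_pos \<Theta> b b'" "(x, y) \<in> \<Theta>"
  shows "b < x \<longleftrightarrow> b' < y" "b = x \<longleftrightarrow> b' = y" "x < b \<longleftrightarrow> y < b'"
  using sg_pos_iff[OF same_posD[OF assms]] sg_neg_iff[OF same_posD[OF assms]] sg_zero_iff[OF same_posD[OF assms]]
  by auto

lemma increasingD: "increasing \<Theta> \<Longrightarrow> finite \<Theta>" "increasing \<Theta> \<Longrightarrow> (x, y) \<in> \<Theta> \<Longrightarrow> same_pos \<Theta> x y"
  by (auto simp: increasing_def)

lemma same_pos_converse: "same_pos (\<Theta>\<inverse>) b' b \<longleftrightarrow> same_pos \<Theta> b b'"
  unfolding same_pos_iff converse_iff by metis

lemma increasing_converse: "increasing (\<Theta>\<inverse>) \<longleftrightarrow> increasing \<Theta>"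
  by (auto simp: increasing_def same_pos_converse)

lemma same_signs_converse: "same_signs (\<Theta>\<inverse>) q p \<longleftrightarrow> same_signs \<Theta> p q"
  by (auto simp: same_signs_def same_pos_converse)

lemma same_pos_mono: "same_pos \<Theta> b b' \<Longrightarrow> \<Theta>' \<subseteq> \<Theta> \<Longrightarrow> same_pos \<Theta>' b b'"
  by (auto simp: same_pos_def)

lemma increasing_mono: "increasing \<Theta> \<Longrightarrow> \<Theta>' \<subseteq> \<Theta> \<Longrightarrow> increasing \<Theta>'"
  unfolding increasing_def by (blast intro: finite_subset same_pos_mono)

lemma same_signs_mono: "same_signs \<Theta>' p q \<Longrightarrow> \<Theta>' \<subseteq> \<Theta> \<Longrightarrow> same_signs \<Theta> p q"
  by (auto simp: same_signs_def intro: same_pos_mono)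

lemma finite_between:
  fixes L U :: "'a::linordered_field set"
  assumes "finite L" "finite U" "\<And>l u. l \<in> L \<Longrightarrow> u \<in> U \<Longrightarrow> l < u"
  shows "\<exists>c. (\<forall>l\<in>L. l < c) \<and> (\<forall>u\<in>U. c < u)"
proof (cases "L = {}")
  case True
  show ?thesis
  proof (cases "U = {}")
    case False
    with assms have "\<forall>u\<in>U. Min U - 1 < u" by (metis Min_le diff_less_eq le_less_trans less_add_one order.strict_trans1)
    with True show ?thesis by blast
  qed (use True in auto)
next
  case L: False
  show ?thesis
  proof (cases "U = {}")
    case True
    from L assms have "\<forall>l\<in>L. l < Max L + 1" by (metis Max_ge le_less_trans less_add_one)
    with True show ?thesis by blast
  next
    case False
    then have "Max L < Min U" using L assms by simp
    from dense[OF this] obtain c where "Max L < c" "c < Min U" by blast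
    with L False assms show ?thesis by (intro exI[of _ c]) auto
  qed
qed

text \<open>Corresponding open cells are nonempty, as an ordered field is dense and has no end
  points.\<close>

lemma same_pos_exists:
  fixes \<Theta> :: "('a::linordered_field \<times> 'b::linordered_field) set"
  assumes "increasing \<Theta>"
  shows "\<exists>b'. same_pos \<Theta> b b'"
proof (cases "b \<in> fst ` \<Theta>")
  case True
  then show ?thesis using increasingD(2)[OF assms] by force
next
  case False
  have "\<exists>c. (\<forall>l\<in>snd ` {z \<in> \<Theta>. fst z < b}. l < c) \<and> (\<forall>u\<in>snd ` {z \<in> \<Theta>. b < fst z}. c < u)"
  proof (rule finite_between)
    fix l u assume "l \<in> snd ` {z \<in> \<Theta>. fst z < b}" "u \<in> snd ` {z \<in> \<Theta>. b < fst z}"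
    then obtain x x' where "(x, l) \<in> \<Theta>" "x < b" "(x', u) \<in> \<Theta>" "b < x'" by auto
    then show "l < u" using same_pos_order(1)[OF increasingD(2)[OF assms]] by (meson less_trans)
  qed (use increasingD(1)[OF assms] in auto)
  then obtain c where c: "\<And>x y. (x, y) \<in> \<Theta> \<Longrightarrow> x < b \<Longrightarrow> y < c" "\<And>x y. (x, y) \<in> \<Theta> \<Longrightarrow> b < x \<Longrightarrow> c < y"
    by force
  have "sg (b - x) = sg (c - y)" if "(x, y) \<in> \<Theta>" for x y
  proof -
    have "b \<noteq> x" using that False by force
    then show ?thesis using c[OF that] by (cases "x < b") (auto simp: sg_def)
  qed
  then show ?thesis by (auto simp: same_pos_def)
qed

text \<open>An unmarked root would lie in an open cell, and \<open>p\<close> would have sign 0 on a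
  whole interval.\<close>

lemma same_signs_root:
  fixes p :: "'a::linordered_field poly" and q :: "'b::linordered_field poly"
  assumes "increasing \<Theta>" "same_signs \<Theta> p q" "p \<noteq> 0" "poly p b = 0"
  shows "\<exists>y. (b, y) \<in> \<Theta> \<and> poly q y = 0"
proof -
  have "b \<in> fst ` \<Theta>"
  proof (rule ccontr)
    assume b: "b \<notin> fst ` \<Theta>"
    obtain b' where b': "same_pos \<Theta> b b'" using same_pos_exists[OF assms(1)] by blast
    have fin: "finite (fst ` \<Theta>)" using increasingD(1)[OF assms(1)] by simp
    have "\<exists>c. (\<forall>l\<in>insert b {x \<in> fst ` \<Theta>. x < b}. l < c) \<and> (\<forall>u\<in>{x \<in> fst ` \<Theta>. b < x}. c < u)"
      by (rule finite_between) (use fin in auto)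
    then obtain c where c: "b < c" "\<And>x. x \<in> fst ` \<Theta> \<Longrightarrow> b < x \<Longrightarrow> c < x" by auto
    have "poly p d = 0" if d: "d \<in> {b<..<c}" for d
    proof -
      have "same_pos \<Theta> d b'"
        unfolding same_pos_def
      proof safe
        fix x y assume xy: "(x, y) \<in> \<Theta>"
        then have x: "x \<in> fst ` \<Theta>" by force
        have "sg (d - x) = sg (b - x)"
        proof (cases "b < x")
          case True
          then show ?thesis using c(2)[OF x] d by (auto simp: sg_def)
        next
          case False
          then have "x < b" using b x by (metis linorder_neqE)
          then show ?thesis using d by (auto simp: sg_def)
        qed
        then show "sg (d - x) = sg (b' - y)" using same_posD[OF b' xy] by simp
      qed
      then have "sg (poly p d) = sg (poly p b)" using assms(2) b' unfolding same_signs_def by metis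
      then show ?thesis using assms(4) by simp
    qed
    then have "{b<..<c} \<subseteq> {x. poly p x = 0}" by blast
    moreover have "infinite {b<..<c}" using c(1) by (rule infinite_Ioo)
    ultimately show False using poly_roots_finite[OF assms(3)] finite_subset by blast
  qed
  then obtain y where y: "(b, y) \<in> \<Theta>" by force
  with assms(2) increasingD(2)[OF assms(1) y] have "sg (poly p b) = sg (poly q y)" by (simp add: same_signs_def)
  with assms(4) y show ?thesis by auto
qed

definition agree_at :: "('a::linordered_idom \<times> 'b::linordered_idom) set \<Rightarrow> 'a poly \<Rightarrow> 'b poly \<Rightarrow> bool" where
  "agree_at \<Theta> p q \<longleftrightarrow> (\<forall>(x, y)\<in>\<Theta>. sg (poly p x) = sg (poly q y))"

text \<open>The situation in which signs at the marks determine everything up to the position of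
  roots: between neighbouring marks \<open>f\<close> is strictly monotone, and outside the two
  extreme pairs both polynomials keep their signs. The clause on critical points speaks of
  \<open>f\<close> alone; for \<open>f'\<close> it is imposed through the converse of
  \<open>\<Theta>\<close>.\<close>

definition controlled :: "('a::linordered_idom \<times> 'b::linordered_idom) set \<Rightarrow> 'a poly \<Rightarrow> 'b poly \<Rightarrow> bool" where
  "controlled \<Theta> f f' \<longleftrightarrow>
     (\<forall>x. poly (pderiv f) x = 0 \<longrightarrow> x \<in> fst ` \<Theta>) \<and>
     (\<exists>(x, y)\<in>\<Theta>. (\<forall>b>x. sg (poly f b) = sg (poly f x)) \<and> (\<forall>b>y. sg (poly f' b) = sg (poly f' y))) \<and>
     (\<exists>(x, y)\<in>\<Theta>. (\<forall>b<x. sg (poly f b) = sg (poly f x)) \<and> (\<forall>b<y. sg (poly f' b) = sg (poly f' y)))"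

lemma neighbours:
  fixes \<Theta> :: "('a::linordered_idom \<times> 'b::linordered_idom) set"
  assumes "increasing \<Theta>" "(x0, y0) \<in> \<Theta>" "x0 < b" "(x1, y1) \<in> \<Theta>" "b < x1" "b \<notin> fst ` \<Theta>"
  shows "\<exists>x y x' y'. (x, y) \<in> \<Theta> \<and> (x', y') \<in> \<Theta> \<and> x < b \<and> b < x' \<and>
           (\<forall>c c'. x < c \<longrightarrow> c < x' \<longrightarrow> y < c' \<longrightarrow> c' < y' \<longrightarrow> same_pos \<Theta> c c') \<and>
           (\<forall>c. x < c \<longrightarrow> c < x' \<longrightarrow> c \<notin> fst ` \<Theta>) \<and> (\<forall>c'. y < c' \<longrightarrow> c' < y' \<longrightarrow> c' \<notin> snd ` \<Theta>)"
proof -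
  define L where "L = {x \<in> fst ` \<Theta>. x < b}"
  define U where "U = {x \<in> fst ` \<Theta>. b < x}"
  have fin: "finite L" "finite U" using increasingD(1)[OF assms(1)] by (auto simp: L_def U_def)
  have "x0 \<in> L" "x1 \<in> U" using assms by (force simp: L_def U_def)+
  then have ne: "L \<noteq> {}" "U \<noteq> {}" by auto
  define x where "x = Max L"
  define x' where "x' = Min U"
  have x: "x \<in> L" "x' \<in> U" unfolding x_def x'_def using Max_in[OF fin(1) ne(1)] Min_in[OF fin(2) ne(2)] by auto
  then obtain y y' where xy: "(x, y) \<in> \<Theta>" "(x', y') \<in> \<Theta>" by (auto simp: L_def U_def)
  have lt: "x < b" "b < x'" using x by (auto simp: L_def U_def)
  have sep: "(u \<le> x \<and> v \<le> y) \<or> (x' \<le> u \<and> y' \<le> v)" if uv: "(u, v) \<in> \<Theta>" for u v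
  proof (cases "u < b")
    case True
    then have "u \<in> L" using uv by (force simp: L_def)
    then have "u \<le> x" unfolding x_def using fin by simp
    then show ?thesis using same_pos_order(3)[OF increasingD(2)[OF assms(1) uv] xy(1)] by (simp add: not_less[symmetric])
  next
    case False
    then have "u \<in> U" using uv assms(6) by (force simp: U_def)
    then have "x' \<le> u" unfolding x'_def using fin by simp
    then show ?thesis using same_pos_order(1)[OF increasingD(2)[OF assms(1) uv] xy(2)] by (simp add: not_less[symmetric])
  qed
  have pos: "same_pos \<Theta> c c'" if "x < c" "c < x'" "y < c'" "c' < y'" for c c'
    unfolding same_pos_iff
  proof (intro allI impI)
    fix u v assume "(u, v) \<in> \<Theta>"
    from sep[OF this] that show "sg (c - u) = sg (c' - v)" by (auto simp: sg_def)
  qed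
  have "c \<notin> fst ` \<Theta>" if "x < c" "c < x'" for c using sep that by force
  moreover have "c' \<notin> snd ` \<Theta>" if "y < c'" "c' < y'" for c' using sep that by force
  ultimately show ?thesis using xy lt pos by blast
qed

lemma rcf_monotone:
  fixes p :: "'a::real_closed_field poly"
  assumes "\<And>c. x < c \<Longrightarrow> c < x' \<Longrightarrow> poly (pderiv p) c \<noteq> 0" "x < b" "b < x'" "x \<le> u" "u < v" "v \<le> x'"
  shows "sg (poly p v - poly p u) = sg (poly (pderiv p) b)"
proof -
  from rcf_poly_MVT[OF assms(5)] obtain c where c: "u < c" "c < v" "poly p v - poly p u = (v - u) * poly (pderiv p) c" by blast
  have xc: "x < c" "c < x'" using c assms by auto
  have "sg (poly (pderiv p) c) = sg (poly (pderiv p) b)"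
  proof (rule ccontr)
    assume ne: "\<not> ?thesis"
    have "\<exists>d. min b c \<le> d \<and> d \<le> max b c \<and> poly (pderiv p) d = 0"
    proof (cases b c rule: linorder_cases)
      case less
      with rcf_sign_change[OF less, of "pderiv p"] ne show ?thesis by force
    next
      case greater
      with rcf_sign_change[OF greater, of "pderiv p"] ne show ?thesis by force
    qed (use ne in simp)
    then obtain d where "min b c \<le> d" "d \<le> max b c" "poly (pderiv p) d = 0" by blast
    moreover from this have "x < d" "d < x'" using xc assms by (auto simp: min_def max_def split: if_splits)
    ultimately show False using assms(1) by blast
  qed
  moreover have "sg (v - u) = 1" using assms by simp
  ultimately show ?thesis using c(3) by (simp add: sg_mult)
qed

text \<open>Otherwise \<open>b\<close> lies in a bounded open cell on which both polynomials are
  monotone in the same direction. The signs at its ends agree, and monotonicity makes them opposite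
  at the two ends, so each polynomial has a root in the cell; but these roots lie on different sides
  of \<open>b\<close> and \<open>b'\<close>, against \<open>roots\<close>. Applied to negatives and
  to the converse diagram, this yields equality of signs.\<close>

lemma positive_transfer:
  fixes f :: "'a::real_closed_field poly" and f' :: "'b::real_closed_field poly"
  assumes inc: "increasing \<Theta>" and agree: "agree_at \<Theta> f f'" and deriv: "same_signs \<Theta> (pderiv f) (pderiv f')"
    and ctrl: "controlled \<Theta> f f'" and bb: "same_pos \<Theta> b b'"
    and roots: "\<And>c c'. poly f c = 0 \<Longrightarrow> poly f' c' = 0 \<Longrightarrow> same_pos \<Theta> c c' \<Longrightarrow> sg (b - c) = sg (b' - c')"
    and pos: "0 < poly f b"
  shows "0 < poly f' b'"
proof (rule ccontr)
  assume neg: "\<not> 0 < poly f' b'"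
  have agreeD: "sg (poly f x) = sg (poly f' y)" if "(x, y) \<in> \<Theta>" for x y
    using agree that by (auto simp: agree_at_def)
  obtain x0 y0 where lo: "(x0, y0) \<in> \<Theta>" "\<And>b. b < x0 \<Longrightarrow> sg (poly f b) = sg (poly f x0)"
    "\<And>b. b < y0 \<Longrightarrow> sg (poly f' b) = sg (poly f' y0)" using ctrl unfolding controlled_def by blast
  obtain x1 y1 where hi: "(x1, y1) \<in> \<Theta>" "\<And>b. x1 < b \<Longrightarrow> sg (poly f b) = sg (poly f x1)"
    "\<And>b. y1 < b \<Longrightarrow> sg (poly f' b) = sg (poly f' y1)" using ctrl unfolding controlled_def by blast
  have ne: "sg (poly f b) \<noteq> sg (poly f' b')" using pos neg sg_pos_iff by blast
  have nb: "b \<notin> fst ` \<Theta>"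
  proof
    assume "b \<in> fst ` \<Theta>"
    then obtain y where y: "(b, y) \<in> \<Theta>" by force
    then have "b' = y" using same_pos_order(2)[OF bb y] by simp
    then show False using agreeD[OF y] ne by simp
  qed
  have x0b: "x0 < b"
  proof (rule ccontr)
    assume "\<not> x0 < b"
    moreover have "b \<noteq> x0" using nb lo(1) by force
    ultimately have b: "b < x0" by simp
    then have "b' < y0" using same_pos_order(1)[OF bb lo(1)] by simp
    from lo(3)[OF this] show False using lo(2)[OF b] agreeD[OF lo(1)] ne by metis
  qed
  have bx1: "b < x1"
  proof (rule ccontr)
    assume "\<not> b < x1"
    moreover have "b \<noteq> x1" using nb hi(1) by force
    ultimately have b: "x1 < b" by simp
    then have "y1 < b'" using same_pos_order(3)[OF bb hi(1)] by simp
    from hi(3)[OF this] show False using hi(2)[OF b] agreeD[OF hi(1)] ne by metis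
  qed
  from neighbours[OF inc lo(1) x0b hi(1) bx1 nb] obtain x y x' y' where nbr: "(x, y) \<in> \<Theta>" "(x', y') \<in> \<Theta>" "x < b" "b < x'"
    and gap: "\<And>c c'. x < c \<Longrightarrow> c < x' \<Longrightarrow> y < c' \<Longrightarrow> c' < y' \<Longrightarrow> same_pos \<Theta> c c'"
    and gap1: "\<And>c. x < c \<Longrightarrow> c < x' \<Longrightarrow> c \<notin> fst ` \<Theta>" and gap2: "\<And>c'. y < c' \<Longrightarrow> c' < y' \<Longrightarrow> c' \<notin> snd ` \<Theta>"
    by metis
  have b': "y < b'" "b' < y'" using same_pos_order[OF bb nbr(1)] same_pos_order[OF bb nbr(2)] nbr by simp_all
  have d1: "poly (pderiv f) c \<noteq> 0" if "x < c" "c < x'" for c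
    using gap1[OF that] ctrl by (auto simp: controlled_def)
  have d2: "poly (pderiv f') c' \<noteq> 0" if c': "y < c'" "c' < y'" for c'
  proof -
    have "sg (poly (pderiv f) b) = sg (poly (pderiv f') c')"
      using deriv gap[OF nbr(3,4) c'] by (simp add: same_signs_def)
    then show ?thesis using d1[OF nbr(3,4)] sg_zero_iff by blast
  qed
  have mono1: "sg (poly f v - poly f u) = sg (poly (pderiv f) b)" if "x \<le> u" "u < v" "v \<le> x'" for u v
    using rcf_monotone[OF d1 nbr(3,4) that] .
  have mono2: "sg (poly f' v - poly f' u) = sg (poly (pderiv f) b)" if "y \<le> u" "u < v" "v \<le> y'" for u v
    using rcf_monotone[OF d2 b' that] deriv bb by (simp add: same_signs_def)
  have ends: "sg (poly f x) = sg (poly f' y)" "sg (poly f x') = sg (poly f' y')" using agreeD nbr by auto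
  consider "0 < poly (pderiv f) b" | "poly (pderiv f) b < 0" using d1[OF nbr(3,4)] by (meson linorder_neqE)
  then show False
  proof cases
    case 1
    then have s: "sg (poly (pderiv f) b) = 1" by simp
    have "0 < poly f x' - poly f b" using mono1[of b x'] nbr s by simp
    then have "0 < poly f x'" using pos by simp
    then have y': "0 < poly f' y'" using ends(2) sg_pos_iff by blast
    have "0 < poly f' b' - poly f' y" using mono2[of y b'] b' s by simp
    then have "poly f' y < 0" using neg by simp
    then have "poly f x < 0" using ends(1) sg_neg_iff by blast
    then have "poly f x * poly f b < 0" using pos by (simp add: mult_less_0_iff)
    from rcf_poly_IVT[OF nbr(3) this] obtain c where c: "x < c" "c < b" "poly f c = 0" by blast
    have "sg (poly f' b') \<noteq> sg (poly f' y')" using neg y' sg_pos_iff by blast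
    from rcf_sign_change[OF b'(2) this] obtain c' where c': "b' \<le> c'" "c' \<le> y'" "poly f' c' = 0" by blast
    moreover have "c' \<noteq> y'" using c'(3) y' by auto
    ultimately have "same_pos \<Theta> c c'" using gap[of c c'] c nbr b' by simp
    from roots[OF c(3) c'(3) this] have "c < b \<longleftrightarrow> c' < b'" using sg_pos_iff by fastforce
    then show False using c c' by simp
  next
    case 2
    then have s: "sg (poly (pderiv f) b) = - 1" by simp
    have "poly f b - poly f x < 0" using mono1[of x b] nbr s by simp
    then have "0 < poly f x" using pos by simp
    then have y: "0 < poly f' y" using ends(1) sg_pos_iff by blast
    have "poly f' y' - poly f' b' < 0" using mono2[of b' y'] b' s by simp
    then have "poly f' y' < 0" using neg by simp
    then have "poly f x' < 0" using ends(2) sg_neg_iff by blast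
    then have "poly f b * poly f x' < 0" using pos by (simp add: mult_less_0_iff)
    from rcf_poly_IVT[OF nbr(4) this] obtain c where c: "b < c" "c < x'" "poly f c = 0" by blast
    have "sg (poly f' y) \<noteq> sg (poly f' b')" using neg y sg_pos_iff by blast
    from rcf_sign_change[OF b'(1) this] obtain c' where c': "y \<le> c'" "c' \<le> b'" "poly f' c' = 0" by blast
    moreover have "c' \<noteq> y" using c'(3) y by auto
    ultimately have "same_pos \<Theta> c c'" using gap[of c c'] c nbr b' by simp
    from roots[OF c(3) c'(3) this] have "b < c \<longleftrightarrow> b' < c'" using sg_neg_iff by fastforce
    then show False using c c' by simp
  qed
qed

text \<open>The new marks pair the roots that lie in corresponding cells. By Rolle's theorem a mark
  separates any two roots of \<open>f\<close>, and likewise of \<open>f'\<close>, so the enlarged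
  matching stays monotone.\<close>

lemma add_roots:
  fixes f :: "'a::real_closed_field poly" and f' :: "'b::real_closed_field poly"
  assumes inc: "increasing \<Theta>" and agree: "agree_at \<Theta> f f'" and deriv: "same_signs \<Theta> (pderiv f) (pderiv f')"
    and ctrl: "controlled \<Theta> f f'" and ctrl': "controlled (\<Theta>\<inverse>) f' f" and nz: "f \<noteq> 0" "f' \<noteq> 0"
  shows "\<exists>\<Theta>'. \<Theta> \<subseteq> \<Theta>' \<and> increasing \<Theta>' \<and> same_signs \<Theta>' f f'"
proof -
  define R where "R = {(c, c'). poly f c = 0 \<and> poly f' c' = 0 \<and> same_pos \<Theta> c c'}"
  have "finite R"
    by (rule finite_subset[OF _ finite_cartesian_product[OF poly_roots_finite[OF nz(1)] poly_roots_finite[OF nz(2)]]])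
      (auto simp: R_def)
  have between: "\<exists>x y. (x, y) \<in> \<Theta> \<and> c < x \<and> x < d"
    if "poly f c = 0" "poly f d = 0" "c < d" for c d
  proof -
    from rcf_poly_Rolle[OF that(3,1,2)] obtain x where "c < x" "x < d" "poly (pderiv f) x = 0" by blast
    then show ?thesis using ctrl unfolding controlled_def by force
  qed
  have between': "\<exists>x y. (x, y) \<in> \<Theta> \<and> c < y \<and> y < d"
    if "poly f' c = 0" "poly f' d = 0" "c < d" for c d
  proof -
    from rcf_poly_Rolle[OF that(3,1,2)] obtain y where "c < y" "y < d" "poly (pderiv f') y = 0" by blast
    then show ?thesis using ctrl' unfolding controlled_def by force
  qed
  have R_less: "c < d \<longleftrightarrow> c' < d'" if R: "(c, c') \<in> R" "(d, d') \<in> R" for c c' d d'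
  proof
    assume "c < d"
    with between[of c d] R obtain x y where "(x, y) \<in> \<Theta>" "c < x" "x < d" by (auto simp: R_def)
    with R same_pos_order have "c' < y" "y < d'" unfolding R_def by blast+
    then show "c' < d'" by simp
  next
    assume "c' < d'"
    with between'[of c' d'] R obtain x y where "(x, y) \<in> \<Theta>" "c' < y" "y < d'" by (auto simp: R_def)
    with R same_pos_order have "c < x" "x < d" unfolding R_def by blast+
    then show "c < d" by simp
  qed
  have "increasing (\<Theta> \<union> R)"
    unfolding increasing_def same_pos_iff
  proof (intro conjI ballI)
    show "finite (\<Theta> \<union> R)" using \<open>finite R\<close> increasingD(1)[OF inc] by simp
    fix z assume z: "z \<in> \<Theta> \<union> R"
    obtain c c' where zc: "z = (c, c')" by fastforce
    have "sg (c - x) = sg (c' - y)" if xy: "(x, y) \<in> \<Theta> \<union> R" for x y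
    proof -
      consider "z \<in> \<Theta>" "(x, y) \<in> \<Theta>" | "z \<in> R" "(x, y) \<in> \<Theta>" | "z \<in> \<Theta>" "(x, y) \<in> R" | "z \<in> R" "(x, y) \<in> R"
        using z xy by blast
      then show ?thesis
      proof cases
        case 1
        then show ?thesis using same_posD increasingD(2)[OF inc] zc by blast
      next
        case 2
        then show ?thesis using same_posD zc unfolding R_def by blast
      next
        case 3
        then have "sg (x - c) = sg (y - c')" using same_posD zc unfolding R_def by blast
        then have "sg (- (x - c)) = sg (- (y - c'))" unfolding sg_minus by simp
        then show ?thesis by simp
      next
        case 4
        then show ?thesis using R_less[of c c' x y] R_less[of x y c c'] zc
          by (intro sg_eqI) auto
      qed
    qed
    then show "case z of (x, y) \<Rightarrow> \<forall>xa ya. (xa, ya) \<in> \<Theta> \<union> R \<longrightarrow> sg (x - xa) = sg (y - ya)" using zc by blast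
  qed
  moreover have "same_signs (\<Theta> \<union> R) f f'"
    unfolding same_signs_def
  proof (intro allI impI)
    fix b b' assume bb': "same_pos (\<Theta> \<union> R) b b'"
    then have bb: "same_pos \<Theta> b b'" using same_pos_mono by blast
    have roots: "sg (b - c) = sg (b' - c')" if "poly f c = 0" "poly f' c' = 0" "same_pos \<Theta> c c'" for c c'
      using same_posD[OF bb'] that by (simp add: R_def)
    have roots': "sg (b' - c') = sg (b - c)" if "poly f' c' = 0" "poly f c = 0" "same_pos (\<Theta>\<inverse>) c' c" for c c'
      using roots[of c c'] that by (simp add: same_pos_converse)
    have conv: "increasing (\<Theta>\<inverse>)" "agree_at (\<Theta>\<inverse>) f' f" "same_signs (\<Theta>\<inverse>) (pderiv f') (pderiv f)" "same_pos (\<Theta>\<inverse>) b' b"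
      using inc agree deriv bb by (auto simp: increasing_converse same_signs_converse same_pos_converse agree_at_def)
    have neg: "agree_at \<Theta>' (- p) (- q)" if "agree_at \<Theta>' p q" for \<Theta>' :: "('c::linordered_idom \<times> 'd::linordered_idom) set" and p q
      using that by (auto simp: agree_at_def)
    have negs: "same_signs \<Theta>' (pderiv (- p)) (pderiv (- q))" if "same_signs \<Theta>' (pderiv p) (pderiv q)"
      for \<Theta>' :: "('c::linordered_idom \<times> 'd::linordered_idom) set" and p q
      using that by (auto simp: same_signs_def pderiv_minus)
    have negc: "controlled \<Theta>' (- p) (- q)" if "controlled \<Theta>' p q" for \<Theta>' :: "('c::linordered_idom \<times> 'd::linordered_idom) set" and p q
      using that by (simp add: controlled_def pderiv_minus)
    show "sg (poly f b) = sg (poly f' b')"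
    proof (rule sg_eqI)
      show "0 < poly f b \<Longrightarrow> 0 < poly f' b'"
        by (rule positive_transfer[OF inc agree deriv ctrl bb roots])
      show "0 < poly f' b' \<Longrightarrow> 0 < poly f b"
        by (rule positive_transfer[OF conv(1-3) ctrl' conv(4) roots'])
      have "0 < poly (- f) b \<Longrightarrow> 0 < poly (- f') b'"
        by (rule positive_transfer[OF inc neg[OF agree] negs[OF deriv] negc[OF ctrl] bb]) (simp_all add: roots)
      then show "poly f b < 0 \<Longrightarrow> poly f' b' < 0" by simp
      have "0 < poly (- f') b' \<Longrightarrow> 0 < poly (- f) b"
        by (rule positive_transfer[OF conv(1) neg[OF conv(2)] negs[OF conv(3)] negc[OF ctrl'] conv(4)]) (simp_all add: roots')
      then show "poly f' b' < 0 \<Longrightarrow> poly f b < 0" by simp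
    qed
  qed
  ultimately show ?thesis by blast
qed

lemma increasing_insert:
  assumes "increasing \<Theta>" "same_pos \<Theta> a b"
  shows "increasing (insert (a, b) \<Theta>)"
  unfolding increasing_def
proof (intro conjI ballI)
  show "finite (insert (a, b) \<Theta>)" using increasingD(1)[OF assms(1)] by simp
  fix z assume z: "z \<in> insert (a, b) \<Theta>"
  obtain x y where xy: "z = (x, y)" by fastforce
  have *: "sg (x - a) = sg (y - b)"
  proof (cases "(x, y) \<in> \<Theta>")
    case True
    then have "sg (- (a - x)) = sg (- (b - y))" using same_posD[OF assms(2)] unfolding sg_minus by simp
    then show ?thesis by simp
  qed (use z xy in auto)
  moreover have "same_pos \<Theta> x y" using z xy increasingD(2)[OF assms(1)] assms(2) by blast
  ultimately have "same_pos (insert (a, b) \<Theta>) x y" by (auto simp: same_pos_iff)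
  then show "case z of (x, y) \<Rightarrow> same_pos (insert (a, b) \<Theta>) x y" using xy by simp
qed

lemma restrict_to_roots:
  fixes F :: "'i \<Rightarrow> 'a::real_closed_field poly" and F' :: "'i \<Rightarrow> 'b::real_closed_field poly"
  assumes inc: "increasing \<Theta>" and F: "\<And>i. i \<in> I \<Longrightarrow> F i \<noteq> 0" "\<And>i. i \<in> I \<Longrightarrow> same_signs \<Theta> (F i) (F' i)"
    and i: "i \<in> I"
  shows "same_signs {(x, y) \<in> \<Theta>. \<exists>i\<in>I. poly (F i) x = 0} (F i) (F' i)"
  unfolding same_signs_def
proof (intro allI impI)
  fix b b' assume bb: "same_pos {(x, y) \<in> \<Theta>. \<exists>i\<in>I. poly (F i) x = 0} b b'"
  have "increasing (\<Theta>\<inverse>)" using inc by (simp add: increasing_converse)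
  from same_pos_exists[OF this] obtain a where "same_pos (\<Theta>\<inverse>) b' a" by blast
  then have a: "same_pos \<Theta> a b'" by (simp add: same_pos_converse)
  have "sg (poly (F i) a) = sg (poly (F i) b)"
  proof (rule ccontr)
    assume ne: "\<not> ?thesis"
    have "\<exists>r. min a b \<le> r \<and> r \<le> max a b \<and> poly (F i) r = 0"
    proof (cases a b rule: linorder_cases)
      case less
      with rcf_sign_change[OF less, of "F i"] ne show ?thesis by force
    next
      case greater
      with rcf_sign_change[OF greater, of "F i"] ne show ?thesis by force
    qed (use ne in simp)
    then obtain r where r: "min a b \<le> r" "r \<le> max a b" "poly (F i) r = 0" by blast
    obtain y where y: "(r, y) \<in> \<Theta>" using same_signs_root[OF inc F(2)[OF i] F(1)[OF i] r(3)] by blast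
    then have "sg (b - r) = sg (b' - y)" using same_posD[OF bb] i r(3) by blast
    also have "\<dots> = sg (a - r)" using same_posD[OF a y] by simp
    finally have "a = b" using r(1,2) by (auto simp: sg_def min_def max_def split: if_splits)
    then show False using ne by simp
  qed
  then show "sg (poly (F i) b) = sg (poly (F' i) b')"
    using F(2)[OF i] a by (simp add: same_signs_def)
qed

text \<open>The inductive step for one more polynomial \<open>f\<close>. Its signs at the retained
  marks come from \<open>rem\<close>, those near infinity from degree and leading coefficient, and
  its critical points are marked because its derivative belongs to the family;
  \<open>add_roots\<close> does the rest.\<close>

lemma sign_diagram_step:
  fixes F :: "'i \<Rightarrow> 'a::real_closed_field poly" and F' :: "'i \<Rightarrow> 'b::real_closed_field poly"
  assumes inc: "increasing \<Theta>" and nz: "\<And>i. i \<in> I \<Longrightarrow> F i \<noteq> 0" "\<And>i. i \<in> I \<Longrightarrow> F' i \<noteq> 0"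
    and signs: "\<And>i. i \<in> I \<Longrightarrow> same_signs \<Theta> (F i) (F' i)"
    and d: "d \<in> I" "F d = pderiv f" "F' d = pderiv f'"
    and lead: "sg (lead_coeff f) = sg (lead_coeff f')" "degree f = degree f'" "f \<noteq> 0"
    and rem: "\<And>i x y. i \<in> I \<Longrightarrow> (x, y) \<in> \<Theta> \<Longrightarrow> poly (F i) x = 0 \<Longrightarrow> sg (poly f x) = sg (poly f' y)"
  shows "\<exists>\<Theta>'. increasing \<Theta>' \<and> (\<forall>i\<in>I. same_signs \<Theta>' (F i) (F' i)) \<and> same_signs \<Theta>' f f'"
proof -
  define \<Theta>0 where "\<Theta>0 = {(x, y) \<in> \<Theta>. \<exists>i\<in>I. poly (F i) x = 0}"
  have sub: "\<Theta>0 \<subseteq> \<Theta>" by (auto simp: \<Theta>0_def)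
  have inc0: "increasing \<Theta>0" using increasing_mono[OF inc sub] .
  have signs0: "same_signs \<Theta>0 (F i) (F' i)" if "i \<in> I" for i
    unfolding \<Theta>0_def by (rule restrict_to_roots[OF inc nz(1) signs that])
  obtain T1 where T1: "T1 > 0" "\<And>x. x \<ge> T1 \<Longrightarrow> sg (poly f x) = sg (lead_coeff f)"
    "\<And>x. x \<ge> T1 \<Longrightarrow> sg (poly f (- x)) = (- 1) ^ degree f * sg (lead_coeff f)"
    using sg_at_infinity[of f] by blast
  obtain T2 where T2: "T2 > 0" "\<And>x. x \<ge> T2 \<Longrightarrow> sg (poly f' x) = sg (lead_coeff f')"
    "\<And>x. x \<ge> T2 \<Longrightarrow> sg (poly f' (- x)) = (- 1) ^ degree f' * sg (lead_coeff f')"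
    using sg_at_infinity[of f'] by blast
  have fin: "finite \<Theta>0" using increasingD(1)[OF inc0] .
  \<comment> \<open>The marks at \<open>M1\<close>, \<open>M2\<close> and their negatives enclose
    the old ones and lie where the leading terms already decide the signs.\<close>
  obtain M1 where M1: "T1 < M1" "\<And>x y. (x, y) \<in> \<Theta>0 \<Longrightarrow> \<bar>x\<bar> < M1"
    using finite_between[of "insert T1 ((\<lambda>z. \<bar>fst z\<bar>) ` \<Theta>0)" "{}"] fin by force
  obtain M2 where M2: "T2 < M2" "\<And>x y. (x, y) \<in> \<Theta>0 \<Longrightarrow> \<bar>y\<bar> < M2"
    using finite_between[of "insert T2 ((\<lambda>z. \<bar>snd z\<bar>) ` \<Theta>0)" "{}"] fin by force
  have pos1: "same_pos \<Theta>0 M1 M2"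
    unfolding same_pos_iff
  proof (intro allI impI)
    fix x y assume "(x, y) \<in> \<Theta>0"
    from M1(2)[OF this] M2(2)[OF this] have "0 < M1 - x" "0 < M2 - y" by auto
    then show "sg (M1 - x) = sg (M2 - y)" by (auto simp: sg_def)
  qed
  have pos2: "same_pos (insert (M1, M2) \<Theta>0) (- M1) (- M2)"
    unfolding same_pos_iff
  proof (intro allI impI)
    fix x y assume "(x, y) \<in> insert (M1, M2) \<Theta>0"
    then have "- M1 - x < 0" "- M2 - y < 0"
      using M1(2)[of x y] M2(2)[of x y] M1(1) M2(1) T1(1) T2(1) by auto
    then show "sg (- M1 - x) = sg (- M2 - y)" by (auto simp: sg_def)
  qed
  define \<Theta>1 where "\<Theta>1 = insert (- M1, - M2) (insert (M1, M2) \<Theta>0)"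
  have inc1: "increasing \<Theta>1" unfolding \<Theta>1_def by (intro increasing_insert inc0 pos1 pos2)
  have sub1: "\<Theta>0 \<subseteq> \<Theta>1" "(M1, M2) \<in> \<Theta>1" "(- M1, - M2) \<in> \<Theta>1" by (auto simp: \<Theta>1_def)
  have agree: "agree_at \<Theta>1 f f'"
  proof -
    have "sg (poly f x) = sg (poly f' y)" if xy: "(x, y) \<in> \<Theta>1" for x y
    proof -
      consider "(x, y) \<in> \<Theta>0" | "x = M1" "y = M2" | "x = - M1" "y = - M2" using xy by (auto simp: \<Theta>1_def)
      then show ?thesis
      proof cases
        case 1
        then show ?thesis using rem by (auto simp: \<Theta>0_def)
      next
        case 2
        then show ?thesis using T1(2)[of M1] T2(2)[of M2] M1 M2 lead by simp
      next
        case 3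
        then show ?thesis using T1(3)[of M1] T2(3)[of M2] M1 M2 lead by simp
      qed
    qed
    then show ?thesis by (auto simp: agree_at_def)
  qed
  have beyond: "\<forall>b>M1. sg (poly f b) = sg (poly f M1)" "\<forall>b<(- M1). sg (poly f b) = sg (poly f (- M1))"
  proof -
    show "\<forall>b>M1. sg (poly f b) = sg (poly f M1)" using T1(2) M1(1) by simp
    show "\<forall>b<(- M1). sg (poly f b) = sg (poly f (- M1))"
    proof (intro allI impI)
      fix b assume "b < - M1"
      then show "sg (poly f b) = sg (poly f (- M1))" using T1(3)[of M1] T1(3)[of "- b"] M1(1) by simp
    qed
  qed
  have beyond': "\<forall>b>M2. sg (poly f' b) = sg (poly f' M2)" "\<forall>b<(- M2). sg (poly f' b) = sg (poly f' (- M2))"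
  proof -
    show "\<forall>b>M2. sg (poly f' b) = sg (poly f' M2)" using T2(2) M2(1) by simp
    show "\<forall>b<(- M2). sg (poly f' b) = sg (poly f' (- M2))"
    proof (intro allI impI)
      fix b assume "b < - M2"
      then show "sg (poly f' b) = sg (poly f' (- M2))" using T2(3)[of M2] T2(3)[of "- b"] M2(1) by simp
    qed
  qed
  have crit: "x \<in> fst ` \<Theta>1" if "poly (pderiv f) x = 0" for x
  proof -
    have x: "poly (F d) x = 0" using that d by simp
    from same_signs_root[OF inc signs[OF d(1)] nz(1)[OF d(1)] this] obtain y where "(x, y) \<in> \<Theta>" by blast
    then have "(x, y) \<in> \<Theta>1" using x d(1) sub1 by (auto simp: \<Theta>0_def)
    then show ?thesis by force
  qed
  have crit': "y \<in> snd ` \<Theta>1" if "poly (pderiv f') y = 0" for y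
  proof -
    have y: "poly (F' d) y = 0" using that d by simp
    have "increasing (\<Theta>\<inverse>)" "same_signs (\<Theta>\<inverse>) (F' d) (F d)"
      using inc signs[OF d(1)] by (simp_all add: increasing_converse same_signs_converse)
    from same_signs_root[OF this nz(2)[OF d(1)] y] obtain x where "(x, y) \<in> \<Theta>" "poly (F d) x = 0" by blast
    then have "(x, y) \<in> \<Theta>1" using d(1) sub1 by (auto simp: \<Theta>0_def)
    then show ?thesis by force
  qed
  have ctrl: "controlled \<Theta>1 f f'"
    unfolding controlled_def using crit beyond beyond' sub1 by blast
  have ctrl': "controlled (\<Theta>1\<inverse>) f' f"
    unfolding controlled_def
  proof (intro conjI allI impI)
    show "\<And>y. poly (pderiv f') y = 0 \<Longrightarrow> y \<in> fst ` (\<Theta>1\<inverse>)" using crit' by force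
    show "\<exists>(x, y)\<in>\<Theta>1\<inverse>. (\<forall>b>x. sg (poly f' b) = sg (poly f' x)) \<and> (\<forall>b>y. sg (poly f b) = sg (poly f y))"
      using beyond beyond' sub1 by blast
    show "\<exists>(x, y)\<in>\<Theta>1\<inverse>. (\<forall>b<x. sg (poly f' b) = sg (poly f' x)) \<and> (\<forall>b<y. sg (poly f b) = sg (poly f y))"
      using beyond beyond' sub1 by blast
  qed
  have "same_signs \<Theta>1 (pderiv f) (pderiv f')"
    using same_signs_mono[OF signs0[OF d(1)] sub1(1)] d by simp
  moreover have "f' \<noteq> 0" using lead by (metis leading_coeff_0_iff sg_simps(1,5))
  ultimately obtain \<Theta>' where \<Theta>': "\<Theta>1 \<subseteq> \<Theta>'" "increasing \<Theta>'" "same_signs \<Theta>' f f'"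
    using add_roots[OF inc1 agree _ ctrl ctrl' lead(3)] by blast
  then have "same_signs \<Theta>' (F i) (F' i)" if "i \<in> I" for i
    using same_signs_mono[OF signs0[OF that]] sub1(1) by blast
  with \<Theta>' show ?thesis by blast
qed

section \<open>Transfer of sign conditions between real closed fields\<close>

definition is_hom :: "('a::comm_ring_1 \<Rightarrow> 'b::comm_ring_1) \<Rightarrow> bool" where
  "is_hom \<phi> \<longleftrightarrow> \<phi> 0 = 0 \<and> \<phi> 1 = 1 \<and> (\<forall>a b. \<phi> (a + b) = \<phi> a + \<phi> b \<and> \<phi> (a * b) = \<phi> a * \<phi> b)"

lemma is_homD:
  assumes "is_hom \<phi>"
  shows "\<phi> 0 = 0" "\<phi> 1 = 1" "\<phi> (a + b) = \<phi> a + \<phi> b" "\<phi> (a * b) = \<phi> a * \<phi> b" "\<phi> (- a) = - \<phi> a"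
    "\<phi> (a - b) = \<phi> a - \<phi> b" "\<phi> (a ^ n) = \<phi> a ^ n" "\<phi> (of_nat n) = of_nat n"
proof -
  show hom: "\<phi> 0 = 0" "\<phi> 1 = 1" "\<phi> (a + b) = \<phi> a + \<phi> b" "\<phi> (a * b) = \<phi> a * \<phi> b" for a b
    using assms by (auto simp: is_hom_def)
  show neg: "\<phi> (- a) = - \<phi> a" for a using hom(3)[of a "- a"] hom(1) by (simp add: eq_neg_iff_add_eq_0 add.commute)
  show "\<phi> (a - b) = \<phi> a - \<phi> b" using hom(3)[of a "- b"] neg by simp
  show "\<phi> (a ^ n) = \<phi> a ^ n" by (induction n) (simp_all add: hom)
  show "\<phi> (of_nat n) = of_nat n" by (induction n) (simp_all add: hom)
qed

lemma is_hom_sum: "is_hom \<phi> \<Longrightarrow> \<phi> (sum f I) = (\<Sum>i\<in>I. \<phi> (f i))"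
  by (induction I rule: infinite_finite_induct) (simp_all add: is_homD)

lemma map_poly_hom:
  assumes "is_hom \<phi>"
  shows "map_poly \<phi> (p + q) = map_poly \<phi> p + map_poly \<phi> q"
    "map_poly \<phi> (p - q) = map_poly \<phi> p - map_poly \<phi> q"
    "map_poly \<phi> (p * q) = map_poly \<phi> p * map_poly \<phi> q"
    "map_poly \<phi> (smult c p) = smult (\<phi> c) (map_poly \<phi> p)"
    "map_poly \<phi> (monom c n) = monom (\<phi> c) n"
    "\<phi> (poly p a) = poly (map_poly \<phi> p) (\<phi> a)"
proof -
  note h = is_homD[OF assms]
  show "map_poly \<phi> (p + q) = map_poly \<phi> p + map_poly \<phi> q" "map_poly \<phi> (p - q) = map_poly \<phi> p - map_poly \<phi> q"
    "map_poly \<phi> (smult c p) = smult (\<phi> c) (map_poly \<phi> p)"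
    by (rule poly_eqI, simp add: coeff_map_poly h)+
  show "map_poly \<phi> (p * q) = map_poly \<phi> p * map_poly \<phi> q"
    by (rule poly_eqI) (simp add: coeff_map_poly coeff_mult is_hom_sum[OF assms] h)
  show "map_poly \<phi> (monom c n) = monom (\<phi> c) n"
    by (rule poly_eqI) (simp add: coeff_map_poly h)
  show "\<phi> (poly p a) = poly (map_poly \<phi> p) (\<phi> a)"
    by (induction p) (simp_all add: map_poly_pCons h)
qed

text \<open>The library's \<^const>\<open>pderiv\<close> is restricted to rings without zero divisors.\<close>

definition formal_deriv :: "'a::comm_ring_1 poly \<Rightarrow> 'a poly" where
  "formal_deriv p = (\<Sum>i<degree p. monom (of_nat (Suc i) * coeff p (Suc i)) i)"

lemma coeff_formal_deriv: "coeff (formal_deriv p) i = of_nat (Suc i) * coeff p (Suc i)"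
proof -
  have "coeff (formal_deriv p) i = (\<Sum>j<degree p. if j = i then of_nat (Suc j) * coeff p (Suc j) else 0)"
    by (simp add: formal_deriv_def coeff_sum)
  also have "\<dots> = (if i < degree p then of_nat (Suc i) * coeff p (Suc i) else 0)"
    by (simp add: sum.delta' del: of_nat_Suc)
  also have "\<dots> = of_nat (Suc i) * coeff p (Suc i)" by (simp add: coeff_eq_0 del: of_nat_Suc)
  finally show ?thesis .
qed

lemma degree_formal_deriv: "0 < degree p \<Longrightarrow> degree (formal_deriv p) < degree p"
proof -
  assume p: "0 < degree p"
  have "coeff (formal_deriv p) i = 0" if "degree p \<le> i" for i
    using that by (simp add: coeff_formal_deriv coeff_eq_0)
  then show ?thesis using p by (metis leading_coeff_0_iff degree_0 not_le)
qed

lemma polys_over_formal_deriv: "subring_set R \<Longrightarrow> f \<in> polys_over R \<Longrightarrow> formal_deriv f \<in> polys_over R"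
  unfolding polys_over_def mem_Collect_eq coeff_formal_deriv
  by (metis subring_setD(5) subring_set_of_nat)

lemma map_poly_formal_deriv:
  fixes \<phi> :: "'a::comm_ring_1 \<Rightarrow> 'b::idom"
  assumes "is_hom \<phi>" shows "map_poly \<phi> (formal_deriv p) = pderiv (map_poly \<phi> p)"
  by (rule poly_eqI) (simp add: coeff_map_poly coeff_pderiv coeff_formal_deriv is_homD[OF assms] del: of_nat_Suc)

lemma degree_map_poly_hom:
  assumes "is_hom \<phi>" "\<phi> (lead_coeff p) \<noteq> 0"
  shows "degree (map_poly \<phi> p) = degree p" "lead_coeff (map_poly \<phi> p) = \<phi> (lead_coeff p)"
    "map_poly \<phi> p \<noteq> 0"
proof -
  show deg: "degree (map_poly \<phi> p) = degree p"
    by (rule map_poly_degree_eq) (use assms in simp)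
  show lc: "lead_coeff (map_poly \<phi> p) = \<phi> (lead_coeff p)"
    unfolding deg using assms by (simp add: coeff_map_poly is_homD)
  show "map_poly \<phi> p \<noteq> 0" using lc assms(2) by force
qed

text \<open>Elimination trades one polynomial for several of smaller degree, so the multiset order
  on degrees serves as termination measure.\<close>

definition degrees :: "'a::zero poly set \<Rightarrow> nat multiset" where
  "degrees S = image_mset degree (mset_set S)"

lemma degrees_decrease:
  assumes "finite S" "f \<in> S" "finite N" "\<And>g. g \<in> N \<Longrightarrow> degree g < degree f"
  shows "(degrees (S - {f} \<union> N), degrees S) \<in> Multiset.mult {(x, y). x < y}"
proof -
  \<comment> \<open>Members of \<open>N\<close> that already belong to the rest of the family
    contribute no further degree.\<close>
  define K where "K = degrees (N - (S - {f}))"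
  have "degrees (S - {f} \<union> N) = degrees (S - {f}) + K"
    unfolding K_def degrees_def image_mset_union[symmetric]
    using assms by (subst mset_set_Union[symmetric]) auto
  moreover have "degrees S = degrees (S - {f}) + {#degree f#}"
    unfolding degrees_def using mset_set.remove[OF assms(1,2)] by simp
  moreover have "k < degree f" if "k \<in> set_mset K" for k
    using that assms by (auto simp: K_def degrees_def)
  ultimately show ?thesis using one_step_implies_mult[of "{#degree f#}" K "{(x, y). x < y}"] by simp
qed

text \<open>
  Hormander's elimination step: a family containing \<open>f\<close> of maximal degree is replaced by the family in
  which \<open>f\<close> gives way to its derivative and to its remainders modulo the derivative and the other members.
  At the roots of a member \<open>g\<close> the sign of \<open>f\<close> is that of its remainder modulo \<open>g\<close>.
\<close>
theorem sign_diagram_transfer: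
  fixes S :: "'a::comm_ring_1 poly set"
  assumes "subring_set R" "finite S" "S \<subseteq> polys_over R"
  shows "\<exists>C. finite C \<and> C \<subseteq> R \<and>
    (\<forall>(\<phi> :: 'a \<Rightarrow> 'b::real_closed_field) (\<psi> :: 'a \<Rightarrow> 'c::real_closed_field).
       is_hom \<phi> \<longrightarrow> is_hom \<psi> \<longrightarrow> (\<forall>c\<in>C. sg (\<phi> c) = sg (\<psi> c)) \<longrightarrow>
       (\<exists>\<Theta>. increasing \<Theta> \<and> (\<forall>f\<in>S. same_signs \<Theta> (map_poly \<phi> f) (map_poly \<psi> f))))"
proof -
  have wf: "wf (Multiset.mult {(x :: nat, y). x < y})" by (intro wf_mult wf_less)
  show ?thesis
    using assms(2,3)
  proof (induction "degrees S" arbitrary: S rule: wf_induct_rule[OF wf])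
    case (1 S)
    note PS = subring_setD[OF subring_polys_over[OF assms(1)]]
    define good where "good S C \<longleftrightarrow> finite C \<and> C \<subseteq> R \<and>
      (\<forall>(\<phi> :: 'a \<Rightarrow> 'b) (\<psi> :: 'a \<Rightarrow> 'c). is_hom \<phi> \<longrightarrow> is_hom \<psi> \<longrightarrow> (\<forall>c\<in>C. sg (\<phi> c) = sg (\<psi> c)) \<longrightarrow>
       (\<exists>\<Theta>. increasing \<Theta> \<and> (\<forall>f\<in>S. same_signs \<Theta> (map_poly \<phi> f) (map_poly \<psi> f))))" for S C
    have IH: "\<exists>C. good (S - {f} \<union> N) C" if "f \<in> S" "finite N" "\<And>g. g \<in> N \<Longrightarrow> degree g < degree f" "N \<subseteq> polys_over R" for f N
      unfolding good_def
      by (rule 1(1)) (use degrees_decrease[OF 1(2) that(1-3)] 1(2,3) that in auto)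
    have const: "same_signs \<Theta> (map_poly \<phi> g) (map_poly \<psi> g)"
      if "is_hom \<phi>" "is_hom \<psi>" "degree g = 0" "sg (\<phi> (lead_coeff g)) = sg (\<psi> (lead_coeff g))"
      for \<Theta> g and \<phi> :: "'a \<Rightarrow> 'b" and \<psi> :: "'a \<Rightarrow> 'c"
    proof -
      obtain c where "g = [:c:]" using \<open>degree g = 0\<close> by (rule degree_eq_zeroE)
      then show ?thesis using that by (simp add: same_signs_def map_poly_pCons is_homD)
    qed
    have lcR: "lead_coeff ` S \<subseteq> R" using 1(3) lead_coeff_polys_over by blast
    have "\<exists>C. good S C"
    proof (cases "\<forall>f\<in>S. degree f = 0")
      case True
      have "good S (lead_coeff ` S)"
        unfolding good_def
      proof (intro conjI allI impI)
        fix \<phi> :: "'a \<Rightarrow> 'b" and \<psi> :: "'a \<Rightarrow> 'c"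
        assume "is_hom \<phi>" "is_hom \<psi>" "\<forall>c\<in>lead_coeff ` S. sg (\<phi> c) = sg (\<psi> c)"
        then have "\<forall>f\<in>S. same_signs {} (map_poly \<phi> f) (map_poly \<psi> f)" using const True by blast
        moreover have "increasing {}" by (simp add: increasing_def)
        ultimately show "\<exists>\<Theta>. increasing \<Theta> \<and> (\<forall>f\<in>S. same_signs \<Theta> (map_poly \<phi> f) (map_poly \<psi> f))" by blast
      qed (use 1(2) lcR in auto)
      then show ?thesis by blast
    next
      case False
      then have ne: "degree ` S \<noteq> {}" "finite (degree ` S)" using 1(2) by auto
      obtain f where f: "f \<in> S" "degree f = Max (degree ` S)" using Max_in[OF ne(2,1)] by auto
      have fmax: "degree g \<le> degree f" if "g \<in> S" for g using f(2) ne that by simp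
      obtain g0 where "g0 \<in> S" "degree g0 \<noteq> 0" using False by blast
      with fmax[of g0] have df: "0 < degree f" by linarith
      have fR: "f \<in> polys_over R" "formal_deriv f \<in> polys_over R"
        using f 1(3) polys_over_formal_deriv[OF assms(1)] by auto
      have ddf: "degree (formal_deriv f) < degree f" using degree_formal_deriv df by blast
      \<comment> \<open>If a leading coefficient vanishes in the images, \<open>g\<close> and its
        truncation have the same image, and the family with the truncation in place of
        \<open>g\<close> is smaller.\<close>
      define trunc where "trunc g = g - monom (lead_coeff g) (degree g)" for g :: "'a poly"
      have trunc_deg: "degree (trunc g) < degree g" if "0 < degree g" for g
      proof -
        have "coeff (trunc g) i = 0" if "degree g \<le> i" for i
          using that by (cases "i = degree g") (auto simp: trunc_def coeff_eq_0)
        then show ?thesis using that by (metis leading_coeff_0_iff degree_0 not_le)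
      qed
      have truncR: "trunc g \<in> polys_over R" if "g \<in> S" for g
        unfolding trunc_def using that 1(3) by (intro PS polys_over_monom assms(1) lead_coeff_polys_over) auto
      have "\<forall>g\<in>{g \<in> S. 0 < degree g}. \<exists>C. good (S - {g} \<union> {trunc g}) C"
        using IH[of _ "{trunc _}"] trunc_deg truncR by simp
      then obtain Ct where Ct: "\<And>g. g \<in> S \<Longrightarrow> 0 < degree g \<Longrightarrow> good (S - {g} \<union> {trunc g}) (Ct g)"
        by (metis (no_types, lifting) mem_Collect_eq)
      \<comment> \<open>Division is by nonconstant members only: a constant admits no remainder of
        smaller degree.\<close>
      define D where "D = {g \<in> insert (formal_deriv f) (S - {f}). 0 < degree g}"
      have D: "finite D" "D \<subseteq> polys_over R" "\<And>g. g \<in> D \<Longrightarrow> degree g \<le> degree f"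
        using 1(2,3) fR ddf fmax by (auto simp: D_def)
      have "\<forall>g\<in>D. \<exists>r. r \<in> polys_over R \<and> degree r < degree g \<and> (\<exists>e q. smult (lead_coeff g ^ e) f = g * q + r)"
        using pseudo_division_over[OF assms(1) fR(1)] D(2) by (fastforce simp: D_def)
      then obtain r where r: "\<And>g. g \<in> D \<Longrightarrow> r g \<in> polys_over R" "\<And>g. g \<in> D \<Longrightarrow> degree (r g) < degree g"
        "\<And>g. g \<in> D \<Longrightarrow> \<exists>e q. smult (lead_coeff g ^ e) f = g * q + r g" by metis
      define N where "N = insert (formal_deriv f) (r ` D)"
      have N: "finite N" "N \<subseteq> polys_over R" "\<And>g. g \<in> N \<Longrightarrow> degree g < degree f"
        using D(1) r(1) ddf fR order.strict_trans2[OF r(2) D(3)] by (auto simp: N_def)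
      obtain CN where CN: "good (S - {f} \<union> N) CN" using IH[OF f(1) N(1,3,2)] by blast
      \<comment> \<open>Signs of the leading coefficients show whether one of them vanishes in the
        images; \<open>Ct\<close> and \<open>CN\<close> are the conditions that induction demands in
        the respective cases.\<close>
      define C where "C = insert (lead_coeff (formal_deriv f)) (lead_coeff ` S) \<union> (\<Union>g\<in>{g \<in> S. 0 < degree g}. Ct g) \<union> CN"
      have "good S C"
        unfolding good_def
      proof (intro conjI allI impI)
        have "finite (Ct g)" "Ct g \<subseteq> R" if "g \<in> S" "0 < degree g" for g using Ct[OF that] by (auto simp: good_def)
        moreover have "finite CN" "CN \<subseteq> R" using CN by (auto simp: good_def)
        ultimately show "finite C" "C \<subseteq> R"
          using lcR 1(2) lead_coeff_polys_over[OF fR(2)] by (auto simp: C_def)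
      next
        fix \<phi> :: "'a \<Rightarrow> 'b" and \<psi> :: "'a \<Rightarrow> 'c"
        assume hom: "is_hom \<phi>" "is_hom \<psi>" and C: "\<forall>c\<in>C. sg (\<phi> c) = sg (\<psi> c)"
        show "\<exists>\<Theta>. increasing \<Theta> \<and> (\<forall>f\<in>S. same_signs \<Theta> (map_poly \<phi> f) (map_poly \<psi> f))"
        proof (cases "\<exists>g\<in>S. 0 < degree g \<and> \<phi> (lead_coeff g) = 0")
          case True
          then obtain g where g: "g \<in> S" "0 < degree g" "\<phi> (lead_coeff g) = 0" by blast
          have "lead_coeff g \<in> C" using g(1) by (auto simp: C_def)
          then have "sg (\<phi> (lead_coeff g)) = sg (\<psi> (lead_coeff g))" using C by blast
          then have "\<psi> (lead_coeff g) = 0" using g(3) sg_zero_iff by blast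
          then have eq: "map_poly \<phi> (trunc g) = map_poly \<phi> g" "map_poly \<psi> (trunc g) = map_poly \<psi> g"
            using g(3) by (simp_all add: trunc_def map_poly_hom[OF hom(1)] map_poly_hom[OF hom(2)])
          have "\<forall>c\<in>Ct g. sg (\<phi> c) = sg (\<psi> c)" using C g by (auto simp: C_def)
          with Ct[OF g(1,2)] hom obtain \<Theta> where "increasing \<Theta>"
            "\<forall>f\<in>S - {g} \<union> {trunc g}. same_signs \<Theta> (map_poly \<phi> f) (map_poly \<psi> f)" unfolding good_def by blast
          then show ?thesis using eq by (intro exI[of _ \<Theta>]) force
        next
          case False
          have lc: "\<phi> (lead_coeff g) \<noteq> 0" if "g \<in> S" "0 < degree g" for g using False that by blast
          have lc_sg: "sg (\<phi> (lead_coeff g)) = sg (\<psi> (lead_coeff g))" if "g \<in> S \<or> g = formal_deriv f" for g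
            using C that by (auto simp: C_def)
          \<comment> \<open>In the coefficient ring the formal derivative might lose more than one
            degree. It does not, since the image of \<open>degree f\<close> times the leading
            coefficient is nonzero in a field of characteristic 0.\<close>
          have lc_pderiv: "\<phi> (lead_coeff (formal_deriv f)) \<noteq> 0"
          proof -
            have "\<phi> (coeff (formal_deriv f) (degree f - 1)) = of_nat (degree f) * \<phi> (lead_coeff f)"
              using df hom(1) by (simp add: coeff_formal_deriv is_homD del: of_nat_Suc)
            then have nz: "\<phi> (coeff (formal_deriv f) (degree f - 1)) \<noteq> 0" using lc[OF f(1) df] df by simp
            then have "coeff (formal_deriv f) (degree f - 1) \<noteq> 0" using is_homD(1)[OF hom(1)] by metis
            then have "degree f - 1 \<le> degree (formal_deriv f)" by (rule le_degree)
            then have "degree (formal_deriv f) = degree f - 1" using ddf by linarith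
            then show ?thesis using nz by simp
          qed
          have "\<forall>c\<in>CN. sg (\<phi> c) = sg (\<psi> c)" using C by (auto simp: C_def)
          with CN hom obtain \<Theta> where \<Theta>: "increasing \<Theta>"
            "\<And>f'. f' \<in> S - {f} \<union> N \<Longrightarrow> same_signs \<Theta> (map_poly \<phi> f') (map_poly \<psi> f')" unfolding good_def by blast
          define I where "I = insert (formal_deriv f) D"
          have I: "\<phi> (lead_coeff g) \<noteq> 0" "\<psi> (lead_coeff g) \<noteq> 0" "sg (\<phi> (lead_coeff g)) = sg (\<psi> (lead_coeff g))"
            if "g \<in> I" for g
          proof -
            have *: "g = formal_deriv f \<or> (g \<in> S \<and> 0 < degree g)" using that by (auto simp: I_def D_def)
            then show 1: "\<phi> (lead_coeff g) \<noteq> 0" using lc lc_pderiv by blast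
            show 2: "sg (\<phi> (lead_coeff g)) = sg (\<psi> (lead_coeff g))" using * lc_sg by blast
            show "\<psi> (lead_coeff g) \<noteq> 0" using 1 sg_zero_iff[OF 2] by blast
          qed
          have Isub: "I \<subseteq> S - {f} \<union> N" by (auto simp: I_def D_def N_def)
          have fsg: "sg (\<phi> (lead_coeff f)) = sg (\<psi> (lead_coeff f))" using lc_sg f(1) by blast
          have f\<phi>: "\<phi> (lead_coeff f) \<noteq> 0" using lc f(1) df by blast
          then have f\<psi>: "\<psi> (lead_coeff f) \<noteq> 0" using sg_zero_iff[OF fsg] by blast
          note mf = degree_map_poly_hom[OF hom(1) f\<phi>] and mf' = degree_map_poly_hom[OF hom(2) f\<psi>]
          have "\<exists>\<Theta>'. increasing \<Theta>' \<and> (\<forall>i\<in>I. same_signs \<Theta>' (map_poly \<phi> i) (map_poly \<psi> i)) \<and>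
            same_signs \<Theta>' (map_poly \<phi> f) (map_poly \<psi> f)"
          proof (rule sign_diagram_step[OF \<Theta>(1), where d = "formal_deriv f"])
            show "map_poly \<phi> i \<noteq> 0" if "i \<in> I" for i using degree_map_poly_hom(3)[OF hom(1)] I that by blast
            show "map_poly \<psi> i \<noteq> 0" if "i \<in> I" for i using degree_map_poly_hom(3)[OF hom(2)] I that by blast
            show "same_signs \<Theta> (map_poly \<phi> i) (map_poly \<psi> i)" if "i \<in> I" for i using \<Theta>(2) Isub that by blast
            show "formal_deriv f \<in> I" by (simp add: I_def)
            show "map_poly \<phi> (formal_deriv f) = pderiv (map_poly \<phi> f)" "map_poly \<psi> (formal_deriv f) = pderiv (map_poly \<psi> f)"
              using map_poly_formal_deriv hom by blast+
            show "sg (lead_coeff (map_poly \<phi> f)) = sg (lead_coeff (map_poly \<psi> f))" "degree (map_poly \<phi> f) = degree (map_poly \<psi> f)"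
              "map_poly \<phi> f \<noteq> 0" using mf mf' fsg by simp_all
          next
            fix g x y assume g: "g \<in> I" and xy: "(x, y) \<in> \<Theta>" and root: "poly (map_poly \<phi> g) x = 0"
            have at: "sg (poly (map_poly \<phi> h) x) = sg (poly (map_poly \<psi> h) y)" if "h \<in> S - {f} \<union> N" for h
              using \<Theta>(2)[OF that] increasingD(2)[OF \<Theta>(1) xy] by (simp add: same_signs_def)
            have root': "poly (map_poly \<psi> g) y = 0" using sg_zero_iff[OF at] g Isub root by blast
            have "0 < degree g"
            proof (rule ccontr)
              assume "\<not> 0 < degree g"
              then obtain c where "g = [:c:]" using degree_eq_zeroE by blast
              then show False using root I(1)[OF g] hom(1) by (simp add: map_poly_pCons is_homD)
            qed
            then have gD: "g \<in> D" using g by (auto simp: I_def D_def)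
            then obtain e q where eq: "smult (lead_coeff g ^ e) f = g * q + r g" using r(3) by blast
            have "\<phi> (lead_coeff g) ^ e * poly (map_poly \<phi> f) x = poly (map_poly \<phi> (r g)) x"
              using arg_cong[OF eq, of "\<lambda>p. poly (map_poly \<phi> p) x"] root
              by (simp add: map_poly_hom[OF hom(1)] is_homD[OF hom(1)])
            moreover have "\<psi> (lead_coeff g) ^ e * poly (map_poly \<psi> f) y = poly (map_poly \<psi> (r g)) y"
              using arg_cong[OF eq, of "\<lambda>p. poly (map_poly \<psi> p) y"] root'
              by (simp add: map_poly_hom[OF hom(2)] is_homD[OF hom(2)])
            moreover have "sg (poly (map_poly \<phi> (r g)) x) = sg (poly (map_poly \<psi> (r g)) y)"
              using at gD by (auto simp: N_def)
            \<comment> \<open>The factor introduced by pseudo-division has the same nonzero sign on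
              both sides and cancels.\<close>
            ultimately have "sg (\<phi> (lead_coeff g)) ^ e * sg (poly (map_poly \<phi> f) x)
                = sg (\<phi> (lead_coeff g)) ^ e * sg (poly (map_poly \<psi> f) y)"
              using I(3)[OF g] by (metis sg_mult sg_power)
            then show "sg (poly (map_poly \<phi> f) x) = sg (poly (map_poly \<psi> f) y)" using I(1)[OF g] by simp
          qed
          then obtain \<Theta>' where \<Theta>': "increasing \<Theta>'" "\<forall>i\<in>I. same_signs \<Theta>' (map_poly \<phi> i) (map_poly \<psi> i)"
            "same_signs \<Theta>' (map_poly \<phi> f) (map_poly \<psi> f)" by blast
          have "same_signs \<Theta>' (map_poly \<phi> g) (map_poly \<psi> g)" if g: "g \<in> S" for g
          proof (cases "g = f \<or> degree g = 0")
            case True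
            then show ?thesis using \<Theta>'(3) const[OF hom] lc_sg g by blast
          next
            case False
            then have "g \<in> I" using g by (auto simp: I_def D_def)
            then show ?thesis using \<Theta>'(2) by blast
          qed
          then show ?thesis using \<Theta>'(1) by blast
        qed
      qed
      then show ?thesis by blast
    qed
    then show ?case unfolding good_def by blast
  qed
qed

section \<open>Polynomials in several variables\<close>

definition mon_eval :: "('v \<Rightarrow> real) \<Rightarrow> ('v \<Rightarrow>\<^sub>0 nat) \<Rightarrow> real" where
  "mon_eval a t = (\<Prod>v\<in>Poly_Mapping.keys t. a v ^ Poly_Mapping.lookup t v)"

lemma mon_eval_superset:
  "finite A \<Longrightarrow> Poly_Mapping.keys t \<subseteq> A \<Longrightarrow> mon_eval a t = (\<Prod>v\<in>A. a v ^ Poly_Mapping.lookup t v)"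
  unfolding mon_eval_def by (rule prod.mono_neutral_left) (auto simp: in_keys_iff)

lemma mon_eval_add: "mon_eval a (s + t) = mon_eval a s * mon_eval a t"
proof -
  let ?A = "Poly_Mapping.keys s \<union> Poly_Mapping.keys t"
  have "mon_eval a (s + t) = (\<Prod>v\<in>?A. a v ^ Poly_Mapping.lookup (s + t) v)"
    by (rule mon_eval_superset) (simp_all add: keys_add)
  also have "\<dots> = (\<Prod>v\<in>?A. a v ^ Poly_Mapping.lookup s v) * (\<Prod>v\<in>?A. a v ^ Poly_Mapping.lookup t v)"
    by (simp add: lookup_add power_add prod.distrib)
  also have "\<dots> = mon_eval a s * mon_eval a t"
    by (subst (1 2) mon_eval_superset[of ?A]) auto
  finally show ?thesis .
qed

lemma poly_mapping_as_sum:
  "q = (\<Sum>t\<in>Poly_Mapping.keys q. Poly_Mapping.single t (Poly_Mapping.lookup q t))"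
proof (rule poly_mapping_eqI)
  fix k
  show "Poly_Mapping.lookup q k = Poly_Mapping.lookup (\<Sum>t\<in>Poly_Mapping.keys q. Poly_Mapping.single t (Poly_Mapping.lookup q t)) k"
    by (simp add: lookup_sum lookup_single when_def in_keys_iff sum.delta)
qed

lemma poly_eval_superset:
  "finite A \<Longrightarrow> Poly_Mapping.keys q \<subseteq> A \<Longrightarrow> poly_eval q a = (\<Sum>t\<in>A. Poly_Mapping.lookup q t * mon_eval a t)"
  unfolding poly_eval_def mon_eval_def[symmetric] by (rule sum.mono_neutral_left) (auto simp: in_keys_iff)

lemma poly_eval_single: "poly_eval (Poly_Mapping.single t c) a = c * mon_eval a t"
  by (subst poly_eval_superset[of "{t}"]) auto

lemma poly_eval_add: "poly_eval (p + q) a = poly_eval p a + poly_eval q a"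
proof -
  let ?A = "Poly_Mapping.keys p \<union> Poly_Mapping.keys q"
  have "poly_eval (p + q) a = (\<Sum>t\<in>?A. Poly_Mapping.lookup (p + q) t * mon_eval a t)"
    by (rule poly_eval_superset) (simp_all add: keys_add)
  also have "\<dots> = poly_eval p a + poly_eval q a"
    by (subst (1 2) poly_eval_superset[of ?A]) (auto simp: lookup_add distrib_right sum.distrib)
  finally show ?thesis .
qed

lemma poly_eval_0: "poly_eval 0 a = 0"
  by (simp add: poly_eval_def)

lemma poly_eval_sum: "poly_eval (sum f I) a = (\<Sum>i\<in>I. poly_eval (f i) a)"
  by (induction I rule: infinite_finite_induct) (auto simp: poly_eval_0 poly_eval_add)

lemma times_as_sum:
  fixes p q :: "'v::comm_monoid_add \<Rightarrow>\<^sub>0 real"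
  shows "p * q = (\<Sum>s\<in>Poly_Mapping.keys p. \<Sum>t\<in>Poly_Mapping.keys q.
    Poly_Mapping.single (s + t) (Poly_Mapping.lookup p s * Poly_Mapping.lookup q t))"
proof -
  have "p * q = (\<Sum>s\<in>Poly_Mapping.keys p. Poly_Mapping.single s (Poly_Mapping.lookup p s)) *
    (\<Sum>t\<in>Poly_Mapping.keys q. Poly_Mapping.single t (Poly_Mapping.lookup q t))"
    using poly_mapping_as_sum[of p] poly_mapping_as_sum[of q] by simp
  then show ?thesis by (simp add: sum_product mult_single)
qed

lemma poly_eval_hom: "is_hom (\<lambda>q. poly_eval q a)"
  unfolding is_hom_def
proof (intro conjI allI)
  show "poly_eval 0 a = 0" by (rule poly_eval_0)
  have "poly_eval (Poly_Mapping.single 0 1) a = 1" by (simp add: poly_eval_single mon_eval_def del: single_one)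
  then show "poly_eval 1 a = 1" by (simp only: single_one)
  fix p q :: "('a, 'b, 'c) xyz_poly"
  show "poly_eval (p + q) a = poly_eval p a + poly_eval q a" by (rule poly_eval_add)
  have "poly_eval (p * q) a = (\<Sum>s\<in>Poly_Mapping.keys p. \<Sum>t\<in>Poly_Mapping.keys q.
      (Poly_Mapping.lookup p s * mon_eval a s) * (Poly_Mapping.lookup q t * mon_eval a t))"
    by (subst times_as_sum) (simp add: poly_eval_sum poly_eval_single mon_eval_add mult_ac)
  also have "\<dots> = poly_eval p a * poly_eval q a"
    unfolding poly_eval_def mon_eval_def[symmetric] sum_product by simp
  finally show "poly_eval (p * q) a = poly_eval p a * poly_eval q a" .
qed

lemmas poly_eval_simps [simp] = is_homD[OF poly_eval_hom]

lemma poly_eval_Const [simp]: "poly_eval (Const c) a = c"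
  by (simp add: Const_def poly_eval_single mon_eval_def)

lemma poly_eval_Var [simp]: "poly_eval (Var v) a = a v"
  by (simp add: Var_def poly_eval_single mon_eval_def)

lemma Const_hom: "is_hom Const"
  by (auto simp: is_hom_def Const_def single_add mult_single)

lemmas Const_simps = is_homD[OF Const_hom]

lemma Var_power: "Var v ^ n = Poly_Mapping.single (Poly_Mapping.single v n) 1"
proof (induction n)
  case (Suc n)
  then show ?case by (simp add: Var_def mult_single flip: single_add)
qed simp

lemma polys_in_iff: "q \<in> polys_in V \<longleftrightarrow> (\<forall>t. Poly_Mapping.lookup q t \<noteq> 0 \<longrightarrow> Poly_Mapping.keys t \<subseteq> V)"
  by (auto simp: polys_in_def in_keys_iff)

lemma subring_polys_in: "subring_set (polys_in V)"
  unfolding subring_set_def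
proof (intro conjI ballI)
  show "0 \<in> polys_in V" "1 \<in> polys_in V" by (auto simp: polys_in_def)
  fix p q :: "('a, 'b, 'c) xyz_poly" assume pq: "p \<in> polys_in V" "q \<in> polys_in V"
  show "p + q \<in> polys_in V" using pq keys_add[of p q] unfolding polys_in_def by blast
  show "p - q \<in> polys_in V" using pq unfolding polys_in_iff lookup_minus by (metis diff_self)
  show "p * q \<in> polys_in V"
    unfolding polys_in_def
  proof safe
    fix t v assume "t \<in> Poly_Mapping.keys (p * q)" "v \<in> Poly_Mapping.keys t"
    then obtain s u where "t = s + u" "s \<in> Poly_Mapping.keys p" "u \<in> Poly_Mapping.keys q" using keys_mult[of p q] by blast
    then show "v \<in> V" using \<open>v \<in> _\<close> pq keys_add[of s u] unfolding polys_in_def by blast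
  qed
qed

lemmas polys_in_simps = subring_setD[OF subring_polys_in] subring_set_power[OF subring_polys_in]

lemma Const_in: "Const c \<in> polys_in V"
  by (auto simp: polys_in_def Const_def)

lemma Var_in: "v \<in> V \<Longrightarrow> Var v \<in> polys_in V"
  by (auto simp: polys_in_def Var_def)

lemma polys_in_mono: "V \<subseteq> W \<Longrightarrow> polys_in V \<subseteq> polys_in W"
  by (auto simp: polys_in_def)

lemma polys_in_induct [consumes 1, case_names Const Var add mult]:
  assumes "q \<in> polys_in V" and Const: "\<And>c. P (Const c)" and Var: "\<And>v. v \<in> V \<Longrightarrow> P (Var v)"
    and add: "\<And>p q. p \<in> polys_in V \<Longrightarrow> q \<in> polys_in V \<Longrightarrow> P p \<Longrightarrow> P q \<Longrightarrow> P (p + q)"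
    and mult: "\<And>p q. p \<in> polys_in V \<Longrightarrow> q \<in> polys_in V \<Longrightarrow> P p \<Longrightarrow> P q \<Longrightarrow> P (p * q)"
  shows "P q"
proof -
  define P' where "P' q \<longleftrightarrow> q \<in> polys_in V \<and> P q" for q
  have c: "P' (Const c)" for c using Const Const_in by (auto simp: P'_def)
  have a: "P' (p + q)" "P' (p * q)" if "P' p" "P' q" for p q
    using that add mult polys_in_simps by (auto simp: P'_def)
  have pow: "P' (Var v ^ n)" if "v \<in> V" for v n
  proof (induction n)
    case 0
    show ?case using c[of 1] by (simp add: Const_simps)
  next
    case (Suc n)
    moreover have "P' (Var v)" using that Var Var_in by (auto simp: P'_def)
    ultimately show ?case using a by simp
  qed
  have monomial: "P' (Poly_Mapping.single t 1)" if "Poly_Mapping.keys t \<subseteq> V" for t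
  proof -
    have "P' (Poly_Mapping.single (\<Sum>v\<in>A. Poly_Mapping.single v (n v)) 1)" if "finite A" "A \<subseteq> V" for A n
      using that
    proof (induction A)
      case empty
      show ?case using c[of 1] by (simp add: Const_def)
    next
      case (insert v A)
      have "Poly_Mapping.single (Poly_Mapping.single v (n v) + (\<Sum>v\<in>A. Poly_Mapping.single v (n v))) 1
        = Var v ^ n v * Poly_Mapping.single (\<Sum>v\<in>A. Poly_Mapping.single v (n v)) 1"
        by (simp add: Var_power mult_single)
      then show ?case using insert a(2) pow by simp
    qed
    from this[OF finite_keys that, of "Poly_Mapping.lookup t"] show ?thesis
      unfolding poly_mapping_as_sum[symmetric] .
  qed
  have "P' (\<Sum>t\<in>A. Poly_Mapping.single t (Poly_Mapping.lookup q t))" if "finite A" "A \<subseteq> {t. Poly_Mapping.keys t \<subseteq> V}" for A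
    using that
  proof (induction A)
    case empty
    show ?case using c[of 0] by (simp add: Const_def)
  next
    case (insert t A)
    have "Poly_Mapping.single t (Poly_Mapping.lookup q t) = Const (Poly_Mapping.lookup q t) * Poly_Mapping.single t 1"
      by (simp add: Const_def mult_single)
    then show ?case using insert a c monomial by simp
  qed
  from this[of "Poly_Mapping.keys q"] have "P' q"
    using assms(1) by (simp add: polys_in_def subset_eq flip: poly_mapping_as_sum)
  then show ?thesis by (simp add: P'_def)
qed

lemma poly_eval_cong:
  assumes "q \<in> polys_in V" "\<And>v. v \<in> V \<Longrightarrow> a v = b v"
  shows "poly_eval q a = poly_eval q b"
  using assms(1) by (induction rule: polys_in_induct) (auto simp: assms(2))

lemma hom_eq_poly_eval:
  assumes "q \<in> polys_in V" "\<And>c. \<phi> (Const c) = c"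
    "\<And>p q. p \<in> polys_in V \<Longrightarrow> q \<in> polys_in V \<Longrightarrow> \<phi> (p + q) = \<phi> p + \<phi> q \<and> \<phi> (p * q) = \<phi> p * \<phi> q"
  shows "\<phi> q = poly_eval q (\<lambda>v. \<phi> (Var v))"
  using assms(1) by (induction rule: polys_in_induct) (auto simp: assms(2,3))

lemma polys_in_insert:
  assumes "f \<in> polys_in (insert v W)"
  shows "\<exists>p\<in>polys_over (polys_in W). poly p (Var v) = f"
proof -
  have PO: "0 \<in> polys_over (polys_in W)" by (rule subring_setD(1)[OF subring_polys_over[OF subring_polys_in]])
  from assms show ?thesis
  proof (induction rule: polys_in_induct)
    case (Const c)
    show ?case using Const_in PO by (intro bexI[of _ "[:Const c:]"]) simp_all
  next
    case (Var u)
    show ?case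
    proof (cases "u = v")
      case True
      have "[:0, 1:] \<in> polys_over (polys_in W)" by (simp add: polys_in_simps PO)
      then show ?thesis using True by (intro bexI[of _ "[:0, 1:]"]) auto
    next
      case False
      then have "[:Var u:] \<in> polys_over (polys_in W)"
        using Var Var_in PO by simp
      then show ?thesis by (intro bexI[of _ "[:Var u:]"]) auto
    qed
  next
    case (add p q)
    then obtain p' q' where "p' \<in> polys_over (polys_in W)" "q' \<in> polys_over (polys_in W)" "poly p' (Var v) = p" "poly q' (Var v) = q"
      by blast
    then show ?case using subring_setD[OF subring_polys_over[OF subring_polys_in]]
      by (intro bexI[of _ "p' + q'"]) auto
  next
    case (mult p q)
    then obtain p' q' where "p' \<in> polys_over (polys_in W)" "q' \<in> polys_over (polys_in W)" "poly p' (Var v) = p" "poly q' (Var v) = q"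
      by blast
    then show ?case using subring_setD[OF subring_polys_over[OF subring_polys_in]]
      by (intro bexI[of _ "p' * q'"]) auto
  qed
qed

lemma poly_map_poly_eval:
  "poly_eval (poly p (Var v)) a = poly (map_poly (\<lambda>q. poly_eval q a) p) (a v)"
  using map_poly_hom(6)[OF poly_eval_hom, of p "Var v" a] by simp

section \<open>Real points with prescribed signs\<close>

text \<open>Positive reals are invertible squares, so any ring homomorphism respects their
  sign.\<close>

lemma sg_hom_Const:
  fixes \<theta> :: "('n, 'm, 'p) xyz_poly \<Rightarrow> 'b::linordered_idom"
  assumes "is_hom \<theta>"
  shows "sg (\<theta> (Const c)) = sg c"
proof -
  have pos: "0 < \<theta> (Const c)" if "0 < c" for c
  proof -
    have "Const c = Const (sqrt c) * Const (sqrt c)" using that by (simp flip: Const_simps(4))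
    then have "\<theta> (Const c) = \<theta> (Const (sqrt c)) * \<theta> (Const (sqrt c))" by (metis is_homD(4)[OF assms])
    then have "0 \<le> \<theta> (Const c)" by simp
    moreover have "\<theta> (Const c) * \<theta> (Const (1 / c)) = 1"
      using that by (simp flip: is_homD(4)[OF assms] Const_simps(4)) (simp add: Const_simps is_homD[OF assms])
    then have "\<theta> (Const c) \<noteq> 0" by auto
    ultimately show ?thesis by simp
  qed
  consider "0 < c" | "c = 0" | "0 < - c" by linarith
  then show ?thesis
  proof cases
    case 1
    then show ?thesis using pos[OF 1] by (simp add: sg_def)
  next
    case 2
    then show ?thesis by (simp add: Const_simps is_homD[OF assms])
  next
    case 3
    then show ?thesis using pos[OF 3] by (simp add: Const_simps is_homD[OF assms] sg_def)
  qed
qed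

text \<open>One variable is removed at a time. The conditions \<open>C\<close> on the coefficients
  involve fewer variables, so induction realizes their signs at a real point, and the sign diagram
  then links the given field to the reals.\<close>

theorem artin_lang:
  fixes \<theta> :: "('n, 'm, 'p) xyz_poly \<Rightarrow> 'b::real_closed_field"
  assumes hom: "is_hom \<theta>" and "finite W" "finite S" "S \<subseteq> polys_in W"
  shows "\<exists>a. \<forall>f\<in>S. sg (poly_eval f a) = sg (\<theta> f)"
  using assms(2-)
proof (induction W arbitrary: S rule: finite_induct)
  case empty
  have "\<exists>c. f = Const c" if "f \<in> polys_in {}" for f :: "('n, 'm, 'p) xyz_poly"
    using that
  proof (induction rule: polys_in_induct)
    case (add p q)
    then show ?case using Const_simps(3) by metis
  next
    case (mult p q)
    then show ?case using Const_simps(4) by metis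
  qed auto
  then have "sg (poly_eval f a) = sg (\<theta> f)" if "f \<in> S" for f a
    using empty that sg_hom_Const[OF hom] by (metis poly_eval_Const subsetD)
  then show ?case by blast
next
  case (insert v W)
  have "\<forall>f\<in>S. \<exists>p. p \<in> polys_over (polys_in W) \<and> poly p (Var v) = f" using polys_in_insert insert by blast
  then obtain p where p: "\<And>f. f \<in> S \<Longrightarrow> p f \<in> polys_over (polys_in W)" "\<And>f. f \<in> S \<Longrightarrow> poly (p f) (Var v) = f" by metis
  have "finite (p ` S)" "p ` S \<subseteq> polys_over (polys_in W)" using p insert by auto
  from sign_diagram_transfer[OF subring_polys_in this, where 'b = 'b and 'c = real] obtain C where
    C: "finite C" "C \<subseteq> polys_in W" and transfer: "\<forall>(\<phi> :: ('n, 'm, 'p) xyz_poly \<Rightarrow> 'b) (\<psi> :: ('n, 'm, 'p) xyz_poly \<Rightarrow> real).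
       is_hom \<phi> \<longrightarrow> is_hom \<psi> \<longrightarrow> (\<forall>c\<in>C. sg (\<phi> c) = sg (\<psi> c)) \<longrightarrow>
       (\<exists>\<Theta>. increasing \<Theta> \<and> (\<forall>f\<in>p ` S. same_signs \<Theta> (map_poly \<phi> f) (map_poly \<psi> f)))"
    by (elim exE conjE) (rule that)
  from insert.IH[OF C(1,2)] obtain a where "\<forall>f\<in>C. sg (poly_eval f a) = sg (\<theta> f)" by blast
  then have "\<forall>c\<in>C. sg (\<theta> c) = sg (poly_eval c a)" by simp
  from transfer[rule_format, OF hom poly_eval_hom] this obtain \<Theta> where \<Theta>: "increasing \<Theta>"
    "\<And>f. f \<in> S \<Longrightarrow> same_signs \<Theta> (map_poly \<theta> (p f)) (map_poly (\<lambda>q. poly_eval q a) (p f))" by blast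
  \<comment> \<open>The missing coordinate is any real in the cell that corresponds to the cell of
    \<open>\<theta> (Var v)\<close>.\<close>
  from same_pos_exists[OF \<Theta>(1)] obtain b where b: "same_pos \<Theta> (\<theta> (Var v)) b" by blast
  define a' where "a' = a(v := b)"
  have "sg (poly_eval f a') = sg (\<theta> f)" if f: "f \<in> S" for f
  proof -
    have "map_poly (\<lambda>q. poly_eval q a') (p f) = map_poly (\<lambda>q. poly_eval q a) (p f)"
    proof (rule poly_eqI)
      fix i
      have "coeff (p f) i \<in> polys_in W" using p(1)[OF f] by (simp add: polys_over_def)
      then have "poly_eval (coeff (p f) i) a' = poly_eval (coeff (p f) i) a"
        by (rule poly_eval_cong) (use insert.hyps in \<open>auto simp: a'_def\<close>)
      then show "coeff (map_poly (\<lambda>q. poly_eval q a') (p f)) i = coeff (map_poly (\<lambda>q. poly_eval q a) (p f)) i"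
        by (simp add: coeff_map_poly)
    qed
    then have "poly_eval f a' = poly (map_poly (\<lambda>q. poly_eval q a) (p f)) b"
      using poly_map_poly_eval[of "p f" v a'] p(2)[OF f] by (simp add: a'_def)
    moreover have "\<theta> f = poly (map_poly \<theta> (p f)) (\<theta> (Var v))"
      using map_poly_hom(6)[OF hom, of "p f" "Var v"] p(2)[OF f] by simp
    ultimately show ?thesis using \<Theta>(2)[OF f] b by (simp add: same_signs_def)
  qed
  then show ?case by blast
qed

text \<open>A point of the real spectrum: a total ordering of the ring modulo a prime ideal, the
  ideal being the intersection of \<open>P\<close> with its negative.\<close>

definition prime_cone :: "'a::comm_ring_1 set \<Rightarrow> bool" where
  "prime_cone P \<longleftrightarrow> (\<forall>a\<in>P. \<forall>b\<in>P. a + b \<in> P \<and> a * b \<in> P) \<and> (\<forall>a. a \<in> P \<or> - a \<in> P) \<and> - 1 \<notin> P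
     \<and> (\<forall>a b. a * b \<in> P \<longrightarrow> - (a * b) \<in> P \<longrightarrow> (a \<in> P \<and> - a \<in> P) \<or> (b \<in> P \<and> - b \<in> P))"

definition realizable :: "('n, 'm, 'p) xyz_poly set \<Rightarrow> bool" where
  "realizable P \<longleftrightarrow> (\<forall>S. finite S \<longrightarrow> (\<exists>a. \<forall>f\<in>S. f \<in> P \<longleftrightarrow> 0 \<le> poly_eval f a))"

text \<open>
  The residue field of a prime cone would be a type depending on a term. It suffices to consider one
  fixed cone, chosen to be a counterexample to the claim that all prime cones are realizable, if there is one.
\<close>
definition worst_cone :: "('n, 'm, 'p) xyz_poly set" where
  "worst_cone = (SOME P. prime_cone P \<and> ((\<exists>P' :: ('n, 'm, 'p) xyz_poly set. prime_cone P' \<and> \<not> realizable P') \<longrightarrow> \<not> realizable P))"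

text \<open>Ensures that the choice of \<open>worst_cone\<close> yields a prime cone even when there
  is no counterexample.\<close>

lemma prime_cone_at_0: "prime_cone {q :: ('n, 'm, 'p) xyz_poly. 0 \<le> poly_eval q (\<lambda>_. 0)}"
  unfolding prime_cone_def by auto

lemma worst_cone: "prime_cone (worst_cone :: ('n, 'm, 'p) xyz_poly set)"
  "prime_cone P' \<Longrightarrow> \<not> realizable (P' :: ('n, 'm, 'p) xyz_poly set) \<Longrightarrow> \<not> realizable (worst_cone :: ('n, 'm, 'p) xyz_poly set)"
proof -
  have "\<exists>P :: ('n, 'm, 'p) xyz_poly set. prime_cone P \<and> ((\<exists>P' :: ('n, 'm, 'p) xyz_poly set. prime_cone P' \<and> \<not> realizable P') \<longrightarrow> \<not> realizable P)"
    using prime_cone_at_0 by blast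
  from someI_ex[OF this] show "prime_cone (worst_cone :: ('n, 'm, 'p) xyz_poly set)"
    "prime_cone P' \<Longrightarrow> \<not> realizable P' \<Longrightarrow> \<not> realizable (worst_cone :: ('n, 'm, 'p) xyz_poly set)"
    unfolding worst_cone_def[symmetric] by blast+
qed

lemma worst_coneD:
  "a \<in> worst_cone \<Longrightarrow> b \<in> worst_cone \<Longrightarrow> a + b \<in> worst_cone"
  "a \<in> worst_cone \<Longrightarrow> b \<in> worst_cone \<Longrightarrow> a * b \<in> worst_cone"
  "a \<in> worst_cone \<or> - a \<in> worst_cone" "- 1 \<notin> worst_cone"
  "a * b \<in> worst_cone \<Longrightarrow> - (a * b) \<in> worst_cone \<Longrightarrow> (a \<in> worst_cone \<and> - a \<in> worst_cone) \<or> (b \<in> worst_cone \<and> - b \<in> worst_cone)"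
  using worst_cone(1) unfolding prime_cone_def by blast+

definition worst_support :: "('n, 'm, 'p) xyz_poly set" where
  "worst_support = {a. a \<in> worst_cone \<and> - a \<in> worst_cone}"

lemma worst_supportD:
  "0 \<in> worst_support" "a \<in> worst_support \<Longrightarrow> - a \<in> worst_support"
  "a \<in> worst_support \<Longrightarrow> b \<in> worst_support \<Longrightarrow> a + b \<in> worst_support"
  "a \<in> worst_support \<Longrightarrow> c * a \<in> worst_support" "1 \<notin> worst_support"
  "a * b \<in> worst_support \<Longrightarrow> a \<in> worst_support \<or> b \<in> worst_support"
  "a \<in> worst_support \<Longrightarrow> a + b \<in> worst_cone \<longleftrightarrow> b \<in> worst_cone"
proof -
  show 0: "0 \<in> worst_support" using worst_coneD(3)[of 0] by (simp add: worst_support_def)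
  show "a \<in> worst_support \<Longrightarrow> - a \<in> worst_support" for a by (simp add: worst_support_def)
  show add: "a \<in> worst_support \<Longrightarrow> b \<in> worst_support \<Longrightarrow> a + b \<in> worst_support" for a b
    using worst_coneD(1)[of a b] worst_coneD(1)[of "- a" "- b"] by (simp add: worst_support_def)
  show "a \<in> worst_support \<Longrightarrow> c * a \<in> worst_support"
    using worst_coneD(3)[of c] worst_coneD(2)[of c a] worst_coneD(2)[of c "- a"] worst_coneD(2)[of "- c" a] worst_coneD(2)[of "- c" "- a"]
    by (auto simp: worst_support_def)
  show "1 \<notin> worst_support" by (simp add: worst_support_def worst_coneD(4))
  show "a * b \<in> worst_support \<Longrightarrow> a \<in> worst_support \<or> b \<in> worst_support"
    using worst_coneD(5) unfolding worst_support_def by blast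
  show "a \<in> worst_support \<Longrightarrow> a + b \<in> worst_cone \<longleftrightarrow> b \<in> worst_cone"
    using worst_coneD(1)[of a b] worst_coneD(1)[of "- a" "a + b"] by (auto simp: worst_support_def)
qed

section \<open>The ordered residue domain of the chosen cone and its map into a real closed
  field\<close>

definition worst_rel :: "('n, 'm, 'p) xyz_poly \<Rightarrow> ('n, 'm, 'p) xyz_poly \<Rightarrow> bool" where
  "worst_rel a b \<longleftrightarrow> a - b \<in> worst_support"

quotient_type ('n, 'm, 'p) cone_residue = "('n, 'm, 'p) xyz_poly" / worst_rel morphisms rep_residue to_residue
proof (rule equivpI)
  show "reflp worst_rel" by (simp add: reflp_def worst_rel_def worst_supportD)
  show "symp worst_rel" unfolding symp_def worst_rel_def using worst_supportD(2) by fastforce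
  show "transp worst_rel" unfolding transp_def worst_rel_def using worst_supportD(3) by fastforce
qed

instantiation cone_residue :: (type, type, type) "{zero, one, plus, minus, uminus, times, ord, abs, sgn}"
begin

lift_definition zero_cone_residue :: "('a, 'b, 'c) cone_residue" is 0 .
lift_definition one_cone_residue :: "('a, 'b, 'c) cone_residue" is 1 .
lift_definition plus_cone_residue :: "('a, 'b, 'c) cone_residue \<Rightarrow> ('a, 'b, 'c) cone_residue \<Rightarrow> ('a, 'b, 'c) cone_residue"
  is "(+)"
proof -
  fix a b c d :: "('a, 'b, 'c) xyz_poly"
  assume "worst_rel a b" "worst_rel c d"
  then have "(a - b) + (c - d) \<in> worst_support" unfolding worst_rel_def by (rule worst_supportD(3))
  then show "worst_rel (a + c) (b + d)" by (simp add: worst_rel_def algebra_simps)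
qed
lift_definition minus_cone_residue :: "('a, 'b, 'c) cone_residue \<Rightarrow> ('a, 'b, 'c) cone_residue \<Rightarrow> ('a, 'b, 'c) cone_residue"
  is "(-)"
proof -
  fix a b c d :: "('a, 'b, 'c) xyz_poly"
  assume "worst_rel a b" "worst_rel c d"
  then have "(a - b) + - (c - d) \<in> worst_support" unfolding worst_rel_def by (intro worst_supportD(2,3))
  then show "worst_rel (a - c) (b - d)" by (simp add: worst_rel_def algebra_simps)
qed
lift_definition uminus_cone_residue :: "('a, 'b, 'c) cone_residue \<Rightarrow> ('a, 'b, 'c) cone_residue"
  is uminus
proof -
  fix a b :: "('a, 'b, 'c) xyz_poly"
  assume "worst_rel a b"
  then have "- (a - b) \<in> worst_support" unfolding worst_rel_def by (rule worst_supportD(2))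
  then show "worst_rel (- a) (- b)" by (simp add: worst_rel_def)
qed
lift_definition times_cone_residue :: "('a, 'b, 'c) cone_residue \<Rightarrow> ('a, 'b, 'c) cone_residue \<Rightarrow> ('a, 'b, 'c) cone_residue"
  is "(*)"
proof -
  fix a b c d :: "('a, 'b, 'c) xyz_poly"
  assume "worst_rel a b" "worst_rel c d"
  then have "c * (a - b) + b * (c - d) \<in> worst_support" unfolding worst_rel_def by (intro worst_supportD(3,4))
  then show "worst_rel (a * c) (b * d)" by (simp add: worst_rel_def algebra_simps)
qed
lift_definition less_eq_cone_residue :: "('a, 'b, 'c) cone_residue \<Rightarrow> ('a, 'b, 'c) cone_residue \<Rightarrow> bool"
  is "\<lambda>a b. b - a \<in> worst_cone"
proof -
  fix a b c d :: "('a, 'b, 'c) xyz_poly"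
  assume "worst_rel a b" "worst_rel c d"
  then have "(a - b) + - (c - d) \<in> worst_support" unfolding worst_rel_def by (intro worst_supportD(2,3))
  from worst_supportD(7)[OF this, of "c - a"] show "(c - a \<in> worst_cone) = (d - b \<in> worst_cone)" by simp
qed
definition less_cone_residue :: "('a, 'b, 'c) cone_residue \<Rightarrow> ('a, 'b, 'c) cone_residue \<Rightarrow> bool"
  where "less_cone_residue a b \<longleftrightarrow> a \<le> b \<and> \<not> b \<le> a"
definition abs_cone_residue :: "('a, 'b, 'c) cone_residue \<Rightarrow> ('a, 'b, 'c) cone_residue"
  where "abs_cone_residue a = (if a < 0 then - a else a)"
definition sgn_cone_residue :: "('a, 'b, 'c) cone_residue \<Rightarrow> ('a, 'b, 'c) cone_residue"
  where "sgn_cone_residue a = (if a = 0 then 0 else if 0 < a then 1 else - 1)"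

instance ..

end

instance cone_residue :: (type, type, type) idom
proof
  fix a b c :: "('a, 'b, 'c) cone_residue"
  show "a * b * c = a * (b * c)" "a * b = b * a" "1 * a = a" "a + b + c = a + (b + c)"
    "a + b = b + a" "0 + a = a" "- a + a = 0" "a - b = a + - b" "(a + b) * c = a * c + b * c"
    "0 * a = 0" "a * 0 = 0" "a * (b + c) = a * b + a * c"
    by (transfer; simp add: worst_rel_def worst_supportD(1) algebra_simps)+
  show "(0 :: ('a, 'b, 'c) cone_residue) \<noteq> 1"
    by transfer (use worst_supportD(2,5) in \<open>force simp: worst_rel_def\<close>)
  show "a \<noteq> 0 \<Longrightarrow> b \<noteq> 0 \<Longrightarrow> a * b \<noteq> 0"
    by transfer (use worst_supportD(6) in \<open>force simp: worst_rel_def\<close>)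
qed

instance cone_residue :: (type, type, type) linordered_idom
proof
  fix a b c :: "('a, 'b, 'c) cone_residue"
  show refl: "a \<le> a" by transfer (use worst_supportD(1) in \<open>simp add: worst_support_def\<close>)
  show "a \<le> b \<Longrightarrow> b \<le> c \<Longrightarrow> a \<le> c"
  proof transfer
    fix a b c :: "('a, 'b, 'c) xyz_poly" assume "b - a \<in> worst_cone" "c - b \<in> worst_cone"
    from worst_coneD(1)[OF this] show "c - a \<in> worst_cone" by simp
  qed
  show antisym: "a \<le> b \<Longrightarrow> b \<le> a \<Longrightarrow> a = b" for a b :: "('a, 'b, 'c) cone_residue"
    by transfer (simp add: worst_rel_def worst_support_def)
  show "a < b \<longleftrightarrow> a \<le> b \<and> \<not> b \<le> a" by (rule less_cone_residue_def)
  show total: "a \<le> b \<or> b \<le> a"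
  proof transfer
    fix a b :: "('a, 'b, 'c) xyz_poly"
    show "b - a \<in> worst_cone \<or> a - b \<in> worst_cone" using worst_coneD(3)[of "b - a"] by simp
  qed
  show "a \<le> b \<Longrightarrow> c + a \<le> c + b" by transfer simp
  have mono: "0 \<le> a \<Longrightarrow> 0 \<le> b \<Longrightarrow> 0 \<le> a * b" for a b :: "('a, 'b, 'c) cone_residue"
    by transfer (simp add: worst_coneD(2))
  have diff: "a \<le> b \<longleftrightarrow> 0 \<le> b - a" for a b :: "('a, 'b, 'c) cone_residue"
    by transfer simp
  show "a < b \<Longrightarrow> 0 < c \<Longrightarrow> c * a < c * b"
  proof -
    assume ab: "a < b" and c: "0 < c"
    have "0 \<le> b - a" using ab diff unfolding less_cone_residue_def by blast
    then have le: "0 \<le> c * (b - a)" using mono c unfolding less_cone_residue_def by blast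
    have "b \<noteq> a" "c \<noteq> 0" using ab c refl unfolding less_cone_residue_def by auto
    then have ne: "c * a \<noteq> c * b" by simp
    have "c * a \<le> c * b" using le diff[of "c * a" "c * b"] by (simp add: right_diff_distrib)
    with ne antisym[of "c * a" "c * b"] show "c * a < c * b" unfolding less_cone_residue_def by blast
  qed
qed (simp_all only: abs_cone_residue_def sgn_cone_residue_def)

definition residue_hom :: "('n, 'm, 'p) xyz_poly \<Rightarrow> ('n, 'm, 'p) cone_residue fract real_closure" where
  "residue_hom q = of_base (Fract (to_residue q) 1)"

lemma residue_hom: "is_hom residue_hom"
  unfolding is_hom_def residue_hom_def
  by (simp add: of_base_hom flip: of_base_hom zero_cone_residue.abs_eq one_cone_residue.abs_eq
      plus_cone_residue.abs_eq times_cone_residue.abs_eq)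
     (simp add: of_base_hom flip: Zero_fract_def One_fract_def)

lemma worst_cone_iff: "q \<in> worst_cone \<longleftrightarrow> 0 \<le> residue_hom q"
proof -
  have pos: "0 \<le> residue_hom q" if "q \<in> worst_cone" for q :: "('a, 'b, 'c) xyz_poly"
  proof -
    have "0 \<le> to_residue q"
      unfolding zero_cone_residue.abs_eq less_eq_cone_residue.abs_eq using that by simp
    then have "0 \<le> Fract (to_residue q) 1" by (simp add: zero_le_Fract_iff)
    then show ?thesis unfolding residue_hom_def by (rule of_base_hom(5))
  qed
  have zero: "q \<in> worst_cone" if "residue_hom q = 0" for q :: "('a, 'b, 'c) xyz_poly"
  proof -
    have "Fract (to_residue q) 1 = 0" using that unfolding residue_hom_def of_base_hom(6) .
    then have "to_residue q = 0" by (simp add: Zero_fract_def eq_fract)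
    then have "q \<in> worst_support"
      unfolding zero_cone_residue.abs_eq cone_residue.abs_eq_iff worst_rel_def by simp
    then show ?thesis by (simp add: worst_support_def)
  qed
  show ?thesis
  proof
    assume ge: "0 \<le> residue_hom q"
    show "q \<in> worst_cone"
    proof (rule ccontr)
      assume q: "q \<notin> worst_cone"
      then have "0 \<le> residue_hom (- q)" using worst_coneD(3) pos by blast
      then have "residue_hom q = 0" using ge by (simp add: is_homD[OF residue_hom])
      then show False using zero q by blast
    qed
  qed (rule pos)
qed

theorem prime_cone_realizable:
  fixes P :: "('n::finite, 'm::finite, 'p::finite) xyz_poly set"
  assumes "prime_cone P" shows "realizable P"
proof -
  have "realizable (worst_cone :: ('n, 'm, 'p) xyz_poly set)"
    unfolding realizable_def
  proof (intro allI impI)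
    fix S :: "('n, 'm, 'p) xyz_poly set" assume S: "finite S"
    have fin: "finite (UNIV :: ('n, 'm, 'p) xyz_var set)"
    proof -
      have "(UNIV :: ('n, 'm, 'p) xyz_var set) = range VX \<union> range VY \<union> range VZ"
      proof (rule UNIV_eq_I)
        fix v :: "('n, 'm, 'p) xyz_var"
        show "v \<in> range VX \<union> range VY \<union> range VZ" by (cases v) auto
      qed
      then show ?thesis by (metis finite finite_Un finite_imageI)
    qed
    have "S \<subseteq> polys_in UNIV" by (simp add: polys_in_def)
    from artin_lang[OF residue_hom fin S this] obtain a where a: "\<And>f. f \<in> S \<Longrightarrow> sg (poly_eval f a) = sg (residue_hom f)"
      by blast
    have "f \<in> worst_cone \<longleftrightarrow> 0 \<le> poly_eval f a" if "f \<in> S" for f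
      using sg_neg_iff[OF a[OF that]] worst_cone_iff[of f] by (simp add: not_less[symmetric])
    then show "\<exists>a. \<forall>f\<in>S. f \<in> worst_cone \<longleftrightarrow> 0 \<le> poly_eval f a" by blast
  qed
  with worst_cone(2)[OF assms] show ?thesis by blast
qed

section \<open>Archimedean quadratic modules\<close>

definition qmod :: "('n, 'm, 'p) xyz_var set \<Rightarrow> ('n, 'm, 'p) xyz_poly set \<Rightarrow> bool" where
  "qmod V Q \<longleftrightarrow> Q \<subseteq> polys_in V \<and> 1 \<in> Q \<and> (\<forall>p\<in>Q. \<forall>q\<in>Q. p + q \<in> Q) \<and> (\<forall>a\<in>polys_in V. \<forall>q\<in>Q. a\<^sup>2 * q \<in> Q)"

text \<open>An upper bound for every element also gives lower bounds, through
  \<open>- a\<close>.\<close>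

definition arch :: "('n, 'm, 'p) xyz_var set \<Rightarrow> ('n, 'm, 'p) xyz_poly set \<Rightarrow> bool" where
  "arch V Q \<longleftrightarrow> (\<forall>a\<in>polys_in V. \<exists>N. Const N - a \<in> Q)"

lemma qmodD:
  assumes "qmod V Q"
  shows "q \<in> Q \<Longrightarrow> q \<in> polys_in V" "1 \<in> Q" "p \<in> Q \<Longrightarrow> q \<in> Q \<Longrightarrow> p + q \<in> Q"
    "a \<in> polys_in V \<Longrightarrow> q \<in> Q \<Longrightarrow> a\<^sup>2 * q \<in> Q" "a \<in> polys_in V \<Longrightarrow> a\<^sup>2 \<in> Q" "0 \<in> Q"
    "0 \<le> c \<Longrightarrow> Const c \<in> Q" "0 \<le> c \<Longrightarrow> q \<in> Q \<Longrightarrow> Const c * q \<in> Q"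
proof -
  show 1: "q \<in> Q \<Longrightarrow> q \<in> polys_in V" "1 \<in> Q" "p \<in> Q \<Longrightarrow> q \<in> Q \<Longrightarrow> p + q \<in> Q"
    "a \<in> polys_in V \<Longrightarrow> q \<in> Q \<Longrightarrow> a\<^sup>2 * q \<in> Q" for p q a
    using assms by (auto simp: qmod_def)
  show sq: "a \<in> polys_in V \<Longrightarrow> a\<^sup>2 \<in> Q" for a using 1(2) 1(4)[of a 1] by simp
  show "0 \<in> Q" using sq[OF polys_in_simps(1)] by simp
  show scale: "0 \<le> c \<Longrightarrow> q \<in> Q \<Longrightarrow> Const c * q \<in> Q" for c q
  proof -
    assume c: "0 \<le> c" "q \<in> Q"
    have "(Const (sqrt c))\<^sup>2 * q \<in> Q" using 1(4) Const_in c by blast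
    moreover have "(Const (sqrt c))\<^sup>2 = (Const c :: ('a, 'b, 'c) xyz_poly)"
      using c by (simp flip: Const_simps(7))
    ultimately show ?thesis by simp
  qed
  show "0 \<le> c \<Longrightarrow> Const c \<in> Q" using scale[of c 1] 1(2) by simp
qed

lemma Const_numeral: "Const (numeral k) = numeral k"
  using Const_simps(8)[of "numeral k"] by simp

lemma Const_cancel: "c \<noteq> 0 \<Longrightarrow> Const (inverse c) * (Const c * q) = q" "c \<noteq> 0 \<Longrightarrow> Const c * (Const (inverse c) * q) = q"
  by (simp_all add: mult.assoc[symmetric] Const_simps(2) flip: Const_simps(4))

text \<open>A quadratic module need not contain the product of n - a and n + a, but it contains each
  factor times the square of the other, and these two products add up to 2n (n^2 - a^2).\<close>

lemma square_bound:
  assumes Q: "qmod V Q" and a: "a \<in> polys_in V" and n: "0 < n" and "Const n - a \<in> Q" "Const n + a \<in> Q"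
  shows "Const (n\<^sup>2) - a\<^sup>2 \<in> Q"
proof -
  let ?s = "(Const n - a)\<^sup>2 * (Const n + a) + (Const n + a)\<^sup>2 * (Const n - a)"
  have na: "Const n - a \<in> polys_in V" "Const n + a \<in> polys_in V" by (intro polys_in_simps Const_in a)+
  have "?s \<in> Q" by (rule qmodD(3)[OF Q qmodD(4)[OF Q na(1) assms(5)] qmodD(4)[OF Q na(2) assms(4)]])
  then have "Const (inverse (2 * n)) * ?s \<in> Q" using n by (intro qmodD(8)[OF Q]) auto
  moreover have "?s = Const (2 * n) * (Const (n\<^sup>2) - a\<^sup>2)"
    by (simp add: Const_numeral Const_simps(4,7) power2_eq_square algebra_simps)
  moreover have "Const (inverse (2 * n)) * (Const (2 * n) * (Const (n\<^sup>2) - a\<^sup>2)) = Const (n\<^sup>2) - a\<^sup>2"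
    using n by (intro Const_cancel(1)) simp
  ultimately show ?thesis by metis
qed

lemma shift_in:
  assumes Q: "qmod V Q" and "Const n - a \<in> Q" "n \<le> m" shows "Const m - a \<in> Q"
proof -
  have "Const (m - n) + (Const n - a) \<in> Q" using assms by (intro qmodD(3)[OF Q] qmodD(7)[OF Q]) auto
  moreover have "Const (m - n) + (Const n - a) = Const m - a" by (simp add: Const_simps(6))
  ultimately show ?thesis by metis
qed

text \<open>The elements bounded on both sides modulo \<open>Q\<close> form a ring:
  \<open>square_bound\<close> handles squares, and polarization handles products. It remains to
  bound the variables.\<close>

lemma arch_from_norm:
  assumes Q: "qmod V Q" and "finite V" and N: "Const N - (\<Sum>v\<in>V. (Var v)\<^sup>2) \<in> Q"
  shows "arch V Q"
proof -
  note q = qmodD[OF Q]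
  define H where "H a \<longleftrightarrow> a \<in> polys_in V \<and> (\<exists>n>0. Const n - a \<in> Q \<and> Const n + a \<in> Q)" for a
  have HI: "H a" if "a \<in> polys_in V" "Const n - a \<in> Q" "Const n' + a \<in> Q" for a n n'
  proof -
    define m where "m = max 1 (max n n')"
    have "Const m - a \<in> Q" by (rule shift_in[OF Q that(2)]) (simp add: m_def)
    moreover have "Const m - (- a) \<in> Q" by (rule shift_in[OF Q, of n']) (use that(3) in \<open>simp_all add: m_def\<close>)
    then have "Const m + a \<in> Q" by simp
    moreover have "0 < m" by (simp add: m_def)
    ultimately show ?thesis using that(1) H_def by blast
  qed
  have Hadd: "H (a + b)" if ab: "H a" "H b" for a b
  proof -
    obtain n k where *: "Const n - a \<in> Q" "Const n + a \<in> Q" "Const k - b \<in> Q" "Const k + b \<in> Q"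
      using ab by (auto simp: H_def)
    show ?thesis
    proof (rule HI)
      show "a + b \<in> polys_in V" using ab polys_in_simps(3) by (auto simp: H_def)
      have "(Const n - a) + (Const k - b) \<in> Q" "(Const n + a) + (Const k + b) \<in> Q" using * q(3) by blast+
      then show "Const (n + k) - (a + b) \<in> Q" "Const (n + k) + (a + b) \<in> Q"
        by (simp_all add: Const_simps algebra_simps)
    qed
  qed
  have Hminus: "H (- a)" if "H a" for a
    using that polys_in_simps(6) by (auto simp: H_def)
  have Hscale: "H (Const c * a)" if c: "0 \<le> c" and a: "H a" for c a
  proof -
    obtain n where *: "Const n - a \<in> Q" "Const n + a \<in> Q" using a by (auto simp: H_def)
    show ?thesis
    proof (rule HI)
      show "Const c * a \<in> polys_in V" using a by (auto simp: H_def intro: polys_in_simps Const_in)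
      have "Const c * (Const n - a) \<in> Q" "Const c * (Const n + a) \<in> Q" using * c q(8) by blast+
      then show "Const (c * n) - Const c * a \<in> Q" "Const (c * n) + Const c * a \<in> Q"
        by (simp_all add: Const_simps algebra_simps)
    qed
  qed
  have Hsquare: "H (a\<^sup>2)" if a: "H a" for a
  proof -
    obtain n where *: "0 < n" "Const n - a \<in> Q" "Const n + a \<in> Q" "a \<in> polys_in V" using a by (auto simp: H_def)
    show ?thesis
    proof (rule HI)
      show "a\<^sup>2 \<in> polys_in V" using *(4) by (rule polys_in_simps)
      show "Const (n\<^sup>2) - a\<^sup>2 \<in> Q" by (rule square_bound[OF Q *(4,1,2,3)])
      show "Const 0 + a\<^sup>2 \<in> Q" using q(5) *(4) by (simp add: Const_simps)
    qed
  qed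
  have Hmult: "H (a * b)" if ab: "H a" "H b" for a b
  proof -
    have "a * b = Const (1/4) * (Const 4 * (a * b))" using Const_cancel(1)[of 4 "a * b"] by (simp add: inverse_eq_divide)
    also have "Const 4 * (a * b) = (a + b)\<^sup>2 + - ((a + - b)\<^sup>2)"
      by (simp add: Const_numeral power2_eq_square algebra_simps)
    finally have eq: "a * b = Const (1/4) * ((a + b)\<^sup>2 + - ((a + - b)\<^sup>2))" .
    show ?thesis unfolding eq by (rule Hscale) (simp, intro Hadd Hminus Hsquare ab)
  qed
  have HVar: "H (Var v)" if v: "v \<in> V" for v
  proof -
    have sum_in: "(\<Sum>u\<in>U. (Var u)\<^sup>2) \<in> Q" if "finite U" "U \<subseteq> V" for U
      using that by (induction U) (auto simp: q(6) intro!: q(3,5) Var_in)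
    have "(Const N - (\<Sum>v\<in>V. (Var v)\<^sup>2)) + (\<Sum>u\<in>V - {v}. (Var u)\<^sup>2) \<in> Q"
      using N sum_in[of "V - {v}"] \<open>finite V\<close> by (intro q(3)) auto
    then have Nv: "Const N - (Var v)\<^sup>2 \<in> Q"
      using sum.remove[OF \<open>finite V\<close> v, of "\<lambda>v. (Var v)\<^sup>2"] by simp
    have sq: "(Const 1 - Var v)\<^sup>2 \<in> Q" "(Const 1 + Var v)\<^sup>2 \<in> Q"
      using v by (intro q(5) polys_in_simps Const_in Var_in; simp)+
    have "H (Const 2 * Var v)"
    proof (rule HI)
      show "Const 2 * Var v \<in> polys_in V" using v by (intro polys_in_simps Const_in Var_in)
      \<comment> \<open>The quadratic terms cancel, so the bound on the square turns into N + 1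
        \<plusminus> 2v.\<close>
      have "(Const N - (Var v)\<^sup>2) + (Const 1 - Var v)\<^sup>2 \<in> Q" "(Const N - (Var v)\<^sup>2) + (Const 1 + Var v)\<^sup>2 \<in> Q"
        using Nv sq q(3) by blast+
      then show "Const (N + 1) - Const 2 * Var v \<in> Q" "Const (N + 1) + Const 2 * Var v \<in> Q"
        by (simp_all add: Const_numeral Const_simps(2,3) power2_eq_square algebra_simps)
    qed
    from Hscale[OF _ this, of "inverse 2"] show ?thesis by (simp only: Const_cancel) simp
  qed
  have HConst: "H (Const c)" for c
    using HI[of "Const c" "\<bar>c\<bar>" "\<bar>c\<bar>"] q(7)[of "\<bar>c\<bar> - c"] q(7)[of "\<bar>c\<bar> + c"] by (simp add: Const_in Const_simps)
  have "H a" if "a \<in> polys_in V" for a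
    using that by (induction rule: polys_in_induct) (auto intro: HConst HVar Hadd Hmult)
  then show ?thesis by (auto simp: arch_def H_def)
qed

section \<open>The representation theorem for archimedean quadratic modules\<close>

definition max_qmod :: "('n, 'm, 'p) xyz_var set \<Rightarrow> ('n, 'm, 'p) xyz_poly set \<Rightarrow> bool" where
  "max_qmod V Q \<longleftrightarrow> qmod V Q \<and> - 1 \<notin> Q \<and> (\<forall>Q'. qmod V Q' \<longrightarrow> - 1 \<notin> Q' \<longrightarrow> Q \<subseteq> Q' \<longrightarrow> Q' = Q)"

lemma max_qmod_exists:
  assumes "qmod V Q" "- 1 \<notin> Q"
  shows "\<exists>M. max_qmod V M \<and> Q \<subseteq> M"
proof -
  define A where "A = {M. qmod V M \<and> - 1 \<notin> M \<and> Q \<subseteq> M}"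
  have "\<exists>M\<in>A. \<forall>B\<in>A. M \<subseteq> B \<longrightarrow> B = M"
  proof (rule subset_Zorn_nonempty)
    show "A \<noteq> {}" using assms by (auto simp: A_def)
  next
    fix C assume ne: "C \<noteq> {}" and "subset.chain A C"
    then have C: "\<And>B. B \<in> C \<Longrightarrow> qmod V B \<and> - 1 \<notin> B \<and> Q \<subseteq> B" "\<And>B D. B \<in> C \<Longrightarrow> D \<in> C \<Longrightarrow> B \<subseteq> D \<or> D \<subseteq> B"
      by (auto simp: subset.chain_def A_def)
    have "qmod V (Union C)"
      unfolding qmod_def
    proof (intro conjI ballI)
      show "Union C \<subseteq> polys_in V" using C(1) qmodD(1) by blast
      show "1 \<in> Union C" using C(1) ne qmodD(2) by blast
    next
      fix p q assume "p \<in> Union C" "q \<in> Union C"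
      then obtain B where "B \<in> C" "p \<in> B" "q \<in> B" using C(2) by blast
      then show "p + q \<in> Union C" using C(1) qmodD(3) by blast
    next
      fix a q assume "a \<in> polys_in V" "q \<in> Union C"
      then show "a\<^sup>2 * q \<in> Union C" using C(1) qmodD(4) by blast
    qed
    then show "Union C \<in> A" using C(1) ne by (auto simp: A_def)
  qed
  then obtain M where M: "M \<in> A" "\<And>B. B \<in> A \<Longrightarrow> M \<subseteq> B \<Longrightarrow> B = M" by blast
  have "max_qmod V M"
    unfolding max_qmod_def
  proof (intro conjI allI impI)
    fix B assume "qmod V B" "- 1 \<notin> B" "M \<subseteq> B"
    then show "B = M" using M by (auto simp: A_def)
  qed (use M(1) in \<open>auto simp: A_def\<close>)
  then show ?thesis using M(1) by (auto simp: A_def)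
qed

lemma sos_0: "0 \<in> sos R"
  unfolding sos_def mem_Collect_eq by (intro exI[of _ "0 :: nat"] exI[of _ "\<lambda>_. 0"]) simp

lemma sos_add_square:
  assumes "s \<in> sos R" "a \<in> R" shows "s + a\<^sup>2 \<in> sos R"
proof -
  obtain k :: nat and q where s: "s = (\<Sum>i<k. q i ^ 2)" "\<forall>i<k. q i \<in> R" using assms(1) unfolding sos_def by blast
  define q' where "q' = q(k := a)"
  have "s + a\<^sup>2 = (\<Sum>i<Suc k. q' i ^ 2)" unfolding s(1) q'_def by simp
  moreover have "\<forall>i<Suc k. q' i \<in> R" using s(2) assms(2) by (simp add: q'_def less_Suc_eq)
  ultimately show ?thesis unfolding sos_def by blast
qed

lemma sos_induct [consumes 1, case_names zero add]:
  assumes "s \<in> sos R" "P 0" "\<And>s a. s \<in> sos R \<Longrightarrow> P s \<Longrightarrow> a \<in> R \<Longrightarrow> P (s + a\<^sup>2)"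
  shows "P s"
proof -
  obtain k :: nat and q where s: "s = (\<Sum>i<k. q i ^ 2)" "\<forall>i<k. q i \<in> R" using assms(1) unfolding sos_def by blast
  have "(\<Sum>i<j. q i ^ 2) \<in> sos R \<and> P (\<Sum>i<j. q i ^ 2)" if "j \<le> k" for j
    using that
  proof (induction j)
    case 0
    then show ?case using assms(2) sos_0 by simp
  next
    case (Suc j)
    then show ?case using assms(3) s(2) by (simp add: sos_add_square)
  qed
  then show ?thesis unfolding s(1) by blast
qed

lemma sos_square: "a \<in> R \<Longrightarrow> a\<^sup>2 \<in> sos R"
  using sos_add_square[OF sos_0] by fastforce

lemma sos_add:
  assumes "s \<in> sos R" "t \<in> sos R" shows "s + t \<in> sos R"
  using assms(2) by (induction rule: sos_induct) (simp_all add: assms(1) sos_add_square flip: add.assoc)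

lemma sos_square_mult:
  assumes "subring_set R" "a \<in> R" "s \<in> sos R" shows "a\<^sup>2 * s \<in> sos R"
  using assms(3)
proof (induction rule: sos_induct)
  case (add s b)
  have "a\<^sup>2 * (s + b\<^sup>2) = a\<^sup>2 * s + (a * b)\<^sup>2" by (simp add: algebra_simps power_mult_distrib)
  then show ?case using add sos_add_square subring_setD(5)[OF assms(1,2)] by metis
qed (simp add: sos_0)

lemma sos_in: "subring_set R \<Longrightarrow> s \<in> sos R \<Longrightarrow> s \<in> R"
  by (erule sos_induct) (auto intro: subring_setD subring_set_power)

lemma qmod_sos_mult:
  assumes "qmod V Q" "s \<in> sos (polys_in V)" "q \<in> Q" shows "s * q \<in> Q"
  using assms(2)
  by (induction rule: sos_induct) (auto simp: distrib_right qmodD(6)[OF assms(1)] intro!: qmodD(3,4)[OF assms(1)] assms(3))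

lemma qmod_extend:
  assumes Q: "qmod V Q" and a: "a \<in> polys_in V"
  shows "qmod V {q + s * a | q s. q \<in> Q \<and> s \<in> sos (polys_in V)}" (is "qmod V ?E")
    and "Q \<subseteq> {q + s * a | q s. q \<in> Q \<and> s \<in> sos (polys_in V)}"
    and "a \<in> {q + s * a | q s. q \<in> Q \<and> s \<in> sos (polys_in V)}"
proof -
  have EI: "x \<in> ?E" if "x = q + s * a" "q \<in> Q" "s \<in> sos (polys_in V)" for x q s using that by blast
  show sub: "Q \<subseteq> ?E" using EI[of _ _ 0] sos_0 by force
  have "1 \<in> sos (polys_in V)" by (metis sos_square polys_in_simps(2) one_power2)
  then show "a \<in> ?E" using qmodD(6)[OF Q] by (intro EI[of a 0 1]) simp_all
  show "qmod V ?E"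
    unfolding qmod_def
  proof (intro conjI ballI)
    show "?E \<subseteq> polys_in V"
      using qmodD(1)[OF Q] a sos_in[OF subring_polys_in] by (auto intro!: polys_in_simps)
    show "1 \<in> ?E" using sub qmodD(2)[OF Q] by blast
  next
    fix x y assume "x \<in> ?E" "y \<in> ?E"
    then obtain p q s t where *: "x = p + s * a" "y = q + t * a" "p \<in> Q" "q \<in> Q" "s \<in> sos (polys_in V)" "t \<in> sos (polys_in V)" by blast
    have "x + y = (p + q) + (s + t) * a" unfolding *(1,2) by (simp add: algebra_simps)
    then show "x + y \<in> ?E" by (rule EI) (intro qmodD(3)[OF Q] sos_add *)+
  next
    fix b x assume b: "b \<in> polys_in V" and "x \<in> ?E"
    then obtain q s where *: "x = q + s * a" "q \<in> Q" "s \<in> sos (polys_in V)" by blast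
    have "b\<^sup>2 * x = b\<^sup>2 * q + (b\<^sup>2 * s) * a" unfolding *(1) by (simp add: algebra_simps)
    then show "b\<^sup>2 * x \<in> ?E" by (rule EI) (intro qmodD(4)[OF Q b] sos_square_mult[OF subring_polys_in b] *)+
  qed
qed

text \<open>Adjoining either element would produce -1, giving -1 = p + s a = p' - s' a. Since
  \<open>Q\<close> has no products, \<open>a\<close> is first eliminated to get
  \<open>- s \<in> Q\<close>. As also \<open>s \<in> Q\<close> and \<open>a\<close> is a difference
  of two squares, \<open>s * a \<in> Q\<close>, so -1 itself lies in \<open>Q\<close>.\<close>

lemma max_qmod_total:
  assumes M: "max_qmod V Q" and a: "a \<in> polys_in V"
  shows "a \<in> Q \<or> - a \<in> Q"
proof (rule ccontr)
  assume neg: "\<not> ?thesis"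
  have Q: "qmod V Q" "- 1 \<notin> Q" using M by (auto simp: max_qmod_def)
  note q = qmodD[OF Q(1)]
  have ext: "\<exists>p s. p \<in> Q \<and> s \<in> sos (polys_in V) \<and> - 1 = p + s * c" if c: "c \<in> polys_in V" "c \<notin> Q" for c
  proof (rule ccontr)
    assume "\<not> ?thesis"
    then have "- 1 \<notin> {q + s * c | q s. q \<in> Q \<and> s \<in> sos (polys_in V)}" by blast
    then show False using M qmod_extend[OF Q(1) c(1)] c(2) unfolding max_qmod_def by blast
  qed
  obtain p s where ps: "p \<in> Q" "s \<in> sos (polys_in V)" "- 1 = p + s * a" using ext[OF a] neg by blast
  obtain p' s' where ps': "p' \<in> Q" "s' \<in> sos (polys_in V)" "- 1 = p' + s' * (- a)"
    using ext[of "- a"] polys_in_simps(6)[OF a] neg by blast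
  have sQ: "t \<in> Q" if "t \<in> sos (polys_in V)" for t using qmod_sos_mult[OF Q(1) that q(2)] by simp
  have "s * a = (p + s * a) - p" "s' * a = p' - (p' + s' * (- a))" by simp_all
  then have e: "s * a = - 1 - p" "s' * a = p' - (- 1)" unfolding ps(3)[symmetric] ps'(3)[symmetric] by simp_all
  \<comment> \<open>Both terms of the difference equal s s' a, by the two relations for -1.\<close>
  have "s + (s' + s' * p + s * p') = s * (p' - (- 1)) - s' * (- 1 - p)" by (simp add: algebra_simps)
  also have "\<dots> = 0" unfolding e[symmetric] by (simp add: mult_ac)
  finally have "- s = s' + s' * p + s * p'" by (rule minus_unique)
  moreover have "s' + s' * p + s * p' \<in> Q"
    by (intro q(3) sQ qmod_sos_mult[OF Q(1)] ps(1,2) ps'(1,2))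
  ultimately have ms: "- s \<in> Q" by simp
  define h where "h = Const (1/2) * (a + 1)"
  define k where "k = Const (1/2) * (a - 1)"
  have hk: "h \<in> polys_in V" "k \<in> polys_in V" unfolding h_def k_def using a by (intro polys_in_simps Const_in; simp)+
  have "(Const (1/2))\<^sup>2 * Const 4 = (1 :: ('a, 'b, 'c) xyz_poly)"
    by (simp add: Const_simps(2) power2_eq_square flip: Const_simps(4))
  moreover have "h\<^sup>2 - k\<^sup>2 = (Const (1/2))\<^sup>2 * Const 4 * a"
    unfolding h_def k_def power_mult_distrib by (simp add: Const_numeral power2_eq_square algebra_simps)
  ultimately have hka: "h\<^sup>2 - k\<^sup>2 = a" by simp
  have "h\<^sup>2 * s + k\<^sup>2 * (- s) \<in> Q" using ms sQ[OF ps(2)] hk by (intro q(3,4))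
  moreover have "h\<^sup>2 * s + k\<^sup>2 * (- s) = s * a" unfolding hka[symmetric] by (simp add: algebra_simps)
  ultimately have "p + s * a \<in> Q" using ps(1) q(3) by metis
  then show False using ps(3) Q(2) by metis
qed

text \<open>The standard part: \<open>near Q a c\<close> says that \<open>a\<close> is infinitely close to the real number \<open>c\<close>.\<close>

definition near :: "('n, 'm, 'p) xyz_poly set \<Rightarrow> ('n, 'm, 'p) xyz_poly \<Rightarrow> real \<Rightarrow> bool" where
  "near Q a c \<longleftrightarrow> (\<forall>e>0. Const e + (a - Const c) \<in> Q \<and> Const e - (a - Const c) \<in> Q)"

lemma near_add:
  assumes "qmod V Q" "near Q a c" "near Q b d" shows "near Q (a + b) (c + d)"
  unfolding near_def
proof (intro allI impI)
  fix e :: real assume "0 < e"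
  then have *: "Const (e/2) + (a - Const c) \<in> Q" "Const (e/2) - (a - Const c) \<in> Q"
    "Const (e/2) + (b - Const d) \<in> Q" "Const (e/2) - (b - Const d) \<in> Q" using assms(2,3) by (auto simp: near_def)
  have e: "Const e = Const (e/2) + (Const (e/2) :: ('a, 'b, 'c) xyz_poly)" by (simp flip: Const_simps(3))
  have "Const e + (a + b - Const (c + d)) = (Const (e/2) + (a - Const c)) + (Const (e/2) + (b - Const d))"
    "Const e - (a + b - Const (c + d)) = (Const (e/2) - (a - Const c)) + (Const (e/2) - (b - Const d))"
    unfolding e by (simp_all add: Const_simps(3) algebra_simps)
  then show "Const e + (a + b - Const (c + d)) \<in> Q \<and> Const e - (a + b - Const (c + d)) \<in> Q"
    using qmodD(3)[OF assms(1)] * by metis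
qed

lemma near_scale:
  assumes "qmod V Q" "near Q a c" shows "near Q (Const r * a) (r * c)"
proof -
  have pos: "near Q (Const r * a) (r * c)" if "0 < r" "near Q a c" for r a c
    unfolding near_def
  proof (intro allI impI)
    fix e :: real assume "0 < e"
    then have "Const (e/r) + (a - Const c) \<in> Q" "Const (e/r) - (a - Const c) \<in> Q" using that by (auto simp: near_def)
    then have "Const r * (Const (e/r) + (a - Const c)) \<in> Q" "Const r * (Const (e/r) - (a - Const c)) \<in> Q"
      using that(1) by (auto intro: qmodD(8)[OF assms(1)])
    moreover have "Const r * Const (e/r) = (Const e :: ('a, 'b, 'c) xyz_poly)" using that(1) by (simp flip: Const_simps(4))
    ultimately show "Const e + (Const r * a - Const (r * c)) \<in> Q \<and> Const e - (Const r * a - Const (r * c)) \<in> Q"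
      by (simp add: Const_simps(4) algebra_simps)
  qed
  have neg: "near Q (- a) (- c)"
    using assms(2) unfolding near_def by (auto simp: Const_simps(5) algebra_simps)
  consider "0 < r" | "r = 0" | "0 < - r" by linarith
  then show ?thesis
  proof cases
    case 1
    then show ?thesis using pos assms(2) by blast
  next
    case 2
    then show ?thesis using qmodD(7)[OF assms(1)] by (simp add: near_def Const_simps(1))
  next
    case 3
    from pos[OF this neg] show ?thesis by (simp add: Const_simps(5))
  qed
qed

lemma near_Const: "qmod V Q \<Longrightarrow> near Q (Const c) c"
  using qmodD(7)[of V Q] by (simp add: near_def)

text \<open>After centring at \<open>c\<close> the claim is the case of an element near 0, where
  \<open>square_bound\<close> with radius \<open>sqrt e\<close> applies; then a^2 = (a - c)^2 + 2c a
  - c^2.\<close>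

lemma near_square:
  assumes Q: "qmod V Q" and a: "a \<in> polys_in V" "near Q a c" shows "near Q (a\<^sup>2) (c\<^sup>2)"
proof -
  define b where "b = a + Const (- c)"
  have b: "b \<in> polys_in V" unfolding b_def using a by (intro polys_in_simps Const_in)
  have nb: "near Q b 0" using near_add[OF Q a(2) near_Const[OF Q, of "- c"]] by (simp add: b_def)
  have "near Q (b\<^sup>2) 0"
    unfolding near_def
  proof (intro allI impI conjI)
    fix e :: real assume e: "0 < e"
    then have "Const (sqrt e) - b \<in> Q" "Const (sqrt e) + b \<in> Q" using nb by (auto simp: near_def Const_simps(1))
    from square_bound[OF Q b _ this] show "Const e - (b\<^sup>2 - Const 0) \<in> Q" using e by (simp add: Const_simps(1))
    show "Const e + (b\<^sup>2 - Const 0) \<in> Q" using e qmodD(3,5,7)[OF Q] b by (simp add: Const_simps(1))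
  qed
  from near_add[OF Q this near_add[OF Q near_scale[OF Q a(2), of "2 * c"] near_Const[OF Q, of "- (c\<^sup>2)"]]]
  have "near Q (b\<^sup>2 + (Const (2 * c) * a + Const (- (c\<^sup>2)))) (0 + (2 * c * c + - (c\<^sup>2)))" .
  moreover have "b\<^sup>2 + (Const (2 * c) * a + Const (- (c\<^sup>2))) = a\<^sup>2"
    by (simp add: Const_numeral b_def power2_eq_square Const_simps(4,5) algebra_simps)
  ultimately show ?thesis by (simp add: power2_eq_square)
qed

lemma near_mult:
  assumes Q: "qmod V Q" and a: "a \<in> polys_in V" "near Q a c" and b: "b \<in> polys_in V" "near Q b d"
  shows "near Q (a * b) (c * d)"
proof -
  have p: "near Q ((a + b)\<^sup>2) ((c + d)\<^sup>2)"
    using near_square[OF Q _ near_add[OF Q a(2) b(2)]] polys_in_simps(3) a b by blast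
  have m: "near Q ((a + Const (- 1) * b)\<^sup>2) ((c + (- 1) * d)\<^sup>2)"
    by (rule near_square[OF Q _ near_add[OF Q a(2) near_scale[OF Q b(2)]]]) (intro polys_in_simps Const_in a b)
  from near_scale[OF Q near_add[OF Q p near_scale[OF Q m, of "- 1"]], of "1/4"]
  have "near Q (Const (1/4) * ((a + b)\<^sup>2 + Const (- 1) * (a + Const (- 1) * b)\<^sup>2)) (1/4 * ((c + d)\<^sup>2 + - 1 * (c + (- 1) * d)\<^sup>2))" .
  moreover have "(a + b)\<^sup>2 + Const (- 1) * (a + Const (- 1) * b)\<^sup>2 = Const 4 * (a * b)"
    by (simp add: Const_numeral power2_eq_square Const_simps(2,5) algebra_simps)
  moreover have "Const (1/4) * (Const 4 * (a * b)) = a * b" using Const_cancel(1)[of 4 "a * b"] by (simp add: inverse_eq_divide)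
  moreover have "1/4 * ((c + d)\<^sup>2 + - 1 * (c + (- 1) * d)\<^sup>2) = c * d" by (simp add: power2_eq_square algebra_simps)
  ultimately show ?thesis by metis
qed

text \<open>A Dedekind cut: \<open>c\<close> is the supremum of the reals below \<open>a\<close>
  modulo \<open>Q\<close>. The cut is nonempty and bounded by archimedeanity, and totality gives the
  upper estimate.\<close>

lemma near_exists:
  assumes M: "max_qmod V Q" and "arch V Q" and a: "a \<in> polys_in V"
  shows "\<exists>c. near Q a c"
proof -
  have Q: "qmod V Q" "- 1 \<notin> Q" using M by (auto simp: max_qmod_def)
  define L where "L = {r. a - Const r \<in> Q}"
  obtain N where N: "Const N - a \<in> Q" using assms(2) a by (auto simp: arch_def)
  obtain N' where N': "Const N' - (- a) \<in> Q" using assms(2) polys_in_simps(6)[OF a] unfolding arch_def by blast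
  have "- N' \<in> L" using N' by (simp add: L_def Const_simps(5) add.commute)
  have neg: "Const r \<notin> Q" if "r < 0" for r
  proof
    assume "Const r \<in> Q"
    then have "Const (inverse (- r)) * Const r \<in> Q" using that by (intro qmodD(8)[OF Q(1)]) auto
    moreover have "Const (inverse (- r)) * Const r = (- 1 :: ('a, 'b, 'c) xyz_poly)"
      using that by (simp add: Const_simps(2,5) flip: Const_simps(4))
    ultimately show False using Q(2) by simp
  qed
  have "r \<le> N" if "r \<in> L" for r
  proof (rule ccontr)
    assume "\<not> r \<le> N"
    then have "Const (N - r) \<notin> Q" by (intro neg) simp
    moreover have "(Const N - a) + (a - Const r) \<in> Q" using that by (intro qmodD(3)[OF Q(1) N]) (simp add: L_def)
    ultimately show False by (simp add: Const_simps(6))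
  qed
  then have bdd: "bdd_above L" by (rule bdd_aboveI)
  define c where "c = Sup L"
  have "Const e + (a - Const c) \<in> Q \<and> Const e - (a - Const c) \<in> Q" if e: "0 < e" for e
  proof
    obtain r where r: "r \<in> L" "c - e < r" using less_cSup_iff[OF _ bdd, of "c - e"] \<open>- N' \<in> L\<close> e unfolding c_def by auto
    then have "Const (r - (c - e)) + (a - Const r) \<in> Q" using qmodD(3,7)[OF Q(1)] by (simp add: L_def)
    then show "Const e + (a - Const c) \<in> Q" by (simp add: Const_simps algebra_simps)
    have "c + e \<notin> L" using cSup_upper[OF _ bdd, of "c + e"] e unfolding c_def by auto
    then have "a - Const (c + e) \<notin> Q" by (simp add: L_def)
    then have "- (a - Const (c + e)) \<in> Q"
      using max_qmod_total[OF M, of "a - Const (c + e)"] polys_in_simps(4)[OF a Const_in] by blast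
    then show "Const e - (a - Const c) \<in> Q" by (simp add: Const_simps algebra_simps)
  qed
  then show ?thesis by (auto simp: near_def)
qed

lemma near_nonneg:
  assumes "qmod V Q" "- 1 \<notin> Q" "a \<in> Q" "near Q a c" shows "0 \<le> c"
proof (rule ccontr)
  assume "\<not> 0 \<le> c"
  then have c: "0 < - c / 2" by simp
  then have "Const (- c / 2) - (a - Const c) \<in> Q" using assms(4) by (auto simp: near_def)
  then have "a + (Const (- c / 2) - (a - Const c)) \<in> Q" using assms qmodD(3) by blast
  moreover have "a + (Const (- c / 2) - (a - Const c)) = Const (- c / 2 + c)" unfolding Const_simps(3) by simp
  ultimately have "Const (c / 2) \<in> Q" by simp
  then have "Const (inverse (- c / 2)) * Const (c / 2) \<in> Q" using c by (intro qmodD(8)[OF assms(1)]) auto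
  moreover have "Const (inverse (- c / 2)) * Const (c / 2) = (- 1 :: ('a, 'b, 'c) xyz_poly)"
    using c by (simp add: Const_simps(2,5) flip: Const_simps(4))
  ultimately show False using assms(2) by simp
qed

text \<open>The coordinates are the standard parts of the variables, which determine the
  homomorphism on \<open>polys_in V\<close>; coordinates outside \<open>V\<close> are
  arbitrary.\<close>

lemma qmod_real_point:
  assumes "qmod V Q" "- 1 \<notin> Q" "arch V Q"
  shows "\<exists>a. \<forall>q\<in>Q. 0 \<le> poly_eval q a"
proof -
  obtain M where M: "max_qmod V M" "Q \<subseteq> M" using max_qmod_exists assms(1,2) by blast
  have qM: "qmod V M" "- 1 \<notin> M" using M(1) by (auto simp: max_qmod_def)
  have "arch V M" using assms(3) M(2) unfolding arch_def by blast
  define \<phi> where "\<phi> a = (SOME c. near M a c)" for a :: "('a, 'b, 'c) xyz_poly"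
  have near: "near M a (\<phi> a)" if "a \<in> polys_in V" for a
    unfolding \<phi>_def using near_exists[OF M(1) \<open>arch V M\<close> that] by (rule someI_ex)
  have unique: "c = d" if "near M a c" "near M a d" for a c d
  proof -
    have "c - d \<ge> 0" if "near M a c" "near M a d" for c d
      using near_nonneg[OF qM qmodD(6)[OF qM(1)], of "c - d"] near_add[OF qM(1) that(1) near_scale[OF qM(1) that(2), of "- 1"]]
      by (simp add: Const_simps(2,5))
    from this[OF that] this[OF that(2,1)] show ?thesis by simp
  qed
  have "\<phi> q = poly_eval q (\<lambda>v. \<phi> (Var v))" if "q \<in> polys_in V" for q
  proof (rule hom_eq_poly_eval[OF that])
    show "\<phi> (Const c) = c" for c using unique near[OF Const_in] near_Const[OF qM(1)] by blast
    fix p q assume pq: "p \<in> polys_in V" "q \<in> polys_in V"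
    show "\<phi> (p + q) = \<phi> p + \<phi> q \<and> \<phi> (p * q) = \<phi> p * \<phi> q"
      using unique[OF near[OF polys_in_simps(3)[OF pq]] near_add[OF qM(1) near[OF pq(1)] near[OF pq(2)]]]
        unique[OF near[OF polys_in_simps(5)[OF pq]] near_mult[OF qM(1) pq(1) near[OF pq(1)] pq(2) near[OF pq(2)]]] by simp
  qed
  moreover have "q \<in> polys_in V" "0 \<le> \<phi> q" if "q \<in> Q" for q
  proof -
    show q: "q \<in> polys_in V" using that M(2) qmodD(1)[OF qM(1)] by blast
    show "0 \<le> \<phi> q" using near_nonneg[OF qM _ near[OF q]] that M(2) by blast
  qed
  ultimately have "0 \<le> poly_eval q (\<lambda>v. \<phi> (Var v))" if "q \<in> Q" for q using that by metis
  then show ?thesis by blast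
qed

text \<open>Adjoining \<open>- f\<close> cannot give a proper module, as a real point of it would
  have \<open>f\<close> both positive and nonpositive. This gives \<open>s * f - 1 \<in> Q\<close>
  for a sum of squares \<open>s\<close>. Division by \<open>s\<close> being impossible, one starts
  from some \<open>f + Const N \<in> Q\<close> and lowers the constant to 0 in finitely many equal
  steps.\<close>

theorem archimedean_positivstellensatz:
  assumes Q: "qmod V Q" and A: "arch V Q" and f: "f \<in> polys_in V"
    and pos: "\<And>a. (\<And>q. q \<in> Q \<Longrightarrow> 0 \<le> poly_eval q a) \<Longrightarrow> 0 < poly_eval f a"
  shows "f \<in> Q"
proof -
  note q = qmodD[OF Q]
  have mf: "- f \<in> polys_in V" using f by (rule polys_in_simps)
  let ?E = "{q + s * (- f) | q s. q \<in> Q \<and> s \<in> sos (polys_in V)}"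
  have "- 1 \<in> ?E"
  proof (rule ccontr)
    assume "- 1 \<notin> ?E"
    moreover have "arch V ?E" using A qmod_extend(2)[OF Q mf] unfolding arch_def by blast
    ultimately obtain a where a: "\<forall>q\<in>?E. 0 \<le> poly_eval q a" using qmod_real_point[OF qmod_extend(1)[OF Q mf]] by blast
    then have "0 < poly_eval f a" using qmod_extend(2)[OF Q mf] by (intro pos) blast
    moreover have "0 \<le> poly_eval (- f) a" using a qmod_extend(3)[OF Q mf] by blast
    ultimately show False by simp
  qed
  then obtain p s where ps: "p \<in> Q" "s \<in> sos (polys_in V)" "- 1 = p + s * (- f)" by blast
  then have sf: "s * f - 1 \<in> Q" by (simp add: algebra_simps)
  have s: "s \<in> polys_in V" using sos_in[OF subring_polys_in ps(2)] .
  obtain k1 where k1: "Const k1 - s \<in> Q" using A s by (auto simp: arch_def)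
  have "s\<^sup>2 * f + 1 \<in> polys_in V" using s f by (intro polys_in_simps)
  then obtain k2 where k2: "Const k2 - (s\<^sup>2 * f + 1) \<in> Q" using A by (auto simp: arch_def)
  \<comment> \<open>The bound 2k has to dominate both \<open>s\<close> and
    \<open>s\<^sup>2 * f + 1\<close> modulo \<open>Q\<close>, the two errors in the identity
    below.\<close>
  define k where "k = max 1 (max k1 k2)"
  have k: "0 < k" "k1 \<le> 2 * k" "k2 \<le> 2 * k" by (auto simp: k_def)
  have ks: "Const (2 * k) - s \<in> Q" by (rule shift_in[OF Q k1 k(2)])
  have ksf: "Const (2 * k) - (s\<^sup>2 * f + 1) \<in> Q" by (rule shift_in[OF Q k2 k(3)])
  text \<open>Multiplying \<open>f + r\<close> by \<open>k\<^sup>2 = (k - s)\<^sup>2 + (2 k s - s\<^sup>2)\<close> lowers \<open>r\<close> by the fixed amount \<open>1 / k\<^sup>2\<close>.\<close>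
  have step: "f + Const (r - 1 / k\<^sup>2) \<in> Q" if r: "0 \<le> r" "f + Const r \<in> Q" for r
  proof -
    have t1: "(Const k - s)\<^sup>2 * (f + Const r) \<in> Q" by (rule q(4)[OF _ r(2)]) (intro polys_in_simps Const_in s)
    have t2: "Const (2 * k) * (s * f - 1) \<in> Q" by (rule q(8)[OF _ sf]) (use k in simp)
    have t3: "Const r * (s * (Const (2 * k) - s)) \<in> Q" by (rule q(8)[OF r(1) qmod_sos_mult[OF Q ps(2) ks]])
    have "(Const k - s)\<^sup>2 * (f + Const r) + (Const (2 * k) * (s * f - 1) + (Const r * (s * (Const (2 * k) - s)) + (Const (2 * k) - (s\<^sup>2 * f + 1)))) \<in> Q"
      by (intro q(3) t1 t2 t3 ksf)
    moreover have "(Const k - s)\<^sup>2 * (f + Const r) + (Const (2 * k) * (s * f - 1) + (Const r * (s * (Const (2 * k) - s)) + (Const (2 * k) - (s\<^sup>2 * f + 1))))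
       = Const (k\<^sup>2) * (f + Const r) - 1"
      by (simp add: Const_numeral power2_eq_square Const_simps(4) algebra_simps)
    ultimately have "Const (inverse (k\<^sup>2)) * (Const (k\<^sup>2) * (f + Const r) - 1) \<in> Q" by (intro q(8)) auto
    moreover have "Const (inverse (k\<^sup>2)) * (Const (k\<^sup>2) * (f + Const r) - 1) = f + Const r - Const (inverse (k\<^sup>2))"
      using k Const_cancel(1)[of "k\<^sup>2" "f + Const r"] by (simp add: right_diff_distrib)
    ultimately show ?thesis by (simp add: Const_simps(6) inverse_eq_divide algebra_simps)
  qed
  obtain N where N: "Const N - (- f) \<in> Q" using A mf unfolding arch_def by blast
  \<comment> \<open>Truncation at 0 preserves the premise \<open>0 \<le> r\<close> of
    \<open>step\<close>.\<close>
  have iter: "f + Const (max 0 (max N 0 - of_nat n / k\<^sup>2)) \<in> Q" for n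
  proof (induction n)
    case 0
    have "Const (max N 0 - N) + (Const N - (- f)) \<in> Q" using q(3)[OF q(7) N] by simp
    then show ?case by (simp add: Const_simps(6) add.commute)
  next
    case (Suc n)
    define r where "r = max 0 (max N 0 - of_nat n / k\<^sup>2)"
    have "Const (max 0 (max N 0 - of_nat (Suc n) / k\<^sup>2) - (r - 1 / k\<^sup>2)) + (f + Const (r - 1 / k\<^sup>2)) \<in> Q"
    proof (rule q(3)[OF q(7)])
      show "f + Const (r - 1 / k\<^sup>2) \<in> Q" using step[of r] Suc by (simp add: r_def)
      show "0 \<le> max 0 (max N 0 - of_nat (Suc n) / k\<^sup>2) - (r - 1 / k\<^sup>2)"
      proof -
        have eq: "max N 0 - of_nat (Suc n) / k\<^sup>2 = (max N 0 - of_nat n / k\<^sup>2) - 1 / k\<^sup>2"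
          by (simp add: add_divide_distrib)
        have "0 < 1 / k\<^sup>2" using k by simp
        then show ?thesis unfolding r_def eq by linarith
      qed
    qed
    then show ?case by (simp add: Const_simps(6) add.commute)
  qed
  obtain n :: nat where "max N 0 * k\<^sup>2 \<le> of_nat n" using real_arch_simple by blast
  moreover have "0 < k\<^sup>2" using k by simp
  ultimately have "max N 0 \<le> of_nat n / k\<^sup>2" by (simp only: pos_le_divide_eq)
  then have "max 0 (max N 0 - of_nat n / k\<^sup>2) = 0" by (intro max_absorb1) linarith
  then show ?thesis using iter[of n] by (simp only: Const_simps(1) add_0_right)
qed

section \<open>Preorderings and Schmuedgen's theorem\<close>

definition preordering :: "'a::comm_ring_1 set \<Rightarrow> bool" where
  "preordering T \<longleftrightarrow> (\<forall>a\<in>T. \<forall>b\<in>T. a + b \<in> T \<and> a * b \<in> T) \<and> (\<forall>a. a\<^sup>2 \<in> T)"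

lemma preorderingD:
  assumes "preordering T"
  shows "a \<in> T \<Longrightarrow> b \<in> T \<Longrightarrow> a + b \<in> T" "a \<in> T \<Longrightarrow> b \<in> T \<Longrightarrow> a * b \<in> T" "a\<^sup>2 \<in> T" "0 \<in> T" "1 \<in> T"
proof -
  show "a \<in> T \<Longrightarrow> b \<in> T \<Longrightarrow> a + b \<in> T" "a \<in> T \<Longrightarrow> b \<in> T \<Longrightarrow> a * b \<in> T" and sq: "a\<^sup>2 \<in> T" for a b
    using assms by (auto simp: preordering_def)
  show "0 \<in> T" "1 \<in> T" using sq[of 0] sq[of 1] by simp_all
qed

lemma preordering_extend:
  assumes T: "preordering T"
  shows "preordering {s + t * c | s t. s \<in> T \<and> t \<in> T}" (is "preordering ?E")
    and "T \<subseteq> {s + t * c | s t. s \<in> T \<and> t \<in> T}" and "c \<in> {s + t * c | s t. s \<in> T \<and> t \<in> T}"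
proof -
  note T = preorderingD[OF T]
  have EI: "x \<in> ?E" if "x = s + t * c" "s \<in> T" "t \<in> T" for x s t using that by blast
  show sub: "T \<subseteq> ?E" using EI[of _ _ 0] T(4) by auto
  show "c \<in> ?E" by (rule EI[of c 0 1]) (simp_all add: T(4,5))
  show "preordering ?E"
    unfolding preordering_def
  proof (intro conjI ballI allI)
    fix x y assume "x \<in> ?E" "y \<in> ?E"
    then obtain s t s' t' where *: "x = s + t * c" "y = s' + t' * c" "s \<in> T" "t \<in> T" "s' \<in> T" "t' \<in> T" by blast
    have "x + y = (s + s') + (t + t') * c" unfolding *(1,2) by (simp add: algebra_simps)
    then show "x + y \<in> ?E" by (rule EI) (intro T *)+
    have "x * y = (s * s' + c\<^sup>2 * (t * t')) + (s * t' + t * s') * c"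
      unfolding *(1,2) by (simp add: algebra_simps power2_eq_square)
    then show "x * y \<in> ?E" by (rule EI) (intro T *)+
  next
    fix a show "a\<^sup>2 \<in> ?E" using sub T(3) by blast
  qed
qed

text \<open>A maximal proper preordering is a prime cone, because adjoining any outside element
  \<open>c\<close> yields a relation -1 = s + t c. Two such relations, multiplied, contradict
  properness: for \<open>a\<close> and \<open>- a\<close> this gives totality, for two factors with
  product in the support it gives primality.\<close>

lemma prime_cone_exists:
  assumes T: "preordering T" and "- 1 \<notin> T"
  shows "\<exists>P. prime_cone P \<and> T \<subseteq> P"
proof -
  define A where "A = {P. preordering P \<and> - 1 \<notin> P \<and> T \<subseteq> P}"
  have "\<exists>M\<in>A. \<forall>B\<in>A. M \<subseteq> B \<longrightarrow> B = M"
  proof (rule subset_Zorn_nonempty)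
    show "A \<noteq> {}" using assms by (auto simp: A_def)
  next
    fix C assume ne: "C \<noteq> {}" and "subset.chain A C"
    then have C: "\<And>B. B \<in> C \<Longrightarrow> preordering B \<and> - 1 \<notin> B \<and> T \<subseteq> B" "\<And>B D. B \<in> C \<Longrightarrow> D \<in> C \<Longrightarrow> B \<subseteq> D \<or> D \<subseteq> B"
      by (auto simp: subset.chain_def A_def)
    have "preordering (Union C)"
      unfolding preordering_def
    proof (intro conjI ballI allI)
      fix p q assume "p \<in> Union C" "q \<in> Union C"
      then obtain B where "B \<in> C" "p \<in> B" "q \<in> B" using C(2) by blast
      then show "p + q \<in> Union C" "p * q \<in> Union C" using C(1) preorderingD(1,2) by blast+
    next
      fix a show "a\<^sup>2 \<in> Union C" using C(1) ne preorderingD(3) by blast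
    qed
    then show "Union C \<in> A" using C(1) ne by (auto simp: A_def)
  qed
  then obtain P where M: "P \<in> A" "\<And>B. B \<in> A \<Longrightarrow> P \<subseteq> B \<Longrightarrow> B = P" by blast
  then have P: "preordering P" "- 1 \<notin> P" "T \<subseteq> P" by (auto simp: A_def)
  note p = preorderingD[OF P(1)]
  have ext: "\<exists>s t. s \<in> P \<and> t \<in> P \<and> - 1 = s + t * c" if c: "c \<notin> P" for c
  proof (rule ccontr)
    assume "\<not> ?thesis"
    then have "- 1 \<notin> {s + t * c | s t. s \<in> P \<and> t \<in> P}" by blast
    then have "{s + t * c | s t. s \<in> P \<and> t \<in> P} \<in> A"
      using preordering_extend(1,2)[OF P(1), of c] P(3) unfolding A_def by blast
    from M(2)[OF this preordering_extend(2)[OF P(1)]] show False using preordering_extend(3)[OF P(1), of c] c by blast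
  qed
  text \<open>If \<open>-1 = s + t c = s' + t' c'\<close>, then \<open>t t' c c' = (1 + s)(1 + s')\<close>.\<close>
  have product: "\<exists>u\<in>P. \<exists>w\<in>P. w * (c * c') = 1 + u" if "c \<notin> P" "c' \<notin> P" for c c'
  proof -
    obtain s t where st: "s \<in> P" "t \<in> P" "- 1 = s + t * c" using ext \<open>c \<notin> P\<close> by blast
    obtain s' t' where st': "s' \<in> P" "t' \<in> P" "- 1 = s' + t' * c'" using ext \<open>c' \<notin> P\<close> by blast
    have "t * c = (s + t * c) - s" "t' * c' = (s' + t' * c') - s'" by simp_all
    then have "t * c = - 1 - s" "t' * c' = - 1 - s'" unfolding st(3)[symmetric] st'(3)[symmetric] .
    then have "(t * c) * (t' * c') = (- 1 - s) * (- 1 - s')" by simp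
    then have "(t * t') * (c * c') = 1 + (s + s' + s * s')" by (simp add: algebra_simps)
    moreover have "s + s' + s * s' \<in> P" "t * t' \<in> P" by (intro p st(1,2) st'(1,2))+
    ultimately show ?thesis by blast
  qed
  have total: "a \<in> P \<or> - a \<in> P" for a
  proof (rule ccontr)
    assume "\<not> ?thesis"
    then obtain u w where uw: "u \<in> P" "w \<in> P" "w * (a * - a) = 1 + u" using product[of a "- a"] by blast
    have "u + w * a\<^sup>2 \<in> P" by (intro p uw(1,2))
    moreover have "- (w * a\<^sup>2) = 1 + u" using uw(3) by (simp add: power2_eq_square)
    then have "u + w * a\<^sup>2 = - 1" by (metis add.commute add_minus_cancel minus_add_distrib minus_minus uminus_add_conv_diff diff_add_cancel add_diff_cancel)
    ultimately show False using P(2) by metis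
  qed
  have ideal: "r * a \<in> P" if "a \<in> P" "- a \<in> P" for a r
    using total[of r]
  proof
    assume "- r \<in> P"
    then have "- r * - a \<in> P" using that p(2) by blast
    then show ?thesis by simp
  qed (use that p(2) in blast)
  have prime: "(a \<in> P \<and> - a \<in> P) \<or> (b \<in> P \<and> - b \<in> P)" if ab: "a * b \<in> P" "- (a * b) \<in> P" for a b
  proof (rule ccontr)
    assume "\<not> ?thesis"
    then obtain c c' where c: "c = a \<or> c = - a" "c \<notin> P" "c' = b \<or> c' = - b" "c' \<notin> P" by blast
    from product[OF c(2,4)] obtain u w where uw: "u \<in> P" "w \<in> P" "w * (c * c') = 1 + u" by blast
    have "c * c' = a * b \<or> c * c' = - (a * b)" using c by auto
    then have cc: "- (c * c') \<in> P" "- (- (c * c')) \<in> P" using ab by auto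
    have "w * - (c * c') + u \<in> P" using ideal[OF cc] uw p(1) by blast
    moreover have "w * - (c * c') + u = - 1" using uw(3) by simp
    ultimately show False using P(2) by metis
  qed
  have "prime_cone P" unfolding prime_cone_def using p(1,2) total prime P(2) by blast
  then show ?thesis using P(3) by blast
qed

text \<open>The ring of admissible squares is a parameter: prime cones require squares of the whole
  ring, the final certificates only those of \<open>polys_in V\<close>.\<close>

inductive_set gen_preordering :: "'a::comm_ring_1 set \<Rightarrow> 'a set \<Rightarrow> 'a set" for R G where
  square: "a \<in> R \<Longrightarrow> a\<^sup>2 \<in> gen_preordering R G"
| add: "s \<in> gen_preordering R G \<Longrightarrow> t \<in> gen_preordering R G \<Longrightarrow> s + t \<in> gen_preordering R G"
| square_mult: "a \<in> R \<Longrightarrow> s \<in> gen_preordering R G \<Longrightarrow> a\<^sup>2 * s \<in> gen_preordering R G"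
| gen_mult: "g \<in> G \<Longrightarrow> s \<in> gen_preordering R G \<Longrightarrow> g * s \<in> gen_preordering R G"

lemma gen_preordering_mult:
  "s \<in> gen_preordering R G \<Longrightarrow> t \<in> gen_preordering R G \<Longrightarrow> s * t \<in> gen_preordering R G"
  by (induction rule: gen_preordering.induct)
    (auto simp: distrib_right mult.assoc intro: gen_preordering.intros)

lemma gen_preordering_gen: "subring_set R \<Longrightarrow> g \<in> G \<Longrightarrow> g \<in> gen_preordering R G"
  using gen_preordering.gen_mult[OF _ gen_preordering.square[OF subring_setD(2)]] by fastforce

lemma gen_preordering_sub:
  assumes "subring_set R" "G \<subseteq> R" shows "gen_preordering R G \<subseteq> R"
proof
  fix x assume "x \<in> gen_preordering R G"
  then show "x \<in> R"
    using assms by (induction) (auto intro!: subring_setD[OF assms(1)] subring_set_power[OF assms(1)])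
qed

lemma preordering_gen: "preordering (gen_preordering UNIV G)"
  unfolding preordering_def using gen_preordering_mult by (auto intro: gen_preordering.intros)

lemma qmod_gen_preordering:
  assumes "G \<subseteq> polys_in V" shows "qmod V (gen_preordering (polys_in V) G)"
  unfolding qmod_def
proof (intro conjI ballI)
  show "gen_preordering (polys_in V) G \<subseteq> polys_in V" by (rule gen_preordering_sub[OF subring_polys_in assms])
  show "1 \<in> gen_preordering (polys_in V) G" using gen_preordering.square[OF polys_in_simps(2)] by fastforce
qed (auto intro: gen_preordering.intros)

text \<open>The substitution of 0 for all variables outside \<open>V\<close>, a retraction of the
  full ring onto \<open>polys_in V\<close>. It fixes generators in \<open>polys_in V\<close> and
  maps squares to squares, so it carries certificates into the small ring.\<close>

definition drop_vars :: "('n, 'm, 'p) xyz_var set \<Rightarrow> ('n, 'm, 'p) xyz_poly \<Rightarrow> ('n, 'm, 'p) xyz_poly" where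
  "drop_vars V q = (\<Sum>t\<in>{t \<in> Poly_Mapping.keys q. Poly_Mapping.keys t \<subseteq> V}. Poly_Mapping.single t (Poly_Mapping.lookup q t))"

lemma lookup_drop_vars:
  "Poly_Mapping.lookup (drop_vars V q) t = (if Poly_Mapping.keys t \<subseteq> V then Poly_Mapping.lookup q t else 0)"
  by (simp add: drop_vars_def lookup_sum lookup_single when_def in_keys_iff sum.delta)

lemma drop_vars_add: "drop_vars V (p + q) = drop_vars V p + drop_vars V q"
  by (rule poly_mapping_eqI) (simp add: lookup_drop_vars lookup_add)

lemma drop_vars_sum: "drop_vars V (sum f I) = (\<Sum>i\<in>I. drop_vars V (f i))"
proof (induction I rule: infinite_finite_induct)
  case empty
  show ?case by (rule poly_mapping_eqI) (simp add: lookup_drop_vars)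
next
  case (infinite I)
  then show ?case by (intro poly_mapping_eqI) (simp add: lookup_drop_vars)
qed (simp add: drop_vars_add)

lemma drop_vars_single:
  "drop_vars V (Poly_Mapping.single t c) = (if Poly_Mapping.keys t \<subseteq> V then Poly_Mapping.single t c else 0)"
  by (rule poly_mapping_eqI) (auto simp: lookup_drop_vars lookup_single when_def)

lemma keys_nat_add: "Poly_Mapping.keys (s + t :: 'v \<Rightarrow>\<^sub>0 nat) = Poly_Mapping.keys s \<union> Poly_Mapping.keys t"
  by (auto simp: in_keys_iff lookup_add)

lemma drop_vars_mult: "drop_vars V (p * q) = drop_vars V p * drop_vars V q"
proof -
  let ?m = "\<lambda>t c. drop_vars V (Poly_Mapping.single t c)"
  have "drop_vars V (p * q) = (\<Sum>s\<in>Poly_Mapping.keys p. \<Sum>t\<in>Poly_Mapping.keys q.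
      ?m s (Poly_Mapping.lookup p s) * ?m t (Poly_Mapping.lookup q t))"
    unfolding times_as_sum[of p q] drop_vars_sum
    by (intro sum.cong refl) (auto simp: drop_vars_single mult_single keys_nat_add)
  also have "\<dots> = drop_vars V p * drop_vars V q"
    unfolding sum_product[symmetric] drop_vars_sum[symmetric] poly_mapping_as_sum[symmetric] ..
  finally show ?thesis .
qed

lemma drop_vars_id: "q \<in> polys_in V \<Longrightarrow> drop_vars V q = q"
  by (rule poly_mapping_eqI) (auto simp: lookup_drop_vars polys_in_iff)

lemma drop_vars_in: "drop_vars V q \<in> polys_in V"
  by (auto simp: polys_in_iff lookup_drop_vars split: if_splits)

lemma drop_vars_gen_preordering:
  assumes "G \<subseteq> polys_in V" "s \<in> gen_preordering UNIV G"
  shows "drop_vars V s \<in> gen_preordering (polys_in V) G"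
  using assms(2)
proof (induction rule: gen_preordering.induct)
  case (square a)
  show ?case unfolding power2_eq_square drop_vars_mult
    using gen_preordering.square[OF drop_vars_in] by (simp add: power2_eq_square)
next
  case (add s t)
  then show ?case unfolding drop_vars_add by (intro gen_preordering.add)
next
  case (square_mult a s)
  then show ?case unfolding power2_eq_square drop_vars_mult
    using gen_preordering.square_mult[OF drop_vars_in] by (simp add: power2_eq_square)
next
  case (gen_mult g s)
  then show ?case unfolding drop_vars_mult
    using assms(1) by (simp add: drop_vars_id subset_iff gen_preordering.gen_mult)
qed

text \<open>If -1 were not in the preordering with \<open>- b\<close> adjoined, a prime cone would
  contain the generators and \<open>- b\<close>, and a real point with these finitely many signs
  would contradict \<open>pos\<close>.\<close>

lemma positivstellensatz:
  fixes G :: "('n::finite, 'm::finite, 'p::finite) xyz_poly set"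
  assumes "finite G" "G \<subseteq> polys_in V" "b \<in> polys_in V"
    and pos: "\<And>a. (\<And>g. g \<in> G \<Longrightarrow> 0 \<le> poly_eval g a) \<Longrightarrow> 0 < poly_eval b a"
  shows "\<exists>p q. p \<in> gen_preordering (polys_in V) G \<and> q \<in> gen_preordering (polys_in V) G \<and> p * b = 1 + q"
proof -
  let ?T = "gen_preordering UNIV G"
  let ?E = "{s + t * (- b) | s t. s \<in> ?T \<and> t \<in> ?T}"
  have "- 1 \<in> ?E"
  proof (rule ccontr)
    assume "- 1 \<notin> ?E"
    then obtain P where P: "prime_cone P" "?E \<subseteq> P" using prime_cone_exists preordering_extend(1)[OF preordering_gen] by blast
    have "insert (- b) G \<subseteq> P"
      using preordering_extend(2,3)[OF preordering_gen[of G], of "- b"] gen_preordering_gen[OF subring_set_UNIV] P(2) by blast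
    moreover obtain a where "\<forall>f\<in>insert (- b) G. f \<in> P \<longleftrightarrow> 0 \<le> poly_eval f a"
      using prime_cone_realizable[OF P(1)] assms(1) unfolding realizable_def by blast
    ultimately have "\<forall>g\<in>G. 0 \<le> poly_eval g a" "0 \<le> poly_eval (- b) a" by blast+
    with pos[of a] show False by simp
  qed
  then obtain s t where st: "s \<in> ?T" "t \<in> ?T" "- 1 = s + t * (- b)" by blast
  have "t * b = s - (s + t * (- b))" by simp
  also have "\<dots> = 1 + s" unfolding st(3)[symmetric] by simp
  finally have "drop_vars V (t * b) = drop_vars V (1 + s)" by simp
  then have "drop_vars V t * b = 1 + drop_vars V s"
    unfolding drop_vars_mult drop_vars_add drop_vars_id[OF assms(3)] drop_vars_id[OF polys_in_simps(2)] .
  then show ?thesis using drop_vars_gen_preordering[OF assms(2)] st(1,2) by blast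
qed

text \<open>
  Woermann's argument: \<open>T' = T + T b\<close> is archimedean for \<open>b = N - \<parallel>x\<parallel>\<^sup>2\<close>, and \<open>p b = 1 + q\<close> gives
  \<open>(1 + q) T' \<subseteq> T\<close>; this bounds first \<open>q\<close> and then \<open>\<parallel>x\<parallel>\<^sup>2\<close> modulo \<open>T\<close>.
\<close>

lemma arch_gen_preordering:
  fixes G :: "('n::finite, 'm::finite, 'p::finite) xyz_poly set"
  assumes "finite G" "G \<subseteq> polys_in V" "finite V"
    and bounded: "\<And>a. (\<And>g. g \<in> G \<Longrightarrow> 0 \<le> poly_eval g a) \<Longrightarrow> (\<Sum>v\<in>V. (a v)\<^sup>2) < N"
  shows "arch V (gen_preordering (polys_in V) G)"
proof -
  let ?T = "gen_preordering (polys_in V) G"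
  define w where "w = (\<Sum>v\<in>V. (Var v)\<^sup>2 :: ('n, 'm, 'p) xyz_poly)"
  \<comment> \<open>Nonnegativity is needed at the end, where a member of the preordering is
    multiplied by \<open>M\<close>.\<close>
  define M where "M = max N 0"
  define b where "b = Const M - w"
  have eval_w: "poly_eval w a = (\<Sum>v\<in>V. (a v)\<^sup>2)" for a by (simp add: w_def poly_eval_sum)
  have w: "w \<in> polys_in V" unfolding w_def
    by (intro subring_set_sum[OF subring_polys_in] polys_in_simps(7) Var_in)
  then have b: "b \<in> polys_in V" unfolding b_def by (intro polys_in_simps Const_in)
  have "0 < poly_eval b a" if "\<And>g. g \<in> G \<Longrightarrow> 0 \<le> poly_eval g a" for a
    using bounded[OF that] by (simp add: b_def eval_w M_def)
  from positivstellensatz[OF assms(1,2) b this] obtain p q where pq: "p \<in> ?T" "q \<in> ?T" "p * b = 1 + q" by blast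
  have Q: "qmod V ?T" by (rule qmod_gen_preordering[OF assms(2)])
  note qT = qmodD[OF Q] and mult = gen_preordering_mult
  define T' where "T' = {s + t * b | s t. s \<in> ?T \<and> t \<in> ?T}"
  have T'I: "x \<in> T'" if "x = s + t * b" "s \<in> ?T" "t \<in> ?T" for x s t using that T'_def by blast
  have Q': "qmod V T'"
    unfolding qmod_def
  proof (intro conjI ballI)
    show "T' \<subseteq> polys_in V" unfolding T'_def using qT(1) b by (auto intro!: polys_in_simps(3,5))
    show "1 \<in> T'" by (rule T'I[of 1 1 0]) (simp_all add: qT(2,6))
  next
    fix x y assume "x \<in> T'" "y \<in> T'"
    then obtain s t s' t' where *: "x = s + t * b" "y = s' + t' * b" "s \<in> ?T" "t \<in> ?T" "s' \<in> ?T" "t' \<in> ?T"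
      unfolding T'_def by blast
    have "x + y = (s + s') + (t + t') * b" unfolding *(1,2) by (simp add: algebra_simps)
    then show "x + y \<in> T'" by (rule T'I) (intro qT(3) *)+
  next
    fix a x assume a: "a \<in> polys_in V" and "x \<in> T'"
    then obtain s t where *: "x = s + t * b" "s \<in> ?T" "t \<in> ?T" unfolding T'_def by blast
    have "a\<^sup>2 * x = a\<^sup>2 * s + (a\<^sup>2 * t) * b" unfolding *(1) by (simp add: algebra_simps)
    then show "a\<^sup>2 * x \<in> T'" by (rule T'I) (intro qT(4) a *)+
  qed
  have "b \<in> T'" by (rule T'I[of b 0 1]) (simp_all add: qT(2,6))
  then have "arch V T'" unfolding b_def w_def by (rule arch_from_norm[OF Q' assms(3)])
  then obtain n where n: "Const n - q \<in> T'" using qT(1)[OF pq(2)] unfolding arch_def by blast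
  \<comment> \<open>Since 1 + q = p b, the summand t b becomes b^2 p t, free of the adjoined
    \<open>b\<close> except in a square.\<close>
  have reduce: "(1 + q) * x \<in> ?T" if "x \<in> T'" for x
  proof -
    from \<open>x \<in> T'\<close> obtain s t where *: "x = s + t * b" "s \<in> ?T" "t \<in> ?T" unfolding T'_def by blast
    have "(1 + q) * x = (1 + q) * s + b\<^sup>2 * (p * t)"
      unfolding *(1) pq(3)[symmetric] by (simp add: algebra_simps power2_eq_square)
    moreover have "(1 + q) * s + b\<^sup>2 * (p * t) \<in> ?T" by (intro qT(2,3,4) mult * pq b)
    ultimately show ?thesis by simp
  qed
  \<comment> \<open>From completing the square: (1 + q)(n - q) + (n/2 - q)^2 = n + n^2/4 -
    q.\<close>
  define m where "m = n + n\<^sup>2 / 4"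
  have mq: "Const m - q \<in> ?T"
  proof -
    have "(1 + q) * (Const n - q) + (Const (n/2) - q)\<^sup>2 \<in> ?T"
      by (intro qT(3) reduce n qT(5) polys_in_simps Const_in qT(1)[OF pq(2)])
    moreover have "(1 + q) * (Const n - q) + (Const (n/2) - q)\<^sup>2 = Const m - q"
    proof -
      have h: "Const n = Const (n/2) * (2 :: ('n, 'm, 'p) xyz_poly)"
        by (simp flip: Const_numeral Const_simps(4))
      have m: "Const m = Const (n/2) * 2 + (Const (n/2))\<^sup>2"
        by (simp add: m_def power_divide flip: Const_numeral Const_simps(3,4,7))
      show ?thesis unfolding m h by (simp add: algebra_simps power2_eq_square)
    qed
    ultimately show ?thesis by simp
  qed
  have wT: "w \<in> ?T"
  proof -
    have "(\<Sum>v\<in>U. (Var v)\<^sup>2) \<in> ?T" if "finite U" "U \<subseteq> V" for U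
      using that by (induction U) (auto simp: qT(6) intro!: qT(3,5) Var_in)
    then show ?thesis unfolding w_def using assms(3) by blast
  qed
  \<comment> \<open>Expanding (1 + q)(M - w), the term q w cancels the mixed product, and the bound
    on \<open>q\<close> removes M q.\<close>
  have "p * b\<^sup>2 + q * w + Const M * (Const m - q) \<in> ?T"
    using wT pq(1,2) mq b by (intro qT(3,8) mult qT(5)) (simp_all add: M_def)
  moreover have "p * b\<^sup>2 = (1 + q) * b" using pq(3) by (simp add: power2_eq_square flip: mult.assoc)
  then have "p * b\<^sup>2 + q * w + Const M * (Const m - q) = Const (M + M * m) - w"
    by (simp add: b_def Const_simps(3,4) algebra_simps)
  ultimately have "Const (M + M * m) - (\<Sum>v\<in>V. (Var v)\<^sup>2) \<in> ?T" unfolding w_def by simp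
  then show ?thesis by (rule arch_from_norm[OF Q assms(3)])
qed

lemma poly_preordering_term:
  assumes "finite I" "K \<subseteq> I" "s \<in> sos R"
  shows "s * (\<Prod>j\<in>K. g j) \<in> poly_preordering R I g"
proof -
  define \<sigma> where "\<sigma> J = (if J = K then s else 0)" for J
  have "(\<Sum>J\<in>Pow I. \<sigma> J * (\<Prod>j\<in>J. g j)) = (\<Sum>J\<in>Pow I. if J = K then s * (\<Prod>j\<in>J. g j) else 0)"
    by (intro sum.cong) (auto simp: \<sigma>_def)
  also have "\<dots> = s * (\<Prod>j\<in>K. g j)" using assms by (simp add: sum.delta)
  finally have "s * (\<Prod>j\<in>K. g j) = (\<Sum>J\<in>Pow I. \<sigma> J * (\<Prod>j\<in>J. g j))" by simp
  moreover have "\<forall>J\<in>Pow I. \<sigma> J \<in> sos R" using assms by (simp add: \<sigma>_def sos_0)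
  ultimately show ?thesis unfolding poly_preordering_def by blast
qed

lemma poly_preordering_add:
  assumes "s \<in> poly_preordering R I g" "t \<in> poly_preordering R I g"
  shows "s + t \<in> poly_preordering R I g"
proof -
  obtain \<sigma> \<tau> where *: "s = (\<Sum>J\<in>Pow I. \<sigma> J * (\<Prod>j\<in>J. g j))" "\<forall>J\<in>Pow I. \<sigma> J \<in> sos R"
    "t = (\<Sum>J\<in>Pow I. \<tau> J * (\<Prod>j\<in>J. g j))" "\<forall>J\<in>Pow I. \<tau> J \<in> sos R"
    using assms unfolding poly_preordering_def by blast
  have "s + t = (\<Sum>J\<in>Pow I. (\<sigma> J + \<tau> J) * (\<Prod>j\<in>J. g j))" unfolding *(1,3) by (simp add: distrib_right sum.distrib)
  moreover have "\<forall>J\<in>Pow I. \<sigma> J + \<tau> J \<in> sos R" using * sos_add by blast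
  ultimately show ?thesis unfolding poly_preordering_def by (intro CollectI exI[of _ "\<lambda>J. \<sigma> J + \<tau> J"]) simp
qed

text \<open>Multiplying a term by a generator either enlarges its index set or, if the generator is
  already present, produces a square that the sum of squares absorbs.\<close>

lemma gen_preordering_sub_poly_preordering:
  assumes I: "finite I" and R: "subring_set R" and g: "\<And>j. j \<in> I \<Longrightarrow> g j \<in> R"
  shows "gen_preordering R (g ` I) \<subseteq> poly_preordering R I g"
proof
  note term_in = poly_preordering_term[OF I]
  have zero: "0 \<in> poly_preordering R I g" using term_in[of "{}" 0] sos_0 by auto
  have map_terms: "c * s \<in> poly_preordering R I g"
    if s: "s \<in> poly_preordering R I g"
      and c: "\<And>r J. r \<in> sos R \<Longrightarrow> J \<subseteq> I \<Longrightarrow> c * (r * (\<Prod>j\<in>J. g j)) \<in> poly_preordering R I g" for c s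
  proof -
    obtain \<sigma> where \<sigma>: "s = (\<Sum>J\<in>Pow I. \<sigma> J * (\<Prod>j\<in>J. g j))" "\<forall>J\<in>Pow I. \<sigma> J \<in> sos R"
      using s unfolding poly_preordering_def by blast
    have "(\<Sum>J\<in>A. c * (\<sigma> J * (\<Prod>j\<in>J. g j))) \<in> poly_preordering R I g" if "finite A" "A \<subseteq> Pow I" for A
      using that
    proof (induction A)
      case (insert J A)
      then show ?case using poly_preordering_add[OF c[of "\<sigma> J" J]] \<sigma>(2) by simp
    qed (simp add: zero)
    then show ?thesis unfolding \<sigma>(1) sum_distrib_left using I by blast
  qed
  fix x assume "x \<in> gen_preordering R (g ` I)"
  then show "x \<in> poly_preordering R I g"
  proof (induction rule: gen_preordering.induct)
    case (square a)
    then show ?case using term_in[of "{}" "a\<^sup>2"] sos_square by auto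
  next
    case (add s t)
    then show ?case by (intro poly_preordering_add)
  next
    case (square_mult a s)
    show ?case
    proof (rule map_terms[OF square_mult.IH])
      fix r J assume "r \<in> sos R" "J \<subseteq> I"
      then show "a\<^sup>2 * (r * (\<Prod>j\<in>J. g j)) \<in> poly_preordering R I g"
        using term_in[of J "a\<^sup>2 * r"] sos_square_mult[OF R square_mult.hyps(1)] by (simp add: mult.assoc)
    qed
  next
    case (gen_mult c s)
    then obtain i where i: "i \<in> I" "c = g i" by blast
    show ?case
    proof (rule map_terms[OF gen_mult.IH])
      fix r J assume r: "r \<in> sos R" and J: "J \<subseteq> I"
      have "finite J" using J I finite_subset by blast
      show "c * (r * (\<Prod>j\<in>J. g j)) \<in> poly_preordering R I g"
      proof (cases "i \<in> J")
        case True
        have "c * (r * (\<Prod>j\<in>J. g j)) = ((g i)\<^sup>2 * r) * (\<Prod>j\<in>J - {i}. g j)"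
          unfolding prod.remove[OF \<open>finite J\<close> True] i(2) by (simp add: power2_eq_square mult_ac)
        moreover have "J - {i} \<subseteq> I" "(g i)\<^sup>2 * r \<in> sos R" using J sos_square_mult[OF R g[OF i(1)] r] by auto
        ultimately show ?thesis using term_in by metis
      next
        case False
        then have "c * (r * (\<Prod>j\<in>J. g j)) = r * (\<Prod>j\<in>insert i J. g j)"
          using \<open>finite J\<close> i(2) by (simp add: mult_ac)
        moreover have "insert i J \<subseteq> I" using J i by simp
        ultimately show ?thesis using term_in r by metis
      qed
    qed
  qed
qed

theorem schmuedgen:
  fixes g :: "'j \<Rightarrow> ('n::finite, 'm::finite, 'p::finite) xyz_poly"
  assumes "finite I" "finite V" and g: "\<And>j. j \<in> I \<Longrightarrow> g j \<in> polys_in V" and f: "f \<in> polys_in V"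
    and bounded: "\<And>a. (\<And>j. j \<in> I \<Longrightarrow> 0 \<le> poly_eval (g j) a) \<Longrightarrow> (\<Sum>v\<in>V. (a v)\<^sup>2) < N"
    and pos: "\<And>a. (\<And>j. j \<in> I \<Longrightarrow> 0 \<le> poly_eval (g j) a) \<Longrightarrow> 0 < poly_eval f a"
  shows "f \<in> poly_preordering (polys_in V) I g"
proof -
  have G: "finite (g ` I)" "g ` I \<subseteq> polys_in V" using assms(1) g by auto
  have "f \<in> gen_preordering (polys_in V) (g ` I)"
  proof (rule archimedean_positivstellensatz[OF qmod_gen_preordering[OF G(2)] _ f])
    show "arch V (gen_preordering (polys_in V) (g ` I))"
      by (rule arch_gen_preordering[OF G assms(2)]) (use bounded in blast)
    fix a assume "\<And>q. q \<in> gen_preordering (polys_in V) (g ` I) \<Longrightarrow> 0 \<le> poly_eval q a"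
    then show "0 < poly_eval f a" using gen_preordering_gen[OF subring_polys_in] by (intro pos) blast
  qed
  then show ?thesis using gen_preordering_sub_poly_preordering[OF assms(1) subring_polys_in, of g V] g by blast
qed

theorem putinar:
  fixes g :: "'j \<Rightarrow> ('n, 'm, 'p) xyz_poly"
  assumes "finite I" "finite V" and g: "\<And>j. j \<in> I \<Longrightarrow> g j \<in> polys_in V" and f: "f \<in> polys_in V"
    and N: "Const N - (\<Sum>v\<in>V. (Var v)\<^sup>2) \<in> quadratic_module (polys_in V) I g"
    and pos: "\<And>a. (\<And>j. j \<in> I \<Longrightarrow> 0 \<le> poly_eval (g j) a) \<Longrightarrow> 0 < poly_eval f a"
  shows "f \<in> quadratic_module (polys_in V) I g"
proof -
  let ?R = "polys_in V"
  let ?Q = "quadratic_module ?R I g"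
  have QI: "x \<in> ?Q" if "x = s + (\<Sum>j\<in>I. \<sigma> j * g j)" "s \<in> sos ?R" "\<And>j. j \<in> I \<Longrightarrow> \<sigma> j \<in> sos ?R" for x s \<sigma>
    using that unfolding quadratic_module_def by blast
  have one: "1 \<in> sos ?R" by (metis sos_square polys_in_simps(2) one_power2)
  have Q: "qmod V ?Q"
    unfolding qmod_def
  proof (intro conjI ballI)
    show "?Q \<subseteq> ?R"
      unfolding quadratic_module_def using sos_in[OF subring_polys_in] g
      by (auto intro!: polys_in_simps(3,5) subring_set_sum[OF subring_polys_in])
    show "1 \<in> ?Q" by (rule QI[of 1 1 "\<lambda>_. 0"]) (simp_all add: one sos_0)
  next
    fix x y assume "x \<in> ?Q" "y \<in> ?Q"
    then obtain s \<sigma> t \<tau> where *: "x = s + (\<Sum>j\<in>I. \<sigma> j * g j)" "s \<in> sos ?R" "\<forall>j\<in>I. \<sigma> j \<in> sos ?R"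
      "y = t + (\<Sum>j\<in>I. \<tau> j * g j)" "t \<in> sos ?R" "\<forall>j\<in>I. \<tau> j \<in> sos ?R" unfolding quadratic_module_def by blast
    have "x + y = (s + t) + (\<Sum>j\<in>I. (\<sigma> j + \<tau> j) * g j)" unfolding *(1,4) by (simp add: distrib_right sum.distrib algebra_simps)
    then show "x + y \<in> ?Q" by (rule QI) (use * sos_add in blast)+
  next
    fix a x assume a: "a \<in> ?R" and "x \<in> ?Q"
    then obtain s \<sigma> where *: "x = s + (\<Sum>j\<in>I. \<sigma> j * g j)" "s \<in> sos ?R" "\<forall>j\<in>I. \<sigma> j \<in> sos ?R"
      unfolding quadratic_module_def by blast
    have "a\<^sup>2 * x = a\<^sup>2 * s + (\<Sum>j\<in>I. (a\<^sup>2 * \<sigma> j) * g j)" unfolding *(1) by (simp add: distrib_left sum_distrib_left mult.assoc)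
    then show "a\<^sup>2 * x \<in> ?Q" by (rule QI) (use * sos_square_mult[OF subring_polys_in a] in blast)+
  qed
  have gQ: "g i \<in> ?Q" if i: "i \<in> I" for i
  proof (rule QI[of _ 0 "\<lambda>j. if j = i then 1 else 0"])
    have "(\<Sum>j\<in>I. (if j = i then 1 else 0) * g j) = (\<Sum>j\<in>I. if j = i then g j else 0)" by (rule sum.cong) auto
    then show "g i = 0 + (\<Sum>j\<in>I. (if j = i then 1 else 0) * g j)" using i assms(1) by (simp add: sum.delta)
  qed (simp_all add: one sos_0)
  show ?thesis
  proof (rule archimedean_positivstellensatz[OF Q arch_from_norm[OF Q assms(2) N] f])
    fix a assume "\<And>q. q \<in> ?Q \<Longrightarrow> 0 \<le> poly_eval q a"
    then show "0 < poly_eval f a" using gQ by (intro pos) blast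
  qed
qed

section \<open>Approximation by polynomials\<close>

text \<open>Sets of coordinate vectors are lifted to assignments of all variables, so that
  conditions on different groups of variables can be intersected; \<open>extend\<close> goes back,
  with 0 elsewhere.\<close>

definition cylinder :: "('i::finite \<Rightarrow> ('n, 'm, 'p) xyz_var) \<Rightarrow> (real ^ 'i) set \<Rightarrow> (('n, 'm, 'p) xyz_var \<Rightarrow> real) set" where
  "cylinder c K = {a. (\<chi> i. a (c i)) \<in> K}"

definition extend :: "('i::finite \<Rightarrow> ('n, 'm, 'p) xyz_var) \<Rightarrow> real ^ 'i \<Rightarrow> ('n, 'm, 'p) xyz_var \<Rightarrow> real" where
  "extend c x v = (if v \<in> range c then x $ inv_into UNIV c v else 0)"

lemma poly_eval_extend:
  assumes "inj c" "q \<in> polys_in (range c)"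
  shows "poly_eval q (extend c (\<chi> i. a (c i))) = poly_eval q a"
  using assms(2) by (rule poly_eval_cong) (auto simp: extend_def inv_f_f[OF assms(1)])

lemma continuous_on_poly_eval:
  assumes "\<And>v. continuous_on S (\<lambda>x. F x v)"
  shows "continuous_on S (\<lambda>x. poly_eval q (F x))"
proof -
  have "q \<in> polys_in UNIV" by (simp add: polys_in_def)
  then show ?thesis
    by (induction rule: polys_in_induct) (auto intro!: continuous_intros assms)
qed

lemma continuous_on_extend: "continuous_on S (\<lambda>x. extend c x v)"
  by (cases "v \<in> range c") (auto simp: extend_def intro!: continuous_intros)

lemma bounded_cylinder:
  assumes "inj c" "compact K" "q \<in> polys_in (range c)"
  shows "\<exists>B. \<forall>a\<in>cylinder c K. \<bar>poly_eval q a\<bar> \<le> B"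
proof -
  have "compact ((\<lambda>x. poly_eval q (extend c x)) ` K)"
    by (intro compact_continuous_image assms continuous_on_poly_eval continuous_on_extend)
  from compact_imp_bounded[OF this] obtain B where "\<And>x. x \<in> K \<Longrightarrow> \<bar>poly_eval q (extend c x)\<bar> \<le> B"
    unfolding bounded_iff by auto
  then have "\<bar>poly_eval q a\<bar> \<le> B" if "a \<in> cylinder c K" for a
    using that poly_eval_extend[OF assms(1,3), of a] unfolding cylinder_def by (metis mem_Collect_eq)
  then show ?thesis by blast
qed

lemma real_polynomial_function_as_poly:
  fixes p :: "real ^ 'i::finite \<Rightarrow> real"
  assumes "real_polynomial_function p"
  shows "\<exists>w\<in>polys_in (range c). \<forall>a. poly_eval w a = p (\<chi> i. a (c i))"
  using assms
proof (induction rule: real_polynomial_function.induct)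
  case (linear f)
  interpret f: bounded_linear f by fact
  have f: "f x = (\<Sum>i\<in>UNIV. f (axis i 1) * x $ i)" for x
  proof -
    have "f x = f (\<Sum>i\<in>UNIV. x $ i *\<^sub>R axis i 1)" using basis_expansion[of x] by (simp add: scalar_mult_eq_scaleR)
    then show ?thesis by (simp add: f.sum f.scaleR mult.commute)
  qed
  show ?case
  proof (intro bexI allI)
    show "(\<Sum>i\<in>UNIV. Const (f (axis i 1)) * Var (c i)) \<in> polys_in (range c)"
      by (intro subring_set_sum[OF subring_polys_in] polys_in_simps(5) Const_in Var_in) simp
    show "poly_eval (\<Sum>i\<in>UNIV. Const (f (axis i 1)) * Var (c i)) a = f (\<chi> i. a (c i))" for a
      by (subst f) (simp add: poly_eval_sum)
  qed
next
  case (const r)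
  show ?case by (rule bexI[OF _ Const_in]) simp
next
  case (add f g)
  then obtain w w' where "w \<in> polys_in (range c)" "w' \<in> polys_in (range c)"
    "\<forall>a. poly_eval w a = f (\<chi> i. a (c i))" "\<forall>a. poly_eval w' a = g (\<chi> i. a (c i))" by blast
  then show ?case by (intro bexI[of _ "w + w'"]) (auto intro: polys_in_simps)
next
  case (mult f g)
  then obtain w w' where "w \<in> polys_in (range c)" "w' \<in> polys_in (range c)"
    "\<forall>a. poly_eval w a = f (\<chi> i. a (c i))" "\<forall>a. poly_eval w' a = g (\<chi> i. a (c i))" by blast
  then show ?case by (intro bexI[of _ "w * w'"]) (auto intro: polys_in_simps)
qed

lemma approximate_cylinder:
  fixes F :: "real ^ 'i::finite \<Rightarrow> real"
  assumes "compact K" "continuous_on K F" "0 < e"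
  shows "\<exists>w\<in>polys_in (range c). \<forall>a\<in>cylinder c K. \<bar>F (\<chi> i. a (c i)) - poly_eval w a\<bar> < e"
proof -
  obtain p where p: "real_polynomial_function p" "\<And>x. x \<in> K \<Longrightarrow> \<bar>F x - p x\<bar> < e"
    using Stone_Weierstrass_real_polynomial_function[OF assms] by blast
  obtain w where "w \<in> polys_in (range c)" "\<forall>a. poly_eval w a = p (\<chi> i. a (c i))"
    using real_polynomial_function_as_poly[OF p(1)] by blast
  with p(2) show ?thesis unfolding cylinder_def by (intro bexI[of _ w]) auto
qed

definition pos_on :: "('n, 'm, 'p) xyz_var set \<Rightarrow> (('n, 'm, 'p) xyz_var \<Rightarrow> real) set \<Rightarrow> ('n, 'm, 'p) xyz_poly set" where
  "pos_on V K = {u \<in> polys_in V. \<forall>a\<in>K. 0 < poly_eval u a}"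

definition sqrt_approx :: "('n, 'm, 'p) xyz_var set \<Rightarrow> (('n, 'm, 'p) xyz_var \<Rightarrow> real) set \<Rightarrow> bool" where
  "sqrt_approx V K \<longleftrightarrow> (\<forall>u\<in>pos_on V K. \<forall>e>0. \<exists>w\<in>polys_in V. \<forall>a\<in>K. \<bar>poly_eval (u - w\<^sup>2) a\<bar> \<le> e)"

definition bounded_on :: "('n, 'm, 'p) xyz_var set \<Rightarrow> (('n, 'm, 'p) xyz_var \<Rightarrow> real) set \<Rightarrow> bool" where
  "bounded_on V K \<longleftrightarrow> (\<forall>q\<in>polys_in V. \<exists>B. \<forall>a\<in>K. \<bar>poly_eval q a\<bar> \<le> B)"

lemma sqrt_approx_cylinder:
  assumes c: "inj c" and K: "compact K"
  shows "sqrt_approx (range c) (cylinder c K)"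
  unfolding sqrt_approx_def
proof (intro ballI allI impI)
  fix u and e :: real assume u: "u \<in> pos_on (range c) (cylinder c K)" and e: "0 < e"
  then have uc: "u \<in> polys_in (range c)" by (simp add: pos_on_def)
  obtain B where B: "\<And>a. a \<in> cylinder c K \<Longrightarrow> \<bar>poly_eval u a\<bar> \<le> B" using bounded_cylinder[OF c K uc] by blast
  define M where "M = sqrt \<bar>B\<bar>"
  have M: "0 \<le> M" by (simp add: M_def)
  \<comment> \<open>With d \<le> 1 the sum of the square root and its approximation is at most 2M +
    1 in absolute value, so u - w^2, the product of difference and sum, stays within e.\<close>
  define d where "d = min 1 (e / (2 * M + 1))"
  have d: "0 < d" "d \<le> 1" using e M by (auto simp: d_def)
  have "d \<le> e / (2 * M + 1)" by (simp add: d_def)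
  moreover have "0 < 2 * M + 1" using M by simp
  ultimately have d3: "d * (2 * M + 1) \<le> e" by (simp only: pos_le_divide_eq)
  define F where "F x = sqrt (poly_eval u (extend c x))" for x
  have "continuous_on K F" unfolding F_def
    by (intro continuous_intros continuous_on_poly_eval continuous_on_extend)
  from approximate_cylinder[OF K this d(1)] obtain w where w: "w \<in> polys_in (range c)"
    "\<And>a. a \<in> cylinder c K \<Longrightarrow> \<bar>F (\<chi> i. a (c i)) - poly_eval w a\<bar> < d" by blast
  have "\<bar>poly_eval (u - w\<^sup>2) a\<bar> \<le> e" if a: "a \<in> cylinder c K" for a
  proof -
    let ?s = "sqrt (poly_eval u a)"
    have u0: "0 < poly_eval u a" using u a by (simp add: pos_on_def)
    have s: "F (\<chi> i. a (c i)) = ?s" by (simp add: F_def poly_eval_extend[OF c uc])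
    have sM: "0 \<le> ?s" "?s \<le> M" unfolding M_def using u0 B[OF a] by auto
    have sw: "\<bar>?s - poly_eval w a\<bar> < d" using w(2)[OF a] s by simp
    then have "\<bar>?s + poly_eval w a\<bar> \<le> 2 * M + 1" using sM d(2) by linarith
    then have "\<bar>?s - poly_eval w a\<bar> * \<bar>?s + poly_eval w a\<bar> \<le> d * (2 * M + 1)"
      using sw by (intro mult_mono) auto
    moreover have "poly_eval (u - w\<^sup>2) a = (?s - poly_eval w a) * (?s + poly_eval w a)"
      using u0 by (simp add: algebra_simps power2_eq_square)
    ultimately show ?thesis using d3 by (simp add: abs_mult)
  qed
  then show "\<exists>w\<in>polys_in (range c). \<forall>a\<in>cylinder c K. \<bar>poly_eval (u - w\<^sup>2) a\<bar> \<le> e" using w(1) by blast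
qed

section \<open>Positive polynomials on a product\<close>

text \<open>The certificates sought on a product: squares may mix the two groups of variables,
  positive polynomials may not.\<close>

definition sum_cone :: "('n, 'm, 'p) xyz_var set \<Rightarrow> (('n, 'm, 'p) xyz_var \<Rightarrow> real) set \<Rightarrow>
    ('n, 'm, 'p) xyz_var set \<Rightarrow> (('n, 'm, 'p) xyz_var \<Rightarrow> real) set \<Rightarrow> ('n, 'm, 'p) xyz_poly set" where
  "sum_cone V K W L = {s + u + w | s u w. s \<in> sos (polys_in (V \<union> W)) \<and> u \<in> pos_on V K \<and> w \<in> pos_on W L}"

lemma pos_on_add: "u \<in> pos_on V K \<Longrightarrow> w \<in> pos_on V K \<Longrightarrow> u + w \<in> pos_on V K"
  by (auto simp: pos_on_def intro: polys_in_simps add_pos_pos)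

lemma sum_cone_commute: "sum_cone V K W L = sum_cone W L V K"
proof -
  have "sum_cone V K W L \<subseteq> sum_cone W L V K" for V W :: "('a, 'b, 'c) xyz_var set" and K L
  proof
    fix x assume "x \<in> sum_cone V K W L"
    then obtain s u w where "x = s + u + w" "s \<in> sos (polys_in (V \<union> W))" "u \<in> pos_on V K" "w \<in> pos_on W L"
      unfolding sum_cone_def by blast
    moreover from this have "x = s + w + u" by (simp add: algebra_simps)
    ultimately show "x \<in> sum_cone W L V K" unfolding sum_cone_def Un_commute[of V W] by blast
  qed
  then show ?thesis by blast
qed

lemma sum_cone_add:
  assumes "x \<in> sum_cone V K W L" "y \<in> sum_cone V K W L" shows "x + y \<in> sum_cone V K W L"
proof -
  obtain s u w s' u' w' where *: "x = s + u + w" "s \<in> sos (polys_in (V \<union> W))" "u \<in> pos_on V K" "w \<in> pos_on W L"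
    "y = s' + u' + w'" "s' \<in> sos (polys_in (V \<union> W))" "u' \<in> pos_on V K" "w' \<in> pos_on W L"
    using assms unfolding sum_cone_def by blast
  have "x + y = (s + s') + (u + u') + (w + w')" unfolding *(1,5) by (simp add: algebra_simps)
  then show ?thesis unfolding sum_cone_def using * sos_add pos_on_add by blast
qed

lemma sum_cone_sos_add:
  assumes "t \<in> sos (polys_in (V \<union> W))" "x \<in> sum_cone V K W L" shows "t + x \<in> sum_cone V K W L"
proof -
  obtain s u w where *: "x = s + u + w" "s \<in> sos (polys_in (V \<union> W))" "u \<in> pos_on V K" "w \<in> pos_on W L"
    using assms unfolding sum_cone_def by blast
  have "t + x = (t + s) + u + w" unfolding *(1) by (simp add: algebra_simps)
  then show ?thesis unfolding sum_cone_def using * sos_add[OF assms(1)] by blast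
qed

inductive_set tensors :: "('n, 'm, 'p) xyz_var set \<Rightarrow> ('n, 'm, 'p) xyz_var set \<Rightarrow> ('n, 'm, 'p) xyz_poly set" for V W where
  prod: "x \<in> polys_in V \<Longrightarrow> y \<in> polys_in W \<Longrightarrow> x * y \<in> tensors V W"
| add: "r \<in> tensors V W \<Longrightarrow> r' \<in> tensors V W \<Longrightarrow> r + r' \<in> tensors V W"

lemma tensors_mult:
  assumes "r \<in> tensors V W" "r' \<in> tensors V W" shows "r * r' \<in> tensors V W"
  using assms(1)
proof (induction rule: tensors.induct)
  case (prod x y)
  from assms(2) show ?case
  proof (induction rule: tensors.induct)
    case (prod x' y')
    have "x * y * (x' * y') = (x * x') * (y * y')" by (simp add: mult_ac)
    also have "\<dots> \<in> tensors V W" using prod \<open>x \<in> polys_in V\<close> \<open>y \<in> polys_in W\<close> by (intro tensors.prod polys_in_simps)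
    finally show ?case .
  qed (simp add: distrib_left tensors.add)
qed (simp add: distrib_right tensors.add)

lemma polys_in_Un_tensors: "r \<in> polys_in (V \<union> W) \<Longrightarrow> r \<in> tensors V W"
proof (induction rule: polys_in_induct)
  case (Const c)
  show ?case using tensors.prod[OF Const_in[of c V] polys_in_simps(2)] by simp
next
  case (Var v)
  then show ?case
    using tensors.prod[OF Var_in[of v V] polys_in_simps(2)] tensors.prod[OF polys_in_simps(2) Var_in[of v W]] by auto
next
  case (add p q)
  then show ?case by (intro tensors.add)
next
  case (mult p q)
  then show ?case by (intro tensors_mult)
qed

text \<open>
  For a product \<open>r = x y\<close> this is the identity
  \<open>2 d x y = (d x / t + t y)\<^sup>2 - (d x / t)\<^sup>2 - (t y)\<^sup>2\<close> with \<open>t\<^sup>2 = e\<close>.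
\<close>
lemma small_multiple_in_sum_cone:
  assumes bdd: "bounded_on V K" "bounded_on W L" and r: "r \<in> polys_in (V \<union> W)"
  shows "\<exists>c>0. \<forall>e>0. \<forall>d\<in>polys_in V. (\<forall>a\<in>K. \<bar>poly_eval d a\<bar> \<le> e) \<longrightarrow> Const (e * c) + d * r \<in> sum_cone V K W L"
  using polys_in_Un_tensors[OF r]
proof (induction rule: tensors.induct)
  case (prod x y)
  obtain A where A: "\<And>a. a \<in> K \<Longrightarrow> \<bar>poly_eval x a\<bar> \<le> A" using bdd(1) prod(1) unfolding bounded_on_def by blast
  obtain B where B: "\<And>a. a \<in> L \<Longrightarrow> \<bar>poly_eval y a\<bar> \<le> B" using bdd(2) prod(2) unfolding bounded_on_def by blast
  \<comment> \<open>The halves e (A^2 + 1)/2 and e (B^2 + 1)/2 of the constant dominate the two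
    subtracted squares, and the summands 1 make the domination strict.\<close>
  define c where "c = (A\<^sup>2 + B\<^sup>2 + 2) / 2"
  have c: "0 < c" using zero_le_power2[of A] zero_le_power2[of B] by (simp add: c_def add_nonneg_pos)
  have "Const (e * c) + d * (x * y) \<in> sum_cone V K W L"
    if e: "0 < e" and d: "d \<in> polys_in V" "\<And>a. a \<in> K \<Longrightarrow> \<bar>poly_eval d a\<bar> \<le> e" for e d
  proof -
    define t where "t = sqrt e"
    have t: "0 < t" "t * t = e" using e by (auto simp: t_def)
    \<comment> \<open>Scales the squares so that the mixed term becomes d x y instead of its
      double.\<close>
    define h where "h = sqrt (1/2)"
    have hh: "Const h * (Const h * q) * 2 = q" for q :: "('a, 'b, 'c) xyz_poly"
    proof -
      have "h * h * 2 = 1" by (simp add: h_def)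
      then have "Const (h * h * 2) = (1 :: ('a, 'b, 'c) xyz_poly)" by (simp only: Const_simps(2))
      then have "Const h * Const h * 2 = (1 :: ('a, 'b, 'c) xyz_poly)" by (simp only: Const_simps(4) Const_numeral)
      moreover have "Const h * (Const h * q) * 2 = Const h * Const h * 2 * q" by (simp add: mult_ac)
      ultimately show ?thesis by simp
    qed
    define z where "z = Const (1/t) * (d * x)"
    have z: "z \<in> polys_in V" unfolding z_def by (intro polys_in_simps Const_in d prod)
    define u where "u = Const (e * (A\<^sup>2 + 1) / 2) - (Const h * z)\<^sup>2"
    define w where "w = Const (e * (B\<^sup>2 + 1) / 2) - (Const (h * t) * y)\<^sup>2"
    define s where "s = (Const h * z + Const (h * t) * y)\<^sup>2"
    have VW: "polys_in V \<subseteq> polys_in (V \<union> W)" "polys_in W \<subseteq> polys_in (V \<union> W)" by (intro polys_in_mono; blast)+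
    have "s \<in> sos (polys_in (V \<union> W))" unfolding s_def
      by (intro sos_square polys_in_simps Const_in) (use z prod VW in blast)+
    moreover have "u \<in> pos_on V K"
      unfolding pos_on_def
    proof (intro CollectI conjI ballI)
      show "u \<in> polys_in V" unfolding u_def by (intro polys_in_simps Const_in z)
      fix a assume a: "a \<in> K"
      have "(poly_eval d a)\<^sup>2 \<le> e\<^sup>2" "(poly_eval x a)\<^sup>2 \<le> A\<^sup>2"
        using power_mono[OF d(2)[OF a] abs_ge_zero, of 2] power_mono[OF A[OF a] abs_ge_zero, of 2] by simp_all
      then have "(poly_eval d a)\<^sup>2 * (poly_eval x a)\<^sup>2 \<le> e\<^sup>2 * A\<^sup>2" by (intro mult_mono) auto
      moreover have "e * (poly_eval z a)\<^sup>2 = (poly_eval d a)\<^sup>2 * (poly_eval x a)\<^sup>2"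
        unfolding t(2)[symmetric] z_def using t(1) by (simp add: power_mult_distrib power2_eq_square)
      ultimately have "e * (poly_eval z a)\<^sup>2 \<le> e * (e * A\<^sup>2)" by (simp add: power2_eq_square mult.assoc)
      then have "(poly_eval z a)\<^sup>2 \<le> e * A\<^sup>2" using e by simp
      then show "0 < poly_eval u a" using e by (simp add: u_def h_def power_mult_distrib algebra_simps)
    qed
    moreover have "w \<in> pos_on W L"
      unfolding pos_on_def
    proof (intro CollectI conjI ballI)
      show "w \<in> polys_in W" unfolding w_def by (intro polys_in_simps Const_in prod)
      fix a assume a: "a \<in> L"
      have "(poly_eval y a)\<^sup>2 \<le> B\<^sup>2" using power_mono[OF B[OF a] abs_ge_zero, of 2] by simp
      then have "e * (poly_eval y a)\<^sup>2 \<le> e * B\<^sup>2" using e by simp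
      moreover have "(h * t * poly_eval y a)\<^sup>2 = e * (poly_eval y a)\<^sup>2 / 2"
        using e by (simp add: h_def t_def power_mult_distrib)
      moreover have "poly_eval w a = e * (B\<^sup>2 + 1) / 2 - (h * t * poly_eval y a)\<^sup>2" by (simp add: w_def)
      moreover have "e * (B\<^sup>2 + 1) / 2 = e * B\<^sup>2 / 2 + e / 2" by (simp add: field_simps)
      ultimately show "0 < poly_eval w a" using e by linarith
    qed
    moreover have "Const (e * c) + d * (x * y) = s + u + w"
    proof -
      have 1: "s + u + w = (Const (e * (A\<^sup>2 + 1) / 2) + Const (e * (B\<^sup>2 + 1) / 2)) + Const h * (Const h * ((Const t * z) * y)) * 2"
        unfolding s_def u_def w_def by (simp add: Const_simps(4) power2_eq_square algebra_simps)
      have 2: "Const t * z = d * x" unfolding z_def using Const_cancel(2)[of t "d * x"] t(1) by (simp add: inverse_eq_divide)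
      have "e * (A\<^sup>2 + 1) / 2 + e * (B\<^sup>2 + 1) / 2 = e * c"
        unfolding c_def add_divide_distrib[symmetric] distrib_left[symmetric] times_divide_eq_right[symmetric] by simp
      then have 3: "Const (e * (A\<^sup>2 + 1) / 2) + Const (e * (B\<^sup>2 + 1) / 2) = (Const (e * c) :: ('a, 'b, 'c) xyz_poly)"
        using Const_simps(3) by metis
      show ?thesis unfolding 1 2 3 hh by (simp only: mult.assoc)
    qed
    ultimately show ?thesis unfolding sum_cone_def by blast
  qed
  then show ?case using c by blast
next
  case (add r r')
  from add.IH(1) obtain c where c: "0 < c"
    "\<forall>e>0. \<forall>d\<in>polys_in V. (\<forall>a\<in>K. \<bar>poly_eval d a\<bar> \<le> e) \<longrightarrow> Const (e * c) + d * r \<in> sum_cone V K W L"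
    by blast
  from add.IH(2) obtain c' where c': "0 < c'"
    "\<forall>e>0. \<forall>d\<in>polys_in V. (\<forall>a\<in>K. \<bar>poly_eval d a\<bar> \<le> e) \<longrightarrow> Const (e * c') + d * r' \<in> sum_cone V K W L"
    by blast
  have "Const (e * (c + c')) + d * (r + r') \<in> sum_cone V K W L"
    if "0 < e" "d \<in> polys_in V" "\<forall>a\<in>K. \<bar>poly_eval d a\<bar> \<le> e" for e d
  proof -
    have "(Const (e * c) + d * r) + (Const (e * c') + d * r') \<in> sum_cone V K W L"
      by (intro sum_cone_add c(2)[rule_format] c'(2)[rule_format]) (use that in auto)
    moreover have "(Const (e * c) + d * r) + (Const (e * c') + d * r') = Const (e * (c + c')) + d * (r + r')"
      by (simp add: distrib_left Const_simps(3) add_ac)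
    ultimately show ?thesis by metis
  qed
  then show ?case using c(1) c'(1) by (intro exI[of _ "c + c'"]) auto
qed

text \<open>Written u q^2 = (w q)^2 + (u - w^2) q^2 with w^2 close to u on \<open>K\<close>, the
  last term is a small multiple of the fixed polynomial q^2. The accuracy \<delta>/c is chosen after
  the constant c belonging to q^2 is known.\<close>

lemma weighted_square_in_sum_cone:
  assumes bdd: "bounded_on V K" "bounded_on W L" and "sqrt_approx V K"
    and u: "u \<in> pos_on V K" and q: "q \<in> polys_in (V \<union> W)" and \<delta>: "0 < \<delta>"
  shows "Const \<delta> + u * q\<^sup>2 \<in> sum_cone V K W L"
proof -
  obtain c where c: "0 < c" "\<And>e d. 0 < e \<Longrightarrow> d \<in> polys_in V \<Longrightarrow> (\<forall>a\<in>K. \<bar>poly_eval d a\<bar> \<le> e) \<Longrightarrow>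
      Const (e * c) + d * q\<^sup>2 \<in> sum_cone V K W L"
    using small_multiple_in_sum_cone[OF bdd polys_in_simps(7)[OF q], of 2] by blast
  have e: "0 < \<delta> / c" using c \<delta> by simp
  then obtain w where w: "w \<in> polys_in V" "\<forall>a\<in>K. \<bar>poly_eval (u - w\<^sup>2) a\<bar> \<le> \<delta> / c"
    using assms(3) u unfolding sqrt_approx_def by blast
  have "u - w\<^sup>2 \<in> polys_in V" using u w by (intro polys_in_simps) (auto simp: pos_on_def)
  from c(2)[OF e this w(2)] have "Const \<delta> + (u - w\<^sup>2) * q\<^sup>2 \<in> sum_cone V K W L" using c(1) by simp
  moreover have "w \<in> polys_in (V \<union> W)" using w(1) polys_in_mono[of V "V \<union> W"] by blast
  then have "(w * q)\<^sup>2 \<in> sos (polys_in (V \<union> W))" by (intro sos_square polys_in_simps q)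
  ultimately have "(w * q)\<^sup>2 + (Const \<delta> + (u - w\<^sup>2) * q\<^sup>2) \<in> sum_cone V K W L" by (rule sum_cone_sos_add[rotated])
  moreover have "(w * q)\<^sup>2 + (Const \<delta> + (u - w\<^sup>2) * q\<^sup>2) = Const \<delta> + u * q\<^sup>2"
    by (simp add: power_mult_distrib algebra_simps)
  ultimately show ?thesis by metis
qed

text \<open>The quadratic module generated by \<open>U\<close>. Taking as generators all polynomials
  positive on one of the two sets gives the archimedean property and avoids products of generators
  from different groups.\<close>

inductive_set weighted_squares :: "('n, 'm, 'p) xyz_poly set \<Rightarrow> ('n, 'm, 'p) xyz_poly set \<Rightarrow> ('n, 'm, 'p) xyz_poly set" for R U where
  base: "u \<in> U \<Longrightarrow> q \<in> R \<Longrightarrow> u * q\<^sup>2 \<in> weighted_squares R U"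
| add: "x \<in> weighted_squares R U \<Longrightarrow> y \<in> weighted_squares R U \<Longrightarrow> x + y \<in> weighted_squares R U"

lemma weighted_squares_gen: "subring_set R \<Longrightarrow> u \<in> U \<Longrightarrow> u \<in> weighted_squares R U"
  using weighted_squares.base[OF _ subring_setD(2)] by fastforce

lemma qmod_weighted_squares:
  assumes "1 \<in> U" "U \<subseteq> polys_in V"
  shows "qmod V (weighted_squares (polys_in V) U)"
  unfolding qmod_def
proof (intro conjI ballI)
  have "x \<in> polys_in V" if "x \<in> weighted_squares (polys_in V) U" for x
    using that
  proof (induction rule: weighted_squares.induct)
    case (base u q)
    then show ?case using assms(2) by (intro polys_in_simps(5,7)) auto
  next
    case (add x y)
    then show ?case by (intro polys_in_simps(3))
  qed
  then show "weighted_squares (polys_in V) U \<subseteq> polys_in V" by blast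
  show "1 \<in> weighted_squares (polys_in V) U" by (rule weighted_squares_gen[OF subring_polys_in assms(1)])
next
  fix a x assume a: "a \<in> polys_in V" and "x \<in> weighted_squares (polys_in V) U"
  from this(2) show "a\<^sup>2 * x \<in> weighted_squares (polys_in V) U"
  proof (induction rule: weighted_squares.induct)
    case (base u q)
    have "a\<^sup>2 * (u * q\<^sup>2) = u * (a * q)\<^sup>2" by (simp add: power_mult_distrib mult_ac)
    then show ?case using weighted_squares.base[OF base(1) polys_in_simps(5)[OF a base(2)]] by simp
  qed (simp add: distrib_left weighted_squares.add)
qed (rule weighted_squares.add)

text \<open>The representation theorem is applied to f - \<delta>/2; the other \<delta>/2 pays for
  replacing its finitely many weights by squares. The premises \<open>closed\<close> recover the
  product set from the nonnegativity of the generators.\<close>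

theorem product_positivstellensatz:
  assumes bdd: "bounded_on V K" "bounded_on W L" and sqrt: "sqrt_approx V K" "sqrt_approx W L"
    and closed: "\<And>a. (\<And>u. u \<in> pos_on V K \<Longrightarrow> 0 \<le> poly_eval u a) \<Longrightarrow> a \<in> K"
      "\<And>a. (\<And>u. u \<in> pos_on W L \<Longrightarrow> 0 \<le> poly_eval u a) \<Longrightarrow> a \<in> L"
    and fin: "finite V" "finite W" "V \<inter> W = {}" and f: "f \<in> polys_in (V \<union> W)"
    and \<delta>: "0 < \<delta>" "\<And>a. a \<in> K \<Longrightarrow> a \<in> L \<Longrightarrow> \<delta> < poly_eval f a"
  shows "f \<in> sum_cone V K W L"
proof -
  let ?R = "polys_in (V \<union> W)"
  let ?U = "pos_on V K \<union> pos_on W L"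
  let ?Q = "weighted_squares ?R ?U"
  have VW: "polys_in V \<subseteq> ?R" "polys_in W \<subseteq> ?R" by (intro polys_in_mono; blast)+
  have U: "1 \<in> ?U" "?U \<subseteq> ?R" using VW polys_in_simps(2) by (auto simp: pos_on_def)
  have Q: "qmod (V \<union> W) ?Q" by (rule qmod_weighted_squares[OF U])
  have gen: "u \<in> ?Q" if "u \<in> ?U" for u by (rule weighted_squares_gen[OF subring_polys_in that])
  have norm: "\<exists>N. Const N - (\<Sum>v\<in>V. (Var v)\<^sup>2) \<in> pos_on V K"
    if VK: "bounded_on V K" for V :: "('a, 'b, 'c) xyz_var set" and K
  proof -
    have *: "(\<Sum>v\<in>V. (Var v)\<^sup>2) \<in> polys_in V"
      by (intro subring_set_sum[OF subring_polys_in] polys_in_simps(7) Var_in)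
    then obtain B where B: "\<And>a. a \<in> K \<Longrightarrow> \<bar>poly_eval (\<Sum>v\<in>V. (Var v)\<^sup>2) a\<bar> \<le> B" using VK unfolding bounded_on_def by blast
    have "Const (B + 1) - (\<Sum>v\<in>V. (Var v)\<^sup>2) \<in> pos_on V K"
      unfolding pos_on_def
    proof (intro CollectI conjI ballI)
      show "Const (B + 1) - (\<Sum>v\<in>V. (Var v)\<^sup>2) \<in> polys_in V" by (intro polys_in_simps Const_in *)
      fix a assume "a \<in> K"
      from B[OF this] have "poly_eval (\<Sum>v\<in>V. (Var v)\<^sup>2) a \<le> B" by linarith
      then show "0 < poly_eval (Const (B + 1) - (\<Sum>v\<in>V. (Var v)\<^sup>2)) a" unfolding poly_eval_simps poly_eval_Const by linarith
    qed
    then show ?thesis by blast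
  qed
  obtain N M where "Const N - (\<Sum>v\<in>V. (Var v)\<^sup>2) \<in> pos_on V K" "Const M - (\<Sum>v\<in>W. (Var v)\<^sup>2) \<in> pos_on W L"
    using norm bdd by blast
  then have "(Const N - (\<Sum>v\<in>V. (Var v)\<^sup>2)) + (Const M - (\<Sum>v\<in>W. (Var v)\<^sup>2)) \<in> ?Q" using gen weighted_squares.add by blast
  then have "Const (N + M) - (\<Sum>v\<in>V \<union> W. (Var v)\<^sup>2) \<in> ?Q"
    by (simp add: sum.union_disjoint[OF fin] Const_simps(3) algebra_simps)
  then have arch: "arch (V \<union> W) ?Q" using arch_from_norm[OF Q] fin by blast
  have "f + Const (- (\<delta> / 2)) \<in> ?Q"
  proof (rule archimedean_positivstellensatz[OF Q arch])
    show "f + Const (- (\<delta> / 2)) \<in> ?R" by (intro polys_in_simps f Const_in)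
    fix a assume "\<And>q. q \<in> ?Q \<Longrightarrow> 0 \<le> poly_eval q a"
    then have "a \<in> K" "a \<in> L" using gen by (blast intro: closed)+
    from \<delta>(2)[OF this] show "0 < poly_eval (f + Const (- (\<delta> / 2))) a" using \<delta>(1) by simp
  qed
  \<comment> \<open>The error \<open>e\<close> is arbitrary so that a sum of two terms can share it
    in halves.\<close>
  moreover have "Const e + x \<in> sum_cone V K W L" if "x \<in> ?Q" "0 < e" for x e
    using that
  proof (induction arbitrary: e rule: weighted_squares.induct)
    case (base u q)
    then show ?case
    proof (elim UnE)
      assume "u \<in> pos_on V K"
      then show ?thesis using weighted_square_in_sum_cone[OF bdd sqrt(1)] base by blast
    next
      assume u: "u \<in> pos_on W L"
      have "q \<in> polys_in (W \<union> V)" using base by (simp add: Un_commute)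
      from weighted_square_in_sum_cone[OF bdd(2,1) sqrt(2) u this base(3)] show ?thesis
        by (simp add: sum_cone_commute)
    qed
  next
    case (add x y)
    have "(Const (e/2) + x) + (Const (e/2) + y) \<in> sum_cone V K W L" using add by (intro sum_cone_add[OF add.IH(1) add.IH(2)]) simp_all
    moreover have "(Const (e/2) + x) + (Const (e/2) + y) = Const e + (x + y)"
      using Const_simps(3)[of "e/2" "e/2", symmetric] by (simp add: algebra_simps)
    ultimately show ?case by metis
  qed
  ultimately have "Const (\<delta> / 2) + (f + Const (- (\<delta> / 2))) \<in> sum_cone V K W L" using \<delta>(1) by simp
  then show ?thesis by (simp add: Const_simps(5))
qed

section \<open>The sparse Positivstellensatz\<close>

lemma norm_sq_vec: "(norm (x :: real ^ 'i::finite))\<^sup>2 = (\<Sum>i\<in>UNIV. (x $ i)\<^sup>2)"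
  by (simp add: norm_vec_def L2_set_def sum_nonneg)

text \<open>The polynomial r^2 - |x|^2 vanishes on the sphere and is not in \<open>pos_on\<close>;
  it is raised by \<open>e\<close>, which then tends to 0.\<close>

lemma pos_on_cball_closed:
  fixes c :: "'i::finite \<Rightarrow> ('n, 'm, 'p) xyz_var"
  assumes c: "inj c" and r: "0 \<le> r"
    and a: "\<And>u. u \<in> pos_on (range c) (cylinder c (cball 0 r)) \<Longrightarrow> 0 \<le> poly_eval u a"
  shows "a \<in> cylinder c (cball 0 r)"
proof -
  have eval: "poly_eval (\<Sum>i\<in>UNIV. (Var (c i))\<^sup>2) b = (norm (\<chi> i. b (c i)))\<^sup>2" for b
    by (simp add: poly_eval_sum norm_sq_vec)
  have "(norm (\<chi> i. a (c i)))\<^sup>2 \<le> r\<^sup>2 + e" if e: "0 < e" for e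
  proof -
    define u where "u = Const (r\<^sup>2 + e) - (\<Sum>i\<in>UNIV. (Var (c i))\<^sup>2)"
    have "u \<in> pos_on (range c) (cylinder c (cball 0 r))"
      unfolding pos_on_def
    proof (intro CollectI conjI ballI)
      show "u \<in> polys_in (range c)" unfolding u_def
        by (intro polys_in_simps(4) Const_in subring_set_sum[OF subring_polys_in] polys_in_simps(7) Var_in) simp
      fix b assume "b \<in> cylinder c (cball 0 r)"
      then have "norm (\<chi> i. b (c i)) \<le> r" by (simp add: cylinder_def)
      then have "(norm (\<chi> i. b (c i)))\<^sup>2 \<le> r\<^sup>2" by (intro power_mono) auto
      then show "0 < poly_eval u b" unfolding u_def poly_eval_simps(6) eval poly_eval_Const using e by linarith
    qed
    from a[OF this] show ?thesis unfolding u_def poly_eval_simps(6) eval poly_eval_Const by linarith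
  qed
  then have "(norm (\<chi> i. a (c i)))\<^sup>2 \<le> r\<^sup>2" by (rule field_le_epsilon)
  then have "norm (\<chi> i. a (c i)) \<le> r" using r by (rule power2_le_imp_le)
  then show ?thesis by (simp add: cylinder_def)
qed

section \<open>Passage between coordinate vectors and assignments, and certificates on the two
  compact factors\<close>

lemma inj_VX: "inj VX" and inj_VY: "inj VY" and inj_VZ: "inj VZ"
  by (auto intro: injI)

lemma RX_eval: "q \<in> RX \<Longrightarrow> poly_eval q (point x y z) = poly_eval q (point x y' z')"
  unfolding RX_def by (erule poly_eval_cong) auto

lemma RXY_eval: "q \<in> RXY \<Longrightarrow> poly_eval q (point x y z) = poly_eval q (point x y z')"
  unfolding RXY_def by (erule poly_eval_cong) auto

lemma RYZ_eval: "q \<in> RYZ \<Longrightarrow> poly_eval q (point x y z) = poly_eval q (point x' y z)"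
  unfolding RYZ_def by (erule poly_eval_cong) auto

lemma point_surj: "point (\<chi> i. a (VX i)) (\<chi> i. a (VY i)) (\<chi> i. a (VZ i)) = a"
proof
  fix v show "point (\<chi> i. a (VX i)) (\<chi> i. a (VY i)) (\<chi> i. a (VZ i)) v = a v" by (cases v) auto
qed

lemma K_x_iff:
  assumes "\<And>j. j \<in> I \<Longrightarrow> g j \<in> RX"
  shows "(\<chi> i. a (VX i)) \<in> K_x I g \<longleftrightarrow> (\<forall>j\<in>I. 0 \<le> poly_eval (g j) a)"
proof -
  have "poly_eval (g j) (point (\<chi> i. a (VX i)) 0 0) = poly_eval (g j) a" if "j \<in> I" for j
    using RX_eval[OF assms[OF that]] point_surj by metis
  then show ?thesis by (simp add: K_x_def)
qed

lemma K_yz_iff: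
  assumes "\<And>k. k \<in> I \<Longrightarrow> h k \<in> RYZ"
  shows "((\<chi> i. a (VY i)), (\<chi> i. a (VZ i))) \<in> K_yz I h \<longleftrightarrow> (\<forall>k\<in>I. 0 \<le> poly_eval (h k) a)"
proof -
  have "poly_eval (h k) (point 0 (\<chi> i. a (VY i)) (\<chi> i. a (VZ i))) = poly_eval (h k) a" if "k \<in> I" for k
    using RYZ_eval[OF assms[OF that]] point_surj by metis
  then show ?thesis by (simp add: K_yz_def)
qed

lemma sum_range_VX: "(\<Sum>v\<in>range VX. f v) = (\<Sum>i\<in>UNIV. f (VX i))"
  by (simp add: sum.reindex[OF inj_VX])

lemma sum_range_VYZ:
  fixes f :: "('n, 'm::finite, 'p::finite) xyz_var \<Rightarrow> 'a::comm_monoid_add"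
  shows "(\<Sum>v\<in>range VY \<union> range VZ. f v) = (\<Sum>i\<in>UNIV. f (VY i)) + (\<Sum>i\<in>UNIV. f (VZ i))"
proof -
  have "range VY \<inter> range VZ = ({} :: ('n, 'm, 'p) xyz_var set)" by auto
  then show ?thesis by (simp add: sum.union_disjoint sum.reindex[OF inj_VY] sum.reindex[OF inj_VZ])
qed

lemma pos_on_K_x:
  fixes g :: "'j \<Rightarrow> ('n::finite, 'm::finite, 'p::finite) xyz_poly"
  assumes I: "finite I" and g: "\<And>j. j \<in> I \<Longrightarrow> g j \<in> RX" and K: "compact (K_x I g)"
    and u: "u \<in> pos_on (range VX) (cylinder VX (K_x I g))"
  shows "u \<in> poly_preordering RX I g"
    and "Const N - norm_sq_X \<in> quadratic_module RX I g \<Longrightarrow> u \<in> quadratic_module RX I g"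
proof -
  have pos: "0 < poly_eval u a" if "\<And>j. j \<in> I \<Longrightarrow> 0 \<le> poly_eval (g j) a" for a
    using u that K_x_iff[of I g a, OF g] by (auto simp: pos_on_def cylinder_def)
  have uX: "u \<in> polys_in (range VX)" using u by (simp add: pos_on_def)
  have g': "\<And>j. j \<in> I \<Longrightarrow> g j \<in> polys_in (range VX)" using g by (simp add: RX_def)
  obtain B where B: "\<And>x. x \<in> K_x I g \<Longrightarrow> norm x \<le> B" using compact_imp_bounded[OF K] unfolding bounded_iff by blast
  show "u \<in> poly_preordering RX I g"
    unfolding RX_def
  proof (rule schmuedgen[OF I _ g' uX _ pos])
    fix a assume "\<And>j. j \<in> I \<Longrightarrow> 0 \<le> poly_eval (g j) a"
    then have "(\<chi> i. a (VX i)) \<in> K_x I g" using K_x_iff[of I g a, OF g] by blast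
    from power_mono[OF B[OF this] norm_ge_zero, of 2]
    show "(\<Sum>v\<in>range VX. (a v)\<^sup>2) < B\<^sup>2 + 1" by (simp add: norm_sq_vec sum_range_VX)
  qed simp_all
  assume N: "Const N - norm_sq_X \<in> quadratic_module RX I g"
  show "u \<in> quadratic_module RX I g"
    unfolding RX_def
  proof (rule putinar[OF I _ g' uX _ pos])
    show "Const N - (\<Sum>v\<in>range VX. (Var v)\<^sup>2) \<in> quadratic_module (polys_in (range VX)) I g"
      using N unfolding RX_def norm_sq_X_def by (simp add: sum_range_VX)
  qed simp_all
qed

lemma positive_on_K_yz:
  fixes h :: "'k \<Rightarrow> ('n::finite, 'm::finite, 'p::finite) xyz_poly"
  assumes I: "finite I" and h: "\<And>k. k \<in> I \<Longrightarrow> h k \<in> RYZ" and K: "compact (K_yz I h)"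
    and u: "u \<in> RYZ" "\<And>y z. (y, z) \<in> K_yz I h \<Longrightarrow> 0 < poly_eval u (point 0 y z)"
  shows "u \<in> poly_preordering RYZ I h"
    and "Const N - norm_sq_YZ \<in> quadratic_module RYZ I h \<Longrightarrow> u \<in> quadratic_module RYZ I h"
proof -
  have pos: "0 < poly_eval u a" if "\<And>k. k \<in> I \<Longrightarrow> 0 \<le> poly_eval (h k) a" for a
  proof -
    have "((\<chi> i. a (VY i)), (\<chi> i. a (VZ i))) \<in> K_yz I h" using K_yz_iff[of I h a, OF h] that by blast
    from u(2)[OF this] show ?thesis using RYZ_eval[OF u(1)] point_surj by metis
  qed
  have uYZ: "u \<in> polys_in (range VY \<union> range VZ)" using u by (simp add: RYZ_def)
  have h': "\<And>k. k \<in> I \<Longrightarrow> h k \<in> polys_in (range VY \<union> range VZ)" using h by (simp add: RYZ_def)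
  obtain B where B: "\<And>w. w \<in> K_yz I h \<Longrightarrow> norm w \<le> B" using compact_imp_bounded[OF K] unfolding bounded_iff by blast
  show "u \<in> poly_preordering RYZ I h"
    unfolding RYZ_def
  proof (rule schmuedgen[OF I _ h' uYZ _ pos])
    fix a assume "\<And>k. k \<in> I \<Longrightarrow> 0 \<le> poly_eval (h k) a"
    then have "((\<chi> i. a (VY i)), (\<chi> i. a (VZ i))) \<in> K_yz I h" using K_yz_iff[of I h a, OF h] by blast
    from power_mono[OF B[OF this] norm_ge_zero, of 2]
    show "(\<Sum>v\<in>range VY \<union> range VZ. (a v)\<^sup>2) < B\<^sup>2 + 1"
      by (simp add: norm_Pair norm_sq_vec sum_range_VYZ sum_nonneg)
  qed simp_all
  assume N: "Const N - norm_sq_YZ \<in> quadratic_module RYZ I h"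
  show "u \<in> quadratic_module RYZ I h"
    unfolding RYZ_def
  proof (rule putinar[OF I _ h' uYZ _ pos])
    show "Const N - (\<Sum>v\<in>range VY \<union> range VZ. (Var v)\<^sup>2) \<in> quadratic_module (polys_in (range VY \<union> range VZ)) I h"
      using N unfolding RYZ_def norm_sq_YZ_def by (simp add: sum_range_VYZ)
  qed simp_all
qed

text \<open>By uniform continuity a minimizer for one parameter is almost optimal for a nearby one,
  in both directions.\<close>

lemma continuous_on_min_over:
  fixes F :: "'a::metric_space \<times> 'b::metric_space \<Rightarrow> real"
  assumes K: "compact K" "K \<noteq> {}" and B: "compact B" and F: "continuous_on (K \<times> B) F"
  shows "continuous_on B (\<lambda>y. INF x\<in>K. F (x, y))"
    and "x \<in> K \<Longrightarrow> y \<in> B \<Longrightarrow> (INF x\<in>K. F (x, y)) \<le> F (x, y)"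
    and "y \<in> B \<Longrightarrow> \<exists>x\<in>K. (INF x\<in>K. F (x, y)) = F (x, y)"
proof -
  have attained: "\<exists>x\<in>K. \<forall>x'\<in>K. F (x, y) \<le> F (x', y)" if "y \<in> B" for y
  proof (rule continuous_attains_inf[OF K])
    show "continuous_on K (\<lambda>x. F (x, y))"
      by (rule continuous_on_compose2[OF F]) (use that in \<open>auto intro!: continuous_intros\<close>)
  qed
  have inf: "\<exists>x\<in>K. (INF x\<in>K. F (x, y)) = F (x, y) \<and> (\<forall>x'\<in>K. F (x, y) \<le> F (x', y))" if y: "y \<in> B" for y
  proof -
    obtain x where x: "x \<in> K" "\<forall>x'\<in>K. F (x, y) \<le> F (x', y)" using attained[OF y] by blast
    have "(INF x\<in>K. F (x, y)) = F (x, y)" by (rule cInf_eq_minimum) (use x in auto)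
    with x show ?thesis by blast
  qed
  then show le: "\<And>x y. x \<in> K \<Longrightarrow> y \<in> B \<Longrightarrow> (INF x\<in>K. F (x, y)) \<le> F (x, y)" by fastforce
  show "y \<in> B \<Longrightarrow> \<exists>x\<in>K. (INF x\<in>K. F (x, y)) = F (x, y)" using inf by blast
  have unif: "uniformly_continuous_on (K \<times> B) F"
    by (intro compact_uniformly_continuous F compact_Times K B)
  show "continuous_on B (\<lambda>y. INF x\<in>K. F (x, y))"
    unfolding continuous_on_iff
  proof (intro ballI allI impI)
    fix y and e :: real assume y: "y \<in> B" and e: "0 < e"
    obtain d where d: "0 < d" "\<And>w w'. w \<in> K \<times> B \<Longrightarrow> w' \<in> K \<times> B \<Longrightarrow> dist w' w < d \<Longrightarrow> dist (F w') (F w) < e"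
      using unif e unfolding uniformly_continuous_on_def by blast
    have half: "(INF x\<in>K. F (x, y1)) < (INF x\<in>K. F (x, y2)) + e" if "y1 \<in> B" "y2 \<in> B" "dist y1 y2 < d" for y1 y2
    proof -
      from inf[OF that(2)] obtain x where x: "x \<in> K" "(INF x\<in>K. F (x, y2)) = F (x, y2)" by blast
      have "dist (x, y1) (x, y2) < d" using that(3) by (simp add: dist_Pair_Pair)
      then have "dist (F (x, y1)) (F (x, y2)) < e" using d(2) x that by blast
      then have "F (x, y1) < F (x, y2) + e" by (simp add: dist_real_def)
      then show ?thesis using le[OF x(1) that(1)] x(2) by linarith
    qed
    have "dist (INF x\<in>K. F (x, y')) (INF x\<in>K. F (x, y)) < e" if "y' \<in> B" "dist y' y < d" for y'
      using half[OF that(1) y that(2)] half[OF y that(1)] that(2) by (simp add: dist_real_def dist_commute)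
    then show "\<exists>d>0. \<forall>y'\<in>B. dist y' y < d \<longrightarrow> dist (INF x\<in>K. F (x, y')) (INF x\<in>K. F (x, y)) < e"
      using d(1) by blast
  qed
qed

lemma continuous_on_point:
  assumes "continuous_on S f" "continuous_on S g" "continuous_on S h"
  shows "continuous_on S (\<lambda>w. poly_eval q (point (f w) (g w) (h w)))"
proof (rule continuous_on_poly_eval)
  fix v show "continuous_on S (\<lambda>w. point (f w) (g w) (h w) v)"
    using assms by (cases v) (auto intro!: continuous_intros)
qed

text \<open>With 2e the minimum of f and p within e/2 of e - l on the ball, both margins exceed e/2:
  f1 \<ge> l gives it for f1 + p, and f2 \<ge> 2e - l on \<open>K_yz\<close>, valid because l is
  attained, gives it for f2 - p.\<close>

lemma sparse_decomposition:
  fixes g :: "'j \<Rightarrow> ('n::finite, 'm::finite, 'p::finite) xyz_poly" and h :: "'k \<Rightarrow> ('n, 'm, 'p) xyz_poly"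
  assumes g: "\<And>j. j \<in> Ix \<Longrightarrow> g j \<in> RX" and Kx: "compact (K_x Ix g)" "K_x Ix g \<noteq> {}"
    and Kyz: "compact (K_yz Iyz h)" "K_yz Iyz h \<noteq> {}" and f: "f \<in> RXY + RYZ"
    and pos: "\<And>x y z. x \<in> K_x Ix g \<Longrightarrow> (y, z) \<in> K_yz Iyz h \<Longrightarrow> 0 < poly_eval f (point x y z)"
  shows "\<exists>s u w. s \<in> sos RXY \<and> u \<in> pos_on (range VX) (cylinder VX (K_x Ix g)) \<and> w \<in> RYZ \<and>
    (\<forall>y z. (y, z) \<in> K_yz Iyz h \<longrightarrow> 0 < poly_eval w (point 0 y z)) \<and> f = s + u + w"
proof -
  let ?K = "K_x Ix g" and ?L = "K_yz Iyz h"
  obtain f1 f2 where f12: "f = f1 + f2" "f1 \<in> RXY" "f2 \<in> RYZ" using f by (rule set_plus_elim)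
  have "\<exists>w\<in>?K \<times> ?L. \<forall>w'\<in>?K \<times> ?L. poly_eval f (point (fst w) (fst (snd w)) (snd (snd w)))
      \<le> poly_eval f (point (fst w') (fst (snd w')) (snd (snd w')))"
    by (rule continuous_attains_inf) (use Kx Kyz in \<open>auto intro!: compact_Times continuous_on_point continuous_intros\<close>)
  then obtain w0 where w0: "w0 \<in> ?K \<times> ?L" "\<forall>w'\<in>?K \<times> ?L. poly_eval f (point (fst w0) (fst (snd w0)) (snd (snd w0)))
      \<le> poly_eval f (point (fst w') (fst (snd w')) (snd (snd w')))" by blast
  obtain x0 y0 z0 where w0_eq: "w0 = (x0, y0, z0)" by (rule prod_cases3)
  have min: "x0 \<in> ?K" "(y0, z0) \<in> ?L" using w0(1) w0_eq by auto
  have min_le: "poly_eval f (point x0 y0 z0) \<le> poly_eval f (point x y z)" if "x \<in> ?K" "(y, z) \<in> ?L" for x y z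
    using bspec[OF w0(2), of "(x, y, z)"] that w0_eq by simp
  define e where "e = poly_eval f (point x0 y0 z0) / 2"
  have e: "0 < e" "\<And>x y z. x \<in> ?K \<Longrightarrow> (y, z) \<in> ?L \<Longrightarrow> 2 * e \<le> poly_eval f (point x y z)"
    using pos[OF min(1,2)] min_le by (auto simp: e_def)
  obtain r where r: "\<And>w. w \<in> ?L \<Longrightarrow> norm w \<le> r" using compact_imp_bounded[OF Kyz(1)] unfolding bounded_iff by blast
  have r0: "0 \<le> r" using r[OF min(2)] norm_ge_zero order_trans by blast
  define B where "B = cball (0 :: real ^ 'm) r"
  have cB: "compact B" by (simp add: B_def)
  have LB: "y \<in> B" if "(y, z) \<in> ?L" for y z using r[OF that] norm_fst_le[of y z] by (simp add: B_def)
  define F where "F w = poly_eval f1 (point (fst w) (snd w) 0)" for w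
  define l where "l y = (INF x\<in>?K. F (x, y))" for y
  have "continuous_on (?K \<times> B) F" unfolding F_def by (intro continuous_on_point continuous_intros)
  note l = continuous_on_min_over[OF Kx cB this, folded l_def]
  have "continuous_on B (\<lambda>y. e - l y)" by (intro continuous_intros l(1))
  moreover have "0 < e / 2" using e(1) by simp
  ultimately obtain p :: "('n, 'm, 'p) xyz_poly" where p: "p \<in> polys_in (range VY)"
    "\<And>a. a \<in> cylinder VY B \<Longrightarrow> \<bar>e - l (\<chi> i. a (VY i)) - poly_eval p a\<bar> < e / 2"
    using approximate_cylinder[OF cB, of "\<lambda>y. e - l y" "e / 2" VY] by blast
  have p': "\<bar>e - l y - poly_eval p (point x y z)\<bar> < e / 2" if "y \<in> B" for x y z
    using p(2)[of "point x y z"] that by (simp add: cylinder_def)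
  have pR: "p \<in> RXY" "p \<in> RYZ" using p(1) polys_in_mono[of "range VY"] unfolding RXY_def RYZ_def by blast+
  have "f1 + p \<in> sum_cone (range VX) (cylinder VX ?K) (range VY) (cylinder VY B)"
  proof (rule product_positivstellensatz)
    show "bounded_on (range VX) (cylinder VX ?K)" "bounded_on (range VY) (cylinder VY B)"
      unfolding bounded_on_def B_def using bounded_cylinder inj_VX inj_VY Kx(1) compact_cball by blast+
    show "sqrt_approx (range VX) (cylinder VX ?K)" "sqrt_approx (range VY) (cylinder VY B)"
      unfolding B_def by (intro sqrt_approx_cylinder inj_VX inj_VY Kx(1) compact_cball)+
    show "a \<in> cylinder VY B" if "\<And>u. u \<in> pos_on (range VY) (cylinder VY B) \<Longrightarrow> 0 \<le> poly_eval u a"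
      for a :: "('n, 'm, 'p) xyz_var \<Rightarrow> real"
      unfolding B_def by (rule pos_on_cball_closed[OF inj_VY r0]) (use that B_def in blast)
    show "a \<in> cylinder VX ?K" if u: "\<And>u. u \<in> pos_on (range VX) (cylinder VX ?K) \<Longrightarrow> 0 \<le> poly_eval u a"
      for a :: "('n, 'm, 'p) xyz_var \<Rightarrow> real"
    proof -
      \<comment> \<open>The constraints are only nonnegative on \<open>K_x\<close>, so small
        positive shifts of them are tested.\<close>
      have "0 \<le> poly_eval (g j) a" if j: "j \<in> Ix" for j
      proof (rule field_le_epsilon)
        fix d :: real assume d: "0 < d"
        have "g j + Const d \<in> pos_on (range VX) (cylinder VX ?K)"
          unfolding pos_on_def
        proof (intro CollectI conjI ballI)
          show "g j + Const d \<in> polys_in (range VX)" using g[OF j] unfolding RX_def by (intro polys_in_simps Const_in)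
          fix b :: "('n, 'm, 'p) xyz_var \<Rightarrow> real" assume "b \<in> cylinder VX ?K"
          then have "0 \<le> poly_eval (g j) b" using K_x_iff[of Ix g b, OF g] j by (simp add: cylinder_def)
          then show "0 < poly_eval (g j + Const d) b" using d by simp
        qed
        from u[OF this] show "0 \<le> poly_eval (g j) a + d" by simp
      qed
      then show ?thesis using K_x_iff[of Ix g a, OF g] by (simp add: cylinder_def)
    qed
    show "f1 + p \<in> polys_in (range VX \<union> range VY)" using f12 pR unfolding RXY_def by (intro polys_in_simps)
    show "0 < e / 4" using e by simp
    fix a :: "('n, 'm, 'p) xyz_var \<Rightarrow> real" assume "a \<in> cylinder VX ?K" "a \<in> cylinder VY B"
    then have a: "(\<chi> i. a (VX i)) \<in> ?K" "(\<chi> i. a (VY i)) \<in> B" by (simp_all add: cylinder_def)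
    have "poly_eval f1 a = F ((\<chi> i. a (VX i)), (\<chi> i. a (VY i)))"
      using RXY_eval[OF f12(2)] point_surj unfolding F_def fst_conv snd_conv by metis
    moreover have "\<bar>e - l (\<chi> i. a (VY i)) - poly_eval p a\<bar> < e / 2" by (rule p(2)) fact
    ultimately show "e / 4 < poly_eval (f1 + p) a" unfolding poly_eval_simps(3) using l(2)[OF a] e(1) by linarith
  qed (auto)
  then obtain s u v where suv: "f1 + p = s + u + v" "s \<in> sos RXY" "u \<in> pos_on (range VX) (cylinder VX ?K)"
    "v \<in> pos_on (range VY) (cylinder VY B)" unfolding sum_cone_def RXY_def by blast
  \<comment> \<open>The part \<open>v\<close> in Y is positive on the ball, which contains the
    projection of \<open>K_yz\<close>, so it joins f2 - p in the ring of Y and Z.\<close>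
  define w where "w = v + (f2 - p)"
  have "v \<in> RYZ" using suv(4) polys_in_mono[of "range VY" "range VY \<union> range VZ"] unfolding pos_on_def RYZ_def by blast
  then have "w \<in> RYZ" using f12 pR unfolding w_def RYZ_def by (intro polys_in_simps)
  moreover have "0 < poly_eval w (point 0 y z)" if yz: "(y, z) \<in> ?L" for y z
  proof -
    have "point (0 :: real ^ 'n) y z \<in> cylinder VY B" using LB[OF yz] by (simp add: cylinder_def)
    then have v: "0 < poly_eval v (point 0 y z)" using suv(4) by (simp add: pos_on_def)
    obtain x where x: "x \<in> ?K" "l y = F (x, y)" using l(3)[OF LB[OF yz]] by blast
    have "2 * e \<le> poly_eval f (point x y z)" using e(2)[OF x(1) yz] .
    also have "\<dots> = l y + poly_eval f2 (point 0 y z)"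
      using RXY_eval[OF f12(2), of x y z 0] RYZ_eval[OF f12(3), of x y z 0] x(2) by (simp add: f12(1) F_def)
    finally show ?thesis using v p'[OF LB[OF yz], of 0 z] e(1)
      unfolding w_def poly_eval_simps(3,6) by linarith
  qed
  moreover have "f = s + u + w" using suv(1) by (simp add: f12(1) w_def algebra_simps)
  ultimately show ?thesis using suv by blast
qed

theorem theorem2p2:
  fixes g :: "'j \<Rightarrow> ('n::finite, 'm::finite, 'p::finite) xyz_poly"
    and h :: "'k \<Rightarrow> ('n, 'm, 'p) xyz_poly"
    and f :: "('n, 'm, 'p) xyz_poly"
    and Ix :: "'j set" and Iyz :: "'k set"
  assumes "finite Ix" and "finite Iyz"
    and "\<And>j. j \<in> Ix \<Longrightarrow> g j \<in> RX"
    and "\<And>k. k \<in> Iyz \<Longrightarrow> h k \<in> RYZ"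
    and "compact (K_x Ix g)" and "compact (K_yz Iyz h)"
    and "interior (K_x Ix g \<times> K_yz Iyz h) \<noteq> {}"
    and "f \<in> RXY + RYZ"
  shows "((\<forall>(x, y, z) \<in> K_x Ix g \<times> K_yz Iyz h. poly_eval f (point x y z) > 0)
           \<longrightarrow> f \<in> sos RXY + poly_preordering RX Ix g + poly_preordering RYZ Iyz h)
         \<and> ((\<forall>(x, y, z) \<in> K_x Ix g \<times> K_yz Iyz h. poly_eval f (point x y z) > 0)
           \<longrightarrow> ((\<exists>N. Const N - norm_sq_X \<in> quadratic_module RX Ix g)
                  \<longrightarrow> f \<in> sos RXY + quadratic_module RX Ix g + poly_preordering RYZ Iyz h)
             \<and> ((\<exists>N. Const N - norm_sq_YZ \<in> quadratic_module RYZ Iyz h)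
                  \<longrightarrow> f \<in> sos RXY + poly_preordering RX Ix g + quadratic_module RYZ Iyz h)
             \<and> ((\<exists>N. Const N - norm_sq_X \<in> quadratic_module RX Ix g) \<and>
                (\<exists>N. Const N - norm_sq_YZ \<in> quadratic_module RYZ Iyz h)
                  \<longrightarrow> f \<in> sos RXY + quadratic_module RX Ix g + quadratic_module RYZ Iyz h))"
proof -
  \<comment> \<open>Both factors are nonempty, so the minima taken in
    \<open>sparse_decomposition\<close> exist.\<close>
  have "K_x Ix g \<times> K_yz Iyz h \<noteq> {}" using assms(7) interior_subset by fastforce
  then have ne: "K_x Ix g \<noteq> {}" "K_yz Iyz h \<noteq> {}" by auto
  have main: "\<exists>s u w. s \<in> sos RXY \<and> u \<in> pos_on (range VX) (cylinder VX (K_x Ix g)) \<and> w \<in> RYZ \<and>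
    (\<forall>y z. (y, z) \<in> K_yz Iyz h \<longrightarrow> 0 < poly_eval w (point 0 y z)) \<and> f = s + u + w"
    if "\<forall>(x, y, z) \<in> K_x Ix g \<times> K_yz Iyz h. poly_eval f (point x y z) > 0"
    by (rule sparse_decomposition[OF assms(3,5) ne(1) assms(6) ne(2) assms(8)]) (use that in auto)
  note x = pos_on_K_x[OF assms(1,3,5)] and yz = positive_on_K_yz[OF assms(2,4,6)]
  \<comment> \<open>One decomposition serves all claims: \<open>u\<close> involves X only and
    \<open>w\<close> only Y and Z, so their certificates are chosen independently.\<close>
  show ?thesis
    using main x yz by (blast intro: set_plus_intro)
qed

end
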